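(* Let $D = D[3]$ be the Molchanov--Vainberg Laplacian in dimension $d=3$ and let $\kappa=4$. Let $\{\mathcal{E}_n\}_{n\ge 1}$ be the strictly decreasing sequence of (two-dimensional) thresholds in $(\cos^2(\pi/4),\cos(\pi/4))$ for $\kappa=4$ defined in the context. Then: (1) $(\cos(\pi/4),1) \subset \boldsymbol{\mu}_{\kappa}(D)$; (2) $0,\ \cos^3(\pi/4),\ \cos^2(\pi/4),\ \cos(\pi/4),\ 1 \in \boldsymbol{\theta}_{0,\kappa}(D)$; (3) $\{\mathcal{E}_n\}_{n\ge1} \subset (\cos^2(\pi/4),\cos(\pi/4)) \cap \boldsymbol{\Theta}_{\kappa}(D)$, with $\mathcal{E}_n \searrow \cos^2(\pi/4)$; (4) $\{\mathcal{E}_n \cos(\pi/4)\}_{n\ge1} \subset (\cos^3(\pi/4),\cos^2(\pi/4)) \cap \boldsymbol{\Theta}_{\kappa}(D)$, with $\mathcal{E}_n\cos(\pi/4) \searrow \cos^3(\pi/4)$.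
   Context: Operators. For $d \geq 1$ let $\mathscr{H}=\ell^2(\mathbb{Z}^d)$, let $S_i$ be the shift $(S_i^{\pm 1} u)(n) = u(n_1,\ldots,n_i \mp 1,\ldots,n_d)$, $\Delta_i = \frac12 (S_i + S_i^* )$ and $D=D[d] = \prod_{i=1}^d \Delta_i$ (Molchanov--Vainberg Laplacian); $\sigma(D)=[-1,1]$. Let $(N_i u)(n) = n_i u(n)$. For $j,\kappa \in \mathbb{N}^*=\{1,2,\ldots\}$ let $A_i(j,\kappa)$ be the closure of $\frac{1}{4\mathrm{i}}\left[(S_i^{j\kappa}-S_i^{-j\kappa})N_i + N_i (S_i^{j\kappa}-S_i^{-j\kappa})\right]$ defined on compactly supported sequences, and $A_{j\kappa} = \sum_{i=1}^d A_i(j,\kappa)$ (self-adjoint). Thresholds. $\boldsymbol{\mu}_\kappa(D)$ is the set of $E \in \sigma(D)$ for which there exist a self-adjoint linear combination (finite or infinite) $\mathbb{A} = \sum_{j \geq 1} \rho_{j\kappa} A_{j\kappa}$, $\rho_{j\kappa}\in\mathbb{R}$, an interval $I \ni E$ and $\gamma>0$ with $1_I(D)[D,\mathrm{i}\mathbb{A}]_\circ 1_I(D) \geq \gamma 1_I(D)$, where $[D,\mathrm{i}\mathbb{A}]_\circ$ is the bounded extension of the commutator from compactly supported sequences. $\boldsymbol{\Theta}_\kappa(D) = \sigma(D)\setminus \boldsymbol{\mu}_\kappa(D)$. Let $T_n, U_n$ be the Chebyshev polynomials of the first and second kind, $T_n(\cos\theta)=\cos(n\theta)$, $U_{n-1}(\cos\theta)=\sin(n\theta)/\sin\theta$.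 For $\vec{x}\in[-1,1]^d$ let $g_{j\kappa}(\vec{x}) = \sum_{i=1}^d \big(\prod_{l \neq i} x_l\big)(1-x_i^2)U_{j\kappa-1}(x_i)$, and $S_E = \{\vec{x}\in[-1,1]^d : \prod_{l=1}^d x_l = E\}$. The function $G_\kappa = \sum_j \rho_{j\kappa} g_{j\kappa}$ represents $[D,\mathrm{i}\mathbb{A}]_\circ$ by functional calculus (with $\Delta_i \leftrightarrow x_i$), and by continuity of $G_\kappa$, $E\in\boldsymbol{\mu}_\kappa(D)$ iff $G_\kappa>0$ on $S_E$ for some such $\mathbb{A}$. Further, $\boldsymbol{\theta}_{0,\kappa}(D[d]) = \{\prod_{q=1}^d \cos(j_q\pi/\kappa) : (j_1,\ldots,j_d)\in\{0,\ldots,\kappa\}^d\}$. The sequence $\mathcal{E}_n$ (with $\kappa=4$): for $n\ge1$, $\mathcal{E}_n$ is the unique $\mathcal{E}_n\in(\cos^2(\pi/\kappa),\cos(\pi/\kappa))$ for which there are reals $X_0,\ldots,X_{n+1}$ such that: if $n$ is odd, $T_\kappa(X_q)=T_\kappa(X_{n-q})$ for $0\le q\le (n-1)/2$, $X_{n-q}=\mathcal{E}_n/X_{1+q}$ for $-1\le q\le (n-1)/2$, and $\mathcal{E}_n = X_0<X_1<\cdots<X_{(n-1)/2}<\cos(\pi/\kappa)<X_{(n+1)/2}<\cdots<X_n<X_{n+1}=1$; if $n$ is even, $T_\kappa(X_q)=T_\kappa(X_{n-q})$ for $0\le q\le n/2-1$, $X_{n-q}=\mathcal{E}_n/X_{1+q}$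 for $-1\le q\le n/2-1$, and $\mathcal{E}_n=X_0<X_1<\cdots<X_{n/2}=\cos(\pi/\kappa)<X_{n/2+1}<\cdots<X_n<X_{n+1}=1$. *)

theory Defs
  imports "HOL-Analysis.Analysis" "HOL-Library.Numeral_Type" "HOL-Library.Nonpos_Ints"
begin

section \<open>The Hilbert space of square-summable sequences and its operators\<close>

text \<open>Vectors are functions \<^term>\<open>u :: 'a \<Rightarrow> complex\<close> subject to \<open>ell2 u\<close>. The inner product is
  antilinear in its first argument.\<close>

definition ell2 :: "('a \<Rightarrow> complex) \<Rightarrow> bool" where
  "ell2 u \<longleftrightarrow> (\<lambda>x. (cmod (u x))\<^sup>2) summable_on UNIV"

definition ell2_norm :: "('a \<Rightarrow> complex) \<Rightarrow> real" where
  "ell2_norm u = sqrt (\<Sum>\<^sub>\<infinity>x. (cmod (u x))\<^sup>2)"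

definition ip :: "('a \<Rightarrow> complex) \<Rightarrow> ('a \<Rightarrow> complex) \<Rightarrow> complex" where
  "ip u v = (\<Sum>\<^sub>\<infinity>x. cnj (u x) * v x)"

definition ell2_lim :: "(nat \<Rightarrow> 'a \<Rightarrow> complex) \<Rightarrow> ('a \<Rightarrow> complex) \<Rightarrow> bool" where
  "ell2_lim F f \<longleftrightarrow> (\<forall>k. ell2 (F k)) \<and> ell2 f \<and>
     (\<lambda>k. ell2_norm (\<lambda>x. F k x - f x)) \<longlonglongrightarrow> 0"

definition finsupp :: "('a \<Rightarrow> complex) \<Rightarrow> bool" where
  "finsupp u \<longleftrightarrow> finite {x. u x \<noteq> 0}"

type_synonym 'a oper = "('a \<Rightarrow> complex) \<Rightarrow> ('a \<Rightarrow> complex)"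

text \<open>An everywhere defined operator is a function on all sequences, of which only the values at
  square-summable sequences matter.\<close>

definition bounded_oper :: "'a oper \<Rightarrow> bool" where
  "bounded_oper T \<longleftrightarrow>
     (\<forall>u. ell2 u \<longrightarrow> ell2 (T u)) \<and>
     (\<forall>u v a b. ell2 u \<longrightarrow> ell2 v \<longrightarrow> T (\<lambda>x. a * u x + b * v x) = (\<lambda>x. a * T u x + b * T v x)) \<and>
     (\<exists>K. \<forall>u. ell2 u \<longrightarrow> ell2_norm (T u) \<le> K * ell2_norm u)"

definition orth_projection :: "'a oper \<Rightarrow> bool" where
  "orth_projection P \<longleftrightarrow> bounded_oper P \<and>
     (\<forall>u. ell2 u \<longrightarrow> P (P u) = P u) \<and>
     (\<forall>u v. ell2 u \<longrightarrow> ell2 v \<longrightarrow> ip (P u) v = ip u (P v))"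

definition oper_le :: "'a oper \<Rightarrow> 'a oper \<Rightarrow> bool" where
  "oper_le S T \<longleftrightarrow> (\<forall>u. ell2 u \<longrightarrow> ip u (\<lambda>x. T u x - S u x) \<in> \<real>\<^sub>\<ge>\<^sub>0)"

definition oper_spectrum :: "'a oper \<Rightarrow> complex set" where
  "oper_spectrum T = {z. \<not> (\<exists>R. bounded_oper R \<and>
     (\<forall>u. ell2 u \<longrightarrow> R (\<lambda>x. T u x - z * u x) = u \<and> (\<lambda>x. T (R u) x - z * R u x) = u))}"

definition scalar_measure :: "(real set \<Rightarrow> 'a oper) \<Rightarrow> ('a \<Rightarrow> complex) \<Rightarrow> real measure" where
  "scalar_measure P u = measure_of UNIV (sets borel) (\<lambda>B. ennreal (Re (ip u (P B u))))"

text \<open>\<open>spectral_measure T P\<close>: \<open>P\<close> is the projection-valued measure of the bounded self-adjoint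
  operator \<open>T\<close>, that is \<open>T = \<integral> t dP(t)\<close>, so that \<open>P I\<close> is \<open>1\<^sub>I(T)\<close>. By the spectral theorem it
  exists and is unique on Borel sets and square-summable sequences.\<close>

definition spectral_measure :: "'a oper \<Rightarrow> (real set \<Rightarrow> 'a oper) \<Rightarrow> bool" where
  "spectral_measure T P \<longleftrightarrow>
     (\<forall>B \<in> sets borel. orth_projection (P B)) \<and>
     (\<forall>u. ell2 u \<longrightarrow> P UNIV u = u) \<and>
     (\<forall>B u. range B \<subseteq> sets borel \<longrightarrow> disjoint_family B \<longrightarrow> ell2 u \<longrightarrow>
        ell2_lim (\<lambda>k x. \<Sum>i<k. P (B i) u x) (P (\<Union>i. B i) u)) \<and>
     (\<forall>u. ell2 u \<longrightarrow> integrable (scalar_measure P u) (\<lambda>t. t) \<and>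
        ip u (T u) = complex_of_real (integral\<^sup>L (scalar_measure P u) (\<lambda>t. t)))"

text \<open>Unbounded operators are given by their graphs.\<close>

type_synonym 'a graph = "(('a \<Rightarrow> complex) \<times> ('a \<Rightarrow> complex)) set"

definition graph_closure :: "'a graph \<Rightarrow> 'a graph" where
  "graph_closure G = {(u, f). \<exists>U F. (\<forall>k. (U k, F k) \<in> G) \<and> ell2_lim U u \<and> ell2_lim F f}"

definition graph_adjoint :: "'a graph \<Rightarrow> 'a graph" where
  "graph_adjoint G = {(v, g). ell2 v \<and> ell2 g \<and> (\<forall>(u, f) \<in> G. ip v f = ip g u)}"

definition self_adjoint_graph :: "'a graph \<Rightarrow> bool" where
  "self_adjoint_graph G \<longleftrightarrow> single_valued G \<and> graph_adjoint G = G"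


section \<open>The Molchanov--Vainberg Laplacian and the conjugate operators\<close>

text \<open>\<open>shift i m\<close> is \<open>S\<^sub>i\<close> to the power \<open>m\<close>, for an arbitrary integer \<open>m\<close>.\<close>

definition shift :: "'d::finite \<Rightarrow> int \<Rightarrow> (int^'d) oper" where
  "shift i m u = (\<lambda>n. u (n - axis i m))"

definition position :: "'d::finite \<Rightarrow> (int^'d) oper" where
  "position i u = (\<lambda>n. of_int (n $ i) * u n)"

definition Delta :: "'d::finite \<Rightarrow> (int^'d) oper" where
  "Delta i u = (\<lambda>n. (shift i 1 u n + shift i (- 1) u n) / 2)"

lemma Delta_commute: "Delta i \<circ> Delta j = Delta j \<circ> Delta i"
  by (auto simp: fun_eq_iff Delta_def shift_def algebra_simps add_divide_distrib)

text \<open>The product (composition) of the commuting operators \<open>Delta i\<close> over all coordinates; the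
  dimension is \<open>CARD('d)\<close>.\<close>

definition MV :: "(int^'d::finite) oper" where
  "MV = Finite_Set.fold (\<lambda>i T. Delta i \<circ> T) id UNIV"

lemma MV_dim3: "(MV :: (int^3) oper) = Delta 1 \<circ> Delta 2 \<circ> Delta 3"
proof -
  interpret comp_fun_commute "\<lambda>(i::3) T. Delta i \<circ> T"
    by unfold_locales (metis (no_types, opaque_lifting) Delta_commute comp_apply fun.map_comp ext)
  show ?thesis
    unfolding MV_def UNIV_3 by (simp add: fun_eq_iff)
qed

text \<open>The expression defining \<open>A\<^sub>i(j,\<kappa>)\<close>, with \<open>m = j\<kappa>\<close>, and the sum over \<open>i\<close>. Only
  the action on finitely supported sequences is used; closures are taken in \<open>A_comb\<close> below.\<close>

definition A_coord :: "'d::finite \<Rightarrow> nat \<Rightarrow> (int^'d) oper" where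
  "A_coord i m u = (\<lambda>n. 1 / (4 * \<i>) *
     ((shift i (int m) (position i u) n - shift i (- int m) (position i u) n)
      + position i (\<lambda>k. shift i (int m) u k - shift i (- int m) u k) n))"

definition A_sum :: "nat \<Rightarrow> (int^'d::finite) oper" where
  "A_sum m u = (\<lambda>n. \<Sum>i\<in>UNIV. A_coord i m u n)"

text \<open>The linear combination with coefficients \<open>\<rho> j\<close>, \<open>j \<ge> 1\<close>, on finitely supported sequences;
  the series is understood as convergent in norm at each such sequence, and it is finite
  if almost all \<open>\<rho> j\<close> vanish.\<close>

definition A_comb_core :: "nat \<Rightarrow> (nat \<Rightarrow> real) \<Rightarrow> (int^'d::finite) graph" where
  "A_comb_core \<kappa> \<rho> = {(u, f). finsupp u \<and>
     ell2_lim (\<lambda>k n. \<Sum>j=1..k. complex_of_real (\<rho> j) * A_sum (j * \<kappa>) u n) f}"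

definition A_comb :: "nat \<Rightarrow> (nat \<Rightarrow> real) \<Rightarrow> (int^'d::finite) graph" where
  "A_comb \<kappa> \<rho> = graph_closure (A_comb_core \<kappa> \<rho>)"

definition admissible :: "'d::finite itself \<Rightarrow> nat \<Rightarrow> (nat \<Rightarrow> real) \<Rightarrow> bool" where
  "admissible _ \<kappa> \<rho> \<longleftrightarrow>
     {u. finsupp u} \<subseteq> Domain (A_comb_core \<kappa> \<rho> :: (int^'d) graph) \<and>
     self_adjoint_graph (A_comb \<kappa> \<rho> :: (int^'d) graph)"

text \<open>\<open>C\<close> is the bounded extension of \<open>[T, \<i>A] = T(\<i>A) - (\<i>A)T\<close> from the finitely supported
  sequences.\<close>

definition commutator_ext :: "'a oper \<Rightarrow> 'a graph \<Rightarrow> 'a oper \<Rightarrow> bool" where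
  "commutator_ext T A C \<longleftrightarrow> bounded_oper C \<and>
     (\<forall>u f g. finsupp u \<longrightarrow> (u, f) \<in> A \<longrightarrow> (T u, g) \<in> A \<longrightarrow>
        C u = (\<lambda>x. T (\<lambda>y. \<i> * f y) x - \<i> * g x))"


section \<open>Thresholds\<close>

text \<open>The interval around \<open>E\<close> is open: for the degenerate interval \<open>{E}\<close> the spectral projection
  vanishes and the estimate would be void.\<close>

definition mu_set :: "'d::finite itself \<Rightarrow> nat \<Rightarrow> real set" where
  "mu_set d \<kappa> = {E. complex_of_real E \<in> oper_spectrum (MV :: (int^'d) oper) \<and>
     (\<exists>\<rho> (C :: (int^'d) oper) P a b \<gamma>.
        admissible d \<kappa> \<rho> \<and>
        commutator_ext MV (A_comb \<kappa> \<rho>) C \<and>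
        spectral_measure MV P \<and>
        a < E \<and> E < b \<and> 0 < \<gamma> \<and>
        oper_le (\<lambda>u n. complex_of_real \<gamma> * P {a<..<b} u n)
                (\<lambda>u. P {a<..<b} (C (P {a<..<b} u))))}"

definition Theta_set :: "'d::finite itself \<Rightarrow> nat \<Rightarrow> real set" where
  "Theta_set d \<kappa> = {E. complex_of_real E \<in> oper_spectrum (MV :: (int^'d) oper)} - mu_set d \<kappa>"

definition theta0_set :: "'d::finite itself \<Rightarrow> nat \<Rightarrow> real set" where
  "theta0_set _ \<kappa> =
     {\<Prod>q\<in>UNIV. cos (real (j q) * pi / real \<kappa>) | j :: 'd \<Rightarrow> nat. \<forall>q. j q \<in> {0..\<kappa>}}"

fun cheb_T :: "nat \<Rightarrow> real \<Rightarrow> real" where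
  "cheb_T 0 x = 1"
| "cheb_T (Suc 0) x = x"
| "cheb_T (Suc (Suc n)) x = 2 * x * cheb_T (Suc n) x - cheb_T n x"

lemma cheb_T_cos: "cheb_T n (cos t) = cos (real n * t)"
proof (induction n "cos t" rule: cheb_T.induct)
  case (3 n)
  have "cos (real (Suc (Suc n)) * t) = cos (real (Suc n) * t + t)"
    and "cos (real n * t) = cos (real (Suc n) * t - t)"
    by (simp_all add: algebra_simps)
  then show ?case
    using 3 by (simp add: cos_add cos_diff del: of_nat_Suc)
qed simp_all

text \<open>The conditions on \<open>X\<^sub>0, \<dots>, X\<^bsub>n+1\<^esub>\<close>. Indices are integers because the index \<open>q\<close> of the second
  condition starts at \<open>-1\<close>.\<close>

definition threshold_chain :: "nat \<Rightarrow> nat \<Rightarrow> real \<Rightarrow> (int \<Rightarrow> real) \<Rightarrow> bool" where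
  "threshold_chain \<kappa> n E X \<longleftrightarrow> (let N = int n; c = cos (pi / real \<kappa>) in
     if odd n then
       (\<forall>q\<in>{0..(N - 1) div 2}. cheb_T \<kappa> (X q) = cheb_T \<kappa> (X (N - q))) \<and>
       (\<forall>q\<in>{-1..(N - 1) div 2}. X (N - q) = E / X (1 + q)) \<and>
       X 0 = E \<and>
       (\<forall>q\<in>{0..<(N - 1) div 2}. X q < X (q + 1)) \<and>
       X ((N - 1) div 2) < c \<and> c < X ((N + 1) div 2) \<and>
       (\<forall>q\<in>{(N + 1) div 2..N}. X q < X (q + 1)) \<and>
       X (N + 1) = 1
     else
       (\<forall>q\<in>{0..N div 2 - 1}. cheb_T \<kappa> (X q) = cheb_T \<kappa> (X (N - q))) \<and>
       (\<forall>q\<in>{-1..N div 2 - 1}. X (N - q) = E / X (1 + q)) \<and>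
       X 0 = E \<and>
       (\<forall>q\<in>{0..N}. X q < X (q + 1)) \<and>
       X (N div 2) = c \<and>
       X (N + 1) = 1)"

text \<open>For \<open>\<kappa> = 4\<close> and \<open>n \<ge> 1\<close> there is exactly one such \<open>E\<close>, namely \<open>1 / (2 cos (\<pi>/(n+4)))\<close>; the value
  at \<open>n = 0\<close> is irrelevant.\<close>

definition threshold :: "nat \<Rightarrow> nat \<Rightarrow> real" where
  "threshold \<kappa> n = (THE E. E \<in> {(cos (pi / real \<kappa>))\<^sup>2<..<cos (pi / real \<kappa>)} \<and>
                           (\<exists>X. threshold_chain \<kappa> n E X))"

end

theory Submission
  imports Defs
begin

text \<open>All operators in the theorem that commute with translations act, after the Fourier transform, as
  multiplications by trigonometric polynomials on the torus: the Laplacian \<open>D\<close> by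
  \<open>p(\<theta>) = \<Prod>\<^sub>i cos \<theta>\<^sub>i\<close>, and \<open>[D, \<i>A\<^sub>m]\<close> by
  \<open>g\<^sub>m(\<theta>) = \<Sum>\<^sub>i sin (m \<theta>\<^sub>i) sin \<theta>\<^sub>i \<Prod>\<^bsub>l\<noteq>i\<^esub> cos \<theta>\<^sub>l\<close>. A Mourre estimate at \<open>E\<close> is therefore a
  statement about the sign of \<open>\<Sum>\<^sub>j \<rho>\<^sub>j g\<^bsub>j\<kappa>\<^esub>\<close> on the level set \<open>p = E\<close>.

  The estimate forces this sum to be positive on the level set (\<open>mu_set_symbol_positive\<close>). A plane wave
  cut off to a large box is nearly an eigenvector of every operator of the kind above, with the value of
  its symbol as eigenvalue, so that the quadratic form of the commutator at it converges to the value of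
  the sum. The spectral projection in the estimate nearly fixes the plane wave, because the complementary
  projections reduce \<open>D\<close> and keep away from \<open>E\<close>. The series of symbols converges absolutely, because a
  combination that is defined at the unit vector of a lattice point already has \<open>j \<rho>\<^sub>j\<close> square-summable.

  So \<open>E\<close> is a threshold as soon as finitely many points of its level set carry positive weights under
  which all \<open>g\<^bsub>j\<kappa>\<^esub>\<close> sum to zero. For \<open>\<kappa> = 4\<close> the relations of the chain \<open>X\<^sub>0, \<dots>, X\<^bsub>n+1\<^esub>\<close> reduce to the
  Moebius recursion \<open>y\<^bsub>q+1\<^esub> (1 - y\<^sub>q) = E\<^sup>2\<close> for \<open>y\<^sub>q = X\<^sub>q\<^sup>2\<close>, whose solution is
  \<open>y\<^sub>q = E sin ((q+1)\<phi>) / sin ((q+2)\<phi>)\<close> with \<open>2 E cos \<phi> = 1\<close>; the end condition selects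
  \<open>\<phi> = \<pi>/(n+4)\<close> (\<open>threshold_eq\<close>). Write \<open>X\<^sub>q = cos \<theta>\<^sub>q\<close>. The pairs \<open>(X\<^sub>q, X\<^bsub>n+1-q\<^esub>)\<close> have product \<open>E\<close>, and the
  pairs \<open>(\<theta>\<^sub>q, \<theta>\<^bsub>n-q\<^esub>)\<close> add up to \<open>\<pi>/2\<close>, which makes \<open>sin (4 j \<theta>\<^sub>q)\<close> and \<open>sin (4 j \<theta>\<^bsub>n-q\<^esub>)\<close> opposite. Hence
  the two contributions to \<open>g\<^bsub>4j\<^esub>\<close> at one pair are of the same form as those at its neighbours, and with
  weights \<open>sin ((q+1)\<phi>) sin ((q+2)\<phi>)\<close> the sum over all pairs telescopes to zero for every \<open>j\<close>
  (\<open>weighted_symbols_cancel\<close>). A third coordinate of angle \<open>0\<close> or \<open>\<pi>/4\<close> contributes nothing to \<open>g\<^bsub>4j\<^esub>\<close>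
  and multiplies the product by \<open>1\<close> or \<open>cos (\<pi>/4)\<close>: these are the two families of thresholds.

  Above \<open>cos (\<pi>/4)\<close> the operator \<open>A\<^sub>4\<close> alone suffices, since \<open>g\<^sub>4 = 4 p \<Sum>\<^sub>i (1 - x\<^sub>i\<^sup>2)(2 x\<^sub>i\<^sup>2 - 1)\<close> with
  \<open>x\<^sub>i = cos \<theta>\<^sub>i\<close>, and all \<open>x\<^sub>i\<^sup>2 > 1/2\<close> on these level sets. Here the objects of the estimate must be
  produced: the closure of \<open>A\<^sub>4\<close> from the finitely supported sequences is self-adjoint, by a cutoff
  argument (\<open>self_adjoint_A\<close>), and the spectral measure of \<open>D\<close> consists of the multiplications by the
  indicators of \<open>p\<^sup>-\<^sup>1(B)\<close> (\<open>spectral_measure_spectral_projection\<close>).\<close>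

section \<open>Square-summable sequences\<close>

lemma null_sequence_if_norm_le:
  fixes f :: "nat \<Rightarrow> 'b::real_normed_vector"
  assumes "\<And>k. norm (f k) \<le> g k" "g \<longlonglongrightarrow> 0"
  shows "f \<longlonglongrightarrow> 0"
  by (rule Lim_null_comparison[OF always_eventually assms(2)]) (simp add: assms(1))

lemma ell2_iff_bounded_sums:
  "ell2 u \<longleftrightarrow> (\<exists>K. \<forall>F. finite F \<longrightarrow> (\<Sum>x\<in>F. (cmod (u x))\<^sup>2) \<le> K)"
proof
  assume "ell2 u"
  then show "\<exists>K. \<forall>F. finite F \<longrightarrow> (\<Sum>x\<in>F. (cmod (u x))\<^sup>2) \<le> K"
    unfolding ell2_def by (intro exI[of _ "\<Sum>\<^sub>\<infinity>x. (cmod (u x))\<^sup>2"] allI impI finite_sum_le_infsum) auto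
next
  assume "\<exists>K. \<forall>F. finite F \<longrightarrow> (\<Sum>x\<in>F. (cmod (u x))\<^sup>2) \<le> K"
  then show "ell2 u"
    unfolding ell2_def by (intro nonneg_bdd_above_summable_on) (auto simp: bdd_above_def)
qed

lemma ell2_norm_nonneg [simp]: "0 \<le> ell2_norm u"
  by (simp add: ell2_norm_def infsum_nonneg)

lemma ell2_norm_power2: "(ell2_norm u)\<^sup>2 = (\<Sum>\<^sub>\<infinity>x. (cmod (u x))\<^sup>2)"
  by (simp add: ell2_norm_def infsum_nonneg)

lemma ell2_sum_le_norm:
  assumes "ell2 u" "finite F"
  shows "(\<Sum>x\<in>F. (cmod (u x))\<^sup>2) \<le> (ell2_norm u)\<^sup>2"
  using assms unfolding ell2_norm_power2 ell2_def by (intro finite_sum_le_infsum) auto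

lemma ell2_normI:
  assumes "\<And>F. finite F \<Longrightarrow> (\<Sum>x\<in>F. (cmod (u x))\<^sup>2) \<le> K\<^sup>2" "0 \<le> K"
  shows "ell2 u" "ell2_norm u \<le> K"
proof -
  show u: "ell2 u" using assms(1) ell2_iff_bounded_sums by blast
  have "(ell2_norm u)\<^sup>2 \<le> K\<^sup>2"
    unfolding ell2_norm_power2 using u assms(1)
    by (intro infsum_le_finite_sums) (auto simp: ell2_def)
  then show "ell2_norm u \<le> K" using assms(2) by (rule power2_le_imp_le)
qed

lemma cmod_le_ell2_norm: "ell2 u \<Longrightarrow> cmod (u x) \<le> ell2_norm u"
  using ell2_sum_le_norm[of u "{x}"] by (auto intro: power2_le_imp_le)

lemma L2_set_le_ell2_norm: "ell2 u \<Longrightarrow> finite F \<Longrightarrow> L2_set (\<lambda>x. cmod (u x)) F \<le> ell2_norm u"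
  using ell2_sum_le_norm[of u F] by (auto simp: L2_set_def intro: real_le_lsqrt sum_nonneg)

lemma ell2_add_norm:
  assumes "ell2 u" "ell2 v"
  shows "ell2 (\<lambda>x. u x + v x)" "ell2_norm (\<lambda>x. u x + v x) \<le> ell2_norm u + ell2_norm v"
proof -
  have "(\<Sum>x\<in>F. (cmod (u x + v x))\<^sup>2) \<le> (ell2_norm u + ell2_norm v)\<^sup>2" if "finite F" for F
  proof -
    have "(\<Sum>x\<in>F. (cmod (u x + v x))\<^sup>2) \<le> (L2_set (\<lambda>x. cmod (u x) + cmod (v x)) F)\<^sup>2"
      by (auto simp: L2_set_def sum_nonneg intro!: sum_mono power_mono norm_triangle_ineq)
    also have "\<dots> \<le> (L2_set (\<lambda>x. cmod (u x)) F + L2_set (\<lambda>x. cmod (v x)) F)\<^sup>2"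
      by (intro power_mono L2_set_triangle_ineq L2_set_nonneg)
    also have "\<dots> \<le> (ell2_norm u + ell2_norm v)\<^sup>2"
      using assms that by (intro power_mono add_mono L2_set_le_ell2_norm) (auto simp: L2_set_nonneg)
    finally show ?thesis .
  qed
  then show "ell2 (\<lambda>x. u x + v x)" "ell2_norm (\<lambda>x. u x + v x) \<le> ell2_norm u + ell2_norm v"
    by (auto intro!: ell2_normI)
qed

lemmas ell2_add = ell2_add_norm(1) and ell2_norm_triangle = ell2_add_norm(2)

lemma ell2_scale: "ell2 u \<Longrightarrow> ell2 (\<lambda>x. c * u x)"
  unfolding ell2_def norm_mult power_mult_distrib by (rule summable_on_cmult_right)

lemma ell2_norm_scale: "ell2_norm (\<lambda>x. c * u x) = cmod c * ell2_norm u"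
  by (simp add: ell2_norm_def norm_mult power_mult_distrib infsum_cmult_right' real_sqrt_mult)

lemma ell2_zero [simp]: "ell2 (\<lambda>x. 0)"
  by (simp add: ell2_def)

lemma ell2_norm_zero [simp]: "ell2_norm (\<lambda>x. 0) = 0"
  by (simp add: ell2_norm_def)

lemma ell2_lincomb: "ell2 u \<Longrightarrow> ell2 v \<Longrightarrow> ell2 (\<lambda>x. a * u x + b * v x)"
  by (intro ell2_add ell2_scale)

lemma ell2_diff: "ell2 u \<Longrightarrow> ell2 v \<Longrightarrow> ell2 (\<lambda>x. u x - v x)"
  using ell2_lincomb[of u v 1 "-1"] by simp

lemma ell2_sum: "(\<And>i. i \<in> I \<Longrightarrow> ell2 (U i)) \<Longrightarrow> ell2 (\<lambda>x. \<Sum>i\<in>I. U i x)"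
  by (induction I rule: infinite_finite_induct) (auto intro: ell2_add)

lemma ell2_norm_minus: "ell2_norm (\<lambda>x. u x - v x) = ell2_norm (\<lambda>x. v x - u x)"
  by (simp add: ell2_norm_def norm_minus_commute)

lemma ell2_dominated:
  assumes "ell2 w" "\<And>x. cmod (u x) \<le> cmod (w x)"
  shows "ell2 u" "ell2_norm u \<le> ell2_norm w"
proof -
  have "(\<Sum>x\<in>F. (cmod (u x))\<^sup>2) \<le> (ell2_norm w)\<^sup>2" if "finite F" for F
  proof -
    have "(\<Sum>x\<in>F. (cmod (u x))\<^sup>2) \<le> (\<Sum>x\<in>F. (cmod (w x))\<^sup>2)"
      by (intro sum_mono power_mono assms) auto
    then show ?thesis using ell2_sum_le_norm[OF assms(1) that] by linarith
  qed
  then show "ell2 u" "ell2_norm u \<le> ell2_norm w" by (auto intro!: ell2_normI)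
qed

lemma finsupp_ell2: "finsupp u \<Longrightarrow> ell2 u"
  unfolding ell2_def finsupp_def by (intro finite_nonzero_values_imp_summable_on) simp

lemma ell2_norm_eq_0: "ell2 u \<Longrightarrow> ell2_norm u = 0 \<longleftrightarrow> u = (\<lambda>x. 0)"
  using cmod_le_ell2_norm[of u] by (auto simp: fun_eq_iff ell2_norm_def)

lemma ell2_reindex:
  assumes "bij h"
  shows "ell2 (\<lambda>x. u (h x)) \<longleftrightarrow> ell2 u" "ell2_norm (\<lambda>x. u (h x)) = ell2_norm u"
  unfolding ell2_def ell2_norm_def
  using summable_on_reindex_bij_betw[OF assms, of "\<lambda>x. (cmod (u x))\<^sup>2"]
    infsum_reindex_bij_betw[OF assms, of "\<lambda>x. (cmod (u x))\<^sup>2"] by auto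

subsection \<open>Inner product\<close>

lemma ip_abs_summable:
  assumes "ell2 u" "ell2 v"
  shows "(\<lambda>x. cmod (cnj (u x) * v x)) summable_on UNIV"
    and "(\<Sum>\<^sub>\<infinity>x. cmod (cnj (u x) * v x)) \<le> ell2_norm u * ell2_norm v"
proof -
  have *: "(\<Sum>x\<in>F. cmod (cnj (u x) * v x)) \<le> ell2_norm u * ell2_norm v" if "finite F" for F
  proof -
    have "(\<Sum>x\<in>F. cmod (cnj (u x) * v x)) \<le> L2_set (\<lambda>x. cmod (u x)) F * L2_set (\<lambda>x. cmod (v x)) F"
      using L2_set_mult_ineq[of "\<lambda>x. cmod (u x)" "\<lambda>x. cmod (v x)" F] by (simp add: norm_mult)
    also have "\<dots> \<le> ell2_norm u * ell2_norm v"
      using assms that by (intro mult_mono L2_set_le_ell2_norm) (auto simp: L2_set_nonneg)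
    finally show ?thesis .
  qed
  then show s: "(\<lambda>x. cmod (cnj (u x) * v x)) summable_on UNIV"
    by (intro nonneg_bdd_above_summable_on) (auto simp: bdd_above_def)
  show "(\<Sum>\<^sub>\<infinity>x. cmod (cnj (u x) * v x)) \<le> ell2_norm u * ell2_norm v"
    using * by (intro infsum_le_finite_sums[OF s]) auto
qed

lemma ip_summable: "ell2 u \<Longrightarrow> ell2 v \<Longrightarrow> (\<lambda>x. cnj (u x) * v x) summable_on UNIV"
  by (rule abs_summable_summable[OF ip_abs_summable(1)])

lemma ip_Cauchy_Schwarz: "ell2 u \<Longrightarrow> ell2 v \<Longrightarrow> cmod (ip u v) \<le> ell2_norm u * ell2_norm v"
  unfolding ip_def by (rule order_trans[OF norm_infsum_bound ip_abs_summable(2)]) (simp_all add: ip_abs_summable)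

lemma ip_add_right:
  "ell2 u \<Longrightarrow> ell2 v \<Longrightarrow> ell2 w \<Longrightarrow> ip u (\<lambda>x. v x + w x) = ip u v + ip u w"
  unfolding ip_def by (simp add: distrib_left infsum_add ip_summable)

lemma ip_scale_right: "ip u (\<lambda>x. c * v x) = c * ip u v"
  unfolding ip_def by (simp add: mult.left_commute[of _ c] infsum_cmult_right')

lemma ip_cnj: "cnj (ip u v) = ip v u"
  unfolding ip_def by (subst infsum_cnj[symmetric]) (simp add: mult.commute)

lemma ip_scale_left: "ip (\<lambda>x. c * u x) v = cnj c * ip u v"
  using arg_cong[OF ip_scale_right[of v c u], of cnj] by (simp add: ip_cnj)

lemma ip_add_left:
  "ell2 u \<Longrightarrow> ell2 v \<Longrightarrow> ell2 w \<Longrightarrow> ip (\<lambda>x. u x + v x) w = ip u w + ip v w"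
  using arg_cong[OF ip_add_right[of w u v], of cnj] by (simp add: ip_cnj)

lemma ip_diff_right:
  "ell2 u \<Longrightarrow> ell2 v \<Longrightarrow> ell2 w \<Longrightarrow> ip u (\<lambda>x. v x - w x) = ip u v - ip u w"
  using ip_add_right[of u v "\<lambda>x. - w x"] ell2_scale[of w "-1"] ip_scale_right[of u "-1" w] by simp

lemma ip_diff_left:
  "ell2 u \<Longrightarrow> ell2 v \<Longrightarrow> ell2 w \<Longrightarrow> ip (\<lambda>x. u x - v x) w = ip u w - ip v w"
  using arg_cong[OF ip_diff_right[of w u v], of cnj] by (simp add: ip_cnj)

lemma ip_zero [simp]: "ip u (\<lambda>x. 0) = 0" "ip (\<lambda>x. 0) u = 0"
  by (simp_all add: ip_def)

lemma ip_sum_right: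
  "ell2 u \<Longrightarrow> (\<And>i. i \<in> I \<Longrightarrow> ell2 (V i)) \<Longrightarrow> ip u (\<lambda>x. \<Sum>i\<in>I. V i x) = (\<Sum>i\<in>I. ip u (V i))"
  by (induction I rule: infinite_finite_induct) (auto simp: ip_add_right ell2_sum)

lemma ip_self:
  assumes "ell2 u"
  shows "ip u u = complex_of_real ((ell2_norm u)\<^sup>2)"
proof -
  have "cnj z * z = complex_of_real ((cmod z)\<^sup>2)" for z
    by (metis complex_norm_square mult.commute)
  then show ?thesis
    unfolding ip_def ell2_norm_power2 using assms
    by (simp only:) (intro infsumI has_sum_of_real has_sum_infsum, simp add: ell2_def)
qed

lemma ip_finsupp_left: "finite S \<Longrightarrow> {x. u x \<noteq> 0} \<subseteq> S \<Longrightarrow> ip u v = (\<Sum>x\<in>S. cnj (u x) * v x)"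
  unfolding ip_def by (subst infsum_finite[symmetric], simp) (rule infsum_cong_neutral, auto)

definition delta :: "'a \<Rightarrow> 'a \<Rightarrow> complex" where
  "delta a = (\<lambda>x. if x = a then 1 else 0)"

lemma finsupp_delta [simp]: "finsupp (delta a)"
  by (simp add: finsupp_def delta_def)

lemma ip_delta_left [simp]: "ip (delta a) v = v a"
  by (subst ip_finsupp_left[of "{a}"]) (auto simp: delta_def)

lemma norm_add_Pythagoras:
  assumes "ell2 u" "ell2 v" "ip u v = 0"
  shows "(ell2_norm (\<lambda>x. u x + v x))\<^sup>2 = (ell2_norm u)\<^sup>2 + (ell2_norm v)\<^sup>2"
proof -
  have "ip v u = 0" using assms(3) ip_cnj[of u v] by simp
  then have "ip (\<lambda>x. u x + v x) (\<lambda>x. u x + v x) = ip u u + ip v v"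
    using assms by (simp add: ip_add_left ip_add_right ell2_add)
  then have "complex_of_real ((ell2_norm (\<lambda>x. u x + v x))\<^sup>2) = complex_of_real ((ell2_norm u)\<^sup>2 + (ell2_norm v)\<^sup>2)"
    by (simp add: ip_self assms ell2_add)
  then show ?thesis unfolding of_real_eq_iff .
qed

subsection \<open>Limits and approximation by finitely supported sequences\<close>

lemma ell2_lim_const: "ell2 u \<Longrightarrow> ell2_lim (\<lambda>k. u) u"
  by (simp add: ell2_lim_def)

lemma ell2_lim_pointwise:
  assumes "ell2_lim F f"
  shows "(\<lambda>k. F k x) \<longlonglongrightarrow> f x"
proof -
  have lim: "(\<lambda>k. ell2_norm (\<lambda>x. F k x - f x)) \<longlonglongrightarrow> 0" using assms by (simp add: ell2_lim_def)
  have "cmod (F k x - f x) \<le> ell2_norm (\<lambda>x. F k x - f x)" for k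
    using cmod_le_ell2_norm[OF ell2_diff, of "F k" f x] assms by (simp add: ell2_lim_def)
  then have "(\<lambda>k. F k x - f x) \<longlonglongrightarrow> 0"
    by (rule null_sequence_if_norm_le[OF _ lim])
  then show ?thesis by (simp add: LIM_zero_iff)
qed

lemma ell2_lim_ip:
  assumes "ell2_lim U u" "ell2_lim V v"
  shows "(\<lambda>k. ip (U k) (V k)) \<longlonglongrightarrow> ip u v"
proof -
  have ell: "ell2 u" "ell2 v" "ell2 (U k)" "ell2 (V k)" for k using assms by (auto simp: ell2_lim_def)
  let ?a = "\<lambda>k. ell2_norm (\<lambda>x. U k x - u x)" and ?b = "\<lambda>k. ell2_norm (\<lambda>x. V k x - v x)"
  have "cmod (ip (U k) (V k) - ip u v) \<le> ?a k * (ell2_norm v + ?b k) + ell2_norm u * ?b k" for k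
  proof -
    have 1: "ip (\<lambda>x. U k x - u x) (V k) = ip (U k) (V k) - ip u (V k)"
     and 2: "ip u (\<lambda>x. V k x - v x) = ip u (V k) - ip u v"
      using ell by (auto simp: ip_diff_left ip_diff_right)
    have "ell2_norm (V k) \<le> ell2_norm v + ?b k"
      using ell2_norm_triangle[of v "\<lambda>x. V k x - v x"] ell by (simp add: ell2_diff)
    then have "cmod (ip (\<lambda>x. U k x - u x) (V k)) \<le> ?a k * (ell2_norm v + ?b k)"
      using ip_Cauchy_Schwarz[OF ell2_diff[OF ell(3,1)] ell(4)]
      by (meson ell2_norm_nonneg mult_left_mono order_trans)
    moreover have "cmod (ip u (\<lambda>x. V k x - v x)) \<le> ell2_norm u * ?b k"
      using ip_Cauchy_Schwarz ell ell2_diff by blast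
    moreover have "ip (U k) (V k) - ip u v = ip (\<lambda>x. U k x - u x) (V k) + ip u (\<lambda>x. V k x - v x)"
      using 1 2 by simp
    ultimately show ?thesis by (simp only: norm_triangle_mono)
  qed
  moreover have "(\<lambda>k. ?a k * (ell2_norm v + ?b k) + ell2_norm u * ?b k) \<longlonglongrightarrow> 0"
  proof -
    have "?a \<longlonglongrightarrow> 0" "?b \<longlonglongrightarrow> 0" using assms by (simp_all add: ell2_lim_def)
    then have "(\<lambda>k. ?a k * (ell2_norm v + ?b k) + ell2_norm u * ?b k) \<longlonglongrightarrow> 0 * (ell2_norm v + 0) + ell2_norm u * 0"
      by (intro tendsto_add tendsto_mult tendsto_const)
    then show ?thesis by simp
  qed
  ultimately have "(\<lambda>k. ip (U k) (V k) - ip u v) \<longlonglongrightarrow> 0"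
    by (rule null_sequence_if_norm_le)
  then show ?thesis by (simp add: LIM_zero_iff)
qed

lemma ell2_lim_norm:
  assumes "ell2_lim U u"
  shows "(\<lambda>k. (ell2_norm (U k))\<^sup>2) \<longlonglongrightarrow> (ell2_norm u)\<^sup>2"
  using tendsto_Re[OF ell2_lim_ip[OF assms assms]] assms by (simp add: ip_self ell2_lim_def)

text \<open>Outside a finite set the dominating sequence is small in norm, and on the finite set pointwise
  convergence is uniform.\<close>

lemma ell2_dominated_convergence:
  assumes W: "ell2 W" and dom: "\<And>k x. cmod (F k x - f x) \<le> cmod (W x)"
    and lim: "\<And>x. (\<lambda>k. F k x) \<longlonglongrightarrow> f x" and f: "ell2 f"
  shows "ell2_lim F f"
proof -
  have d: "ell2 (\<lambda>x. F k x - f x)" for k by (rule ell2_dominated(1)[OF W dom])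
  have Fk: "ell2 (F k)" for k using ell2_add[OF d[of k] f] by simp
  have sW: "(\<lambda>x. (cmod (W x))\<^sup>2) summable_on UNIV" using W by (simp add: ell2_def)
  have "(\<lambda>k. (ell2_norm (\<lambda>x. F k x - f x))\<^sup>2) \<longlonglongrightarrow> 0"
  proof (rule LIMSEQ_I)
    fix e :: real assume "0 < e"
    then obtain S where S: "finite S" "dist (\<Sum>x\<in>S. (cmod (W x))\<^sup>2) (\<Sum>\<^sub>\<infinity>x. (cmod (W x))\<^sup>2) \<le> e / 3"
      using infsum_finite_approximation[OF sW, of "e/3"] by auto
    have "(\<Sum>\<^sub>\<infinity>x. (cmod (W x))\<^sup>2) = (\<Sum>x\<in>S. (cmod (W x))\<^sup>2) + (\<Sum>\<^sub>\<infinity>x\<in>-S. (cmod (W x))\<^sup>2)"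
      using infsum_Un_disjoint[of "\<lambda>x. (cmod (W x))\<^sup>2" S "-S"] S(1) sW summable_on_subset_banach by fastforce
    then have tail: "(\<Sum>\<^sub>\<infinity>x\<in>-S. (cmod (W x))\<^sup>2) \<le> e / 3" using S(2) by (simp add: dist_real_def)
    have "(\<lambda>k. \<Sum>x\<in>S. (cmod (F k x - f x))\<^sup>2) \<longlonglongrightarrow> (\<Sum>x\<in>S. (cmod (f x - f x))\<^sup>2)"
      by (intro tendsto_intros lim)
    then have "eventually (\<lambda>k. (\<Sum>x\<in>S. (cmod (F k x - f x))\<^sup>2) < e / 3) sequentially"
      using \<open>0 < e\<close> by (intro order_tendstoD) auto
    then obtain k0 where k0: "\<And>k. k \<ge> k0 \<Longrightarrow> (\<Sum>x\<in>S. (cmod (F k x - f x))\<^sup>2) < e / 3"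
      by (auto simp: eventually_sequentially)
    show "\<exists>k0. \<forall>k\<ge>k0. norm ((ell2_norm (\<lambda>x. F k x - f x))\<^sup>2 - 0) < e"
    proof (intro exI allI impI)
      fix k assume k: "k \<ge> k0"
      have s: "(\<lambda>x. (cmod (F k x - f x))\<^sup>2) summable_on UNIV" using d[of k] by (simp add: ell2_def)
      have "(\<Sum>\<^sub>\<infinity>x. (cmod (F k x - f x))\<^sup>2) = (\<Sum>x\<in>S. (cmod (F k x - f x))\<^sup>2) + (\<Sum>\<^sub>\<infinity>x\<in>-S. (cmod (F k x - f x))\<^sup>2)"
        using infsum_Un_disjoint[of "\<lambda>x. (cmod (F k x - f x))\<^sup>2" S "-S"] S(1) s summable_on_subset_banach by fastforce
      also have "\<dots> \<le> e / 3 + (\<Sum>\<^sub>\<infinity>x\<in>-S. (cmod (W x))\<^sup>2)"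
        using k0[OF k] by (intro add_mono infsum_mono power_mono dom summable_on_subset_banach[OF s] summable_on_subset_banach[OF sW]) auto
      finally show "norm ((ell2_norm (\<lambda>x. F k x - f x))\<^sup>2 - 0) < e"
        using tail \<open>0 < e\<close> unfolding ell2_norm_power2 by (simp add: infsum_nonneg)
    qed
  qed
  then have "(\<lambda>k. sqrt ((ell2_norm (\<lambda>x. F k x - f x))\<^sup>2)) \<longlonglongrightarrow> sqrt 0" by (rule tendsto_real_sqrt)
  then show ?thesis using Fk f by (simp add: ell2_lim_def)
qed

lemma ell2_finsupp_approx:
  assumes "ell2 u"
  obtains U where "\<And>k. finsupp (U k)" "ell2_lim U u"
proof -
  have s: "(\<lambda>x. (cmod (u x))\<^sup>2) summable_on UNIV" using assms by (simp add: ell2_def)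
  have "\<exists>v. finsupp v \<and> ell2_norm (\<lambda>x. v x - u x) \<le> inverse (real (Suc k))" for k
  proof -
    let ?e = "inverse (real (Suc k))"
    obtain S where S: "finite S" "dist (\<Sum>x\<in>S. (cmod (u x))\<^sup>2) (\<Sum>\<^sub>\<infinity>x. (cmod (u x))\<^sup>2) \<le> ?e\<^sup>2"
      using infsum_finite_approximation[OF s, of "?e\<^sup>2"] by auto
    define v where "v = (\<lambda>x. if x \<in> S then u x else 0)"
    have "(\<Sum>\<^sub>\<infinity>x. (cmod (u x))\<^sup>2) = (\<Sum>x\<in>S. (cmod (u x))\<^sup>2) + (\<Sum>\<^sub>\<infinity>x\<in>-S. (cmod (u x))\<^sup>2)"
      using infsum_Un_disjoint[of "\<lambda>x. (cmod (u x))\<^sup>2" S "-S"] S(1) s summable_on_subset_banach by fastforce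
    then have "(\<Sum>\<^sub>\<infinity>x\<in>-S. (cmod (u x))\<^sup>2) \<le> ?e\<^sup>2" using S(2) by (simp add: dist_real_def)
    moreover have "(\<Sum>\<^sub>\<infinity>x. (cmod (v x - u x))\<^sup>2) = (\<Sum>\<^sub>\<infinity>x\<in>-S. (cmod (u x))\<^sup>2)"
      by (rule infsum_cong_neutral) (auto simp: v_def)
    ultimately have "(ell2_norm (\<lambda>x. v x - u x))\<^sup>2 \<le> ?e\<^sup>2" by (simp add: ell2_norm_power2)
    then have "ell2_norm (\<lambda>x. v x - u x) \<le> ?e" by (rule power2_le_imp_le) simp
    moreover have "finsupp v"
      unfolding finsupp_def by (rule finite_subset[OF _ S(1)]) (auto simp: v_def)
    ultimately show ?thesis by blast
  qed
  then obtain U where U: "\<And>k. finsupp (U k)" "\<And>k. ell2_norm (\<lambda>x. U k x - u x) \<le> inverse (real (Suc k))"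
    by metis
  have "(\<lambda>k. ell2_norm (\<lambda>x. U k x - u x)) \<longlonglongrightarrow> 0"
    by (rule Lim_null_comparison[OF _ LIMSEQ_inverse_real_of_nat]) (use U in auto)
  then have "ell2_lim U u" using U(1) assms by (auto simp: ell2_lim_def finsupp_ell2)
  then show ?thesis using that U(1) by blast
qed

subsection \<open>Bounded operators\<close>

lemma bounded_operI:
  assumes "\<And>u. ell2 u \<Longrightarrow> ell2 (T u)"
    and "\<And>u v a b. ell2 u \<Longrightarrow> ell2 v \<Longrightarrow> T (\<lambda>x. a * u x + b * v x) = (\<lambda>x. a * T u x + b * T v x)"
    and "\<And>u. ell2 u \<Longrightarrow> ell2_norm (T u) \<le> K * ell2_norm u"
  shows "bounded_oper T"
  using assms unfolding bounded_oper_def by blast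

lemma bounded_operD:
  assumes "bounded_oper T"
  shows bounded_oper_ell2: "\<And>u. ell2 u \<Longrightarrow> ell2 (T u)"
    and bounded_oper_lincomb: "\<And>u v a b. ell2 u \<Longrightarrow> ell2 v \<Longrightarrow> T (\<lambda>x. a * u x + b * v x) = (\<lambda>x. a * T u x + b * T v x)"
  using assms by (auto simp: bounded_oper_def)

lemma bounded_oper_bound:
  assumes "bounded_oper T"
  obtains K where "0 \<le> K" "\<And>u. ell2 u \<Longrightarrow> ell2_norm (T u) \<le> K * ell2_norm u"
proof -
  obtain K where K: "\<And>u. ell2 u \<Longrightarrow> ell2_norm (T u) \<le> K * ell2_norm u"
    using assms by (auto simp: bounded_oper_def)
  show ?thesis
  proof (rule that[of "max K 0"])
    fix u :: "'a \<Rightarrow> complex" assume "ell2 u"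
    show "ell2_norm (T u) \<le> max K 0 * ell2_norm u"
      by (rule order_trans[OF K[OF \<open>ell2 u\<close>]]) (auto intro!: mult_right_mono)
  qed auto
qed

lemma bounded_oper_add: "bounded_oper T \<Longrightarrow> ell2 u \<Longrightarrow> ell2 v \<Longrightarrow> T (\<lambda>x. u x + v x) = (\<lambda>x. T u x + T v x)"
  using bounded_oper_lincomb[of T u v 1 1] by simp

lemma bounded_oper_diff: "bounded_oper T \<Longrightarrow> ell2 u \<Longrightarrow> ell2 v \<Longrightarrow> T (\<lambda>x. u x - v x) = (\<lambda>x. T u x - T v x)"
  using bounded_oper_lincomb[of T u v 1 "-1"] by simp

lemma bounded_oper_scale: "bounded_oper T \<Longrightarrow> ell2 u \<Longrightarrow> T (\<lambda>x. c * u x) = (\<lambda>x. c * T u x)"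
  using bounded_oper_lincomb[of T u u c 0] by simp

lemma bounded_oper_lim:
  assumes T: "bounded_oper T" and U: "ell2_lim U u"
  shows "ell2_lim (\<lambda>k. T (U k)) (T u)"
proof -
  obtain K where K: "0 \<le> K" "\<And>u. ell2 u \<Longrightarrow> ell2_norm (T u) \<le> K * ell2_norm u"
    using bounded_oper_bound[OF T] by blast
  have ell: "ell2 u" "ell2 (U k)" for k using U by (auto simp: ell2_lim_def)
  have "ell2_norm (\<lambda>x. T (U k) x - T u x) \<le> K * ell2_norm (\<lambda>x. U k x - u x)" for k
    using K(2)[OF ell2_diff[OF ell(2,1)]] bounded_oper_diff[OF T ell(2,1)] by simp
  moreover have "(\<lambda>k. K * ell2_norm (\<lambda>x. U k x - u x)) \<longlonglongrightarrow> 0"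
    using U by (intro tendsto_mult_right_zero) (auto simp: ell2_lim_def)
  ultimately have "(\<lambda>k. ell2_norm (\<lambda>x. T (U k) x - T u x)) \<longlonglongrightarrow> 0"
    by (intro null_sequence_if_norm_le[where f = "\<lambda>k. ell2_norm (\<lambda>x. T (U k) x - T u x)"
          and g = "\<lambda>k. K * ell2_norm (\<lambda>x. U k x - u x)"]) simp_all
  then show ?thesis using ell bounded_oper_ell2[OF T] by (simp add: ell2_lim_def)
qed

text \<open>Finitely supported sequences are dense.\<close>

lemma bounded_oper_eqI:
  assumes "bounded_oper S" "bounded_oper T" "\<And>v. finsupp v \<Longrightarrow> S v = T v" "ell2 u"
  shows "S u = T u"
proof -
  obtain U where U: "\<And>k. finsupp (U k)" "ell2_lim U u" using ell2_finsupp_approx[OF assms(4)] by blast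
  show ?thesis
  proof
    fix x
    show "S u x = T u x"
      using ell2_lim_pointwise[OF bounded_oper_lim[OF assms(1) U(2)], of x]
        ell2_lim_pointwise[OF bounded_oper_lim[OF assms(2) U(2)], of x] U(1) assms(3) LIMSEQ_unique by simp
  qed
qed

lemma bounded_oper_comp: "bounded_oper S \<Longrightarrow> bounded_oper T \<Longrightarrow> bounded_oper (\<lambda>u. S (T u))"
proof -
  assume S: "bounded_oper S" and T: "bounded_oper T"
  obtain K where K: "0 \<le> K" "\<And>u. ell2 u \<Longrightarrow> ell2_norm (S u) \<le> K * ell2_norm u"
    using bounded_oper_bound[OF S] by blast
  obtain L where L: "0 \<le> L" "\<And>u. ell2 u \<Longrightarrow> ell2_norm (T u) \<le> L * ell2_norm u"
    using bounded_oper_bound[OF T] by blast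
  have "ell2_norm (S (T u)) \<le> (K * L) * ell2_norm u" if "ell2 u" for u
    using K(2)[OF bounded_oper_ell2[OF T that]] mult_left_mono[OF L(2)[OF that] K(1)] by (simp add: mult.assoc)
  then have "\<exists>K. \<forall>u. ell2 u \<longrightarrow> ell2_norm (S (T u)) \<le> K * ell2_norm u" by blast
  moreover have "ell2 u \<Longrightarrow> ell2 v \<Longrightarrow> S (T (\<lambda>x. a * u x + b * v x)) = (\<lambda>x. a * S (T u) x + b * S (T v) x)" for u v a b
    using bounded_oper_lincomb[OF T, of u v a b]
      bounded_oper_lincomb[OF S bounded_oper_ell2[OF T] bounded_oper_ell2[OF T], of u v a b] by simp
  ultimately show ?thesis
    unfolding bounded_oper_def using bounded_oper_ell2[OF S] bounded_oper_ell2[OF T] by blast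
qed

lemma finsupp_lincomb: "finsupp u \<Longrightarrow> finsupp v \<Longrightarrow> finsupp (\<lambda>x. a * u x + b * v x)"
  unfolding finsupp_def by (rule finite_subset[of _ "{x. u x \<noteq> 0} \<union> {x. v x \<noteq> 0}"]) auto

lemma finsupp_sum: "finite I \<Longrightarrow> (\<And>i. i \<in> I \<Longrightarrow> finsupp (F i)) \<Longrightarrow> finsupp (\<lambda>x. \<Sum>i\<in>I. F i x)"
proof (induction I rule: finite_induct)
  case empty
  then show ?case by (simp add: finsupp_def)
next
  case (insert i I)
  then show ?case using finsupp_lincomb[of "F i" "\<lambda>x. \<Sum>i\<in>I. F i x" 1 1] by simp
qed

lemma ip_finsupp_diff_right: "finsupp v \<Longrightarrow> ip v (\<lambda>x. f x - g x) = ip v f - ip v g"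
  unfolding finsupp_def
  by (simp add: ip_finsupp_left[where S = "{x. v x \<noteq> 0}"] right_diff_distrib sum_subtractf)

lemma ip_finsupp_diff_left:
  assumes "finsupp v" "finsupp w"
  shows "ip (\<lambda>x. v x - w x) u = ip v u - ip w u"
proof -
  let ?S = "{x. v x \<noteq> 0} \<union> {x. w x \<noteq> 0}"
  have "finite ?S" using assms by (simp add: finsupp_def)
  then show ?thesis
    by (subst (1 2 3) ip_finsupp_left[where S = ?S]) (auto simp: left_diff_distrib sum_subtractf)
qed

lemma ip_finsupp_sum_right: "finsupp v \<Longrightarrow> ip v (\<lambda>x. \<Sum>i\<in>I. f i x) = (\<Sum>i\<in>I. ip v (f i))"
  unfolding finsupp_def
  by (simp add: ip_finsupp_left[where S = "{x. v x \<noteq> 0}"] sum_distrib_left) (rule sum.swap)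

lemma ip_finsupp_sum_left:
  assumes "finite I" "\<And>i. i \<in> I \<Longrightarrow> finsupp (f i)"
  shows "ip (\<lambda>x. \<Sum>i\<in>I. f i x) u = (\<Sum>i\<in>I. ip (f i) u)"
proof -
  let ?S = "\<Union>i\<in>I. {x. f i x \<noteq> 0}"
  have S: "finite ?S" using assms by (auto simp: finsupp_def)
  have "ip (\<lambda>x. \<Sum>i\<in>I. f i x) u = (\<Sum>x\<in>?S. cnj (\<Sum>i\<in>I. f i x) * u x)"
    by (rule ip_finsupp_left[OF S]) (auto dest: sum.not_neutral_contains_not_neutral)
  also have "\<dots> = (\<Sum>i\<in>I. \<Sum>x\<in>?S. cnj (f i x) * u x)"
    by (simp add: sum_distrib_right) (rule sum.swap)
  also have "\<dots> = (\<Sum>i\<in>I. ip (f i) u)"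
    by (intro sum.cong refl ip_finsupp_left[OF S, symmetric]) auto
  finally show ?thesis .
qed

section \<open>Projection-valued measures\<close>

locale pvm =
  fixes P :: "real set \<Rightarrow> 'a oper"
  assumes proj: "B \<in> sets borel \<Longrightarrow> orth_projection (P B)"
    and UNIV: "ell2 u \<Longrightarrow> P UNIV u = u"
    and countably_additive: "range F \<subseteq> sets borel \<Longrightarrow> disjoint_family F \<Longrightarrow> ell2 u \<Longrightarrow>
      ell2_lim (\<lambda>k x. \<Sum>i<k. P (F i) u x) (P (\<Union>i. F i) u)"
begin

lemma bounded: "B \<in> sets borel \<Longrightarrow> bounded_oper (P B)"
  using proj by (simp add: orth_projection_def)

lemma ell2: "B \<in> sets borel \<Longrightarrow> ell2 u \<Longrightarrow> ell2 (P B u)"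
  using bounded bounded_oper_ell2 by blast

lemma idem: "B \<in> sets borel \<Longrightarrow> ell2 u \<Longrightarrow> P B (P B u) = P B u"
  using proj by (simp add: orth_projection_def)

lemma symmetric: "B \<in> sets borel \<Longrightarrow> ell2 u \<Longrightarrow> ell2 v \<Longrightarrow> ip (P B u) v = ip u (P B v)"
  using proj by (simp add: orth_projection_def)

lemma ip_proj: "B \<in> sets borel \<Longrightarrow> ell2 u \<Longrightarrow> ip u (P B u) = complex_of_real ((ell2_norm (P B u))\<^sup>2)"
  using symmetric[of B u "P B u"] idem[of B u] ell2[of B u] ip_self[of "P B u"] by simp

text \<open>\<open>\<parallel>P u\<parallel>\<^sup>2 = \<langle>u, P u\<rangle>\<close>, and Cauchy--Schwarz.\<close>

lemma norm_le:
  assumes B: "B \<in> sets borel" and u: "ell2 u"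
  shows "ell2_norm (P B u) \<le> ell2_norm u"
proof -
  have "(ell2_norm (P B u))\<^sup>2 = cmod (ip u (P B u))"
    unfolding ip_proj[OF assms] norm_of_real by simp
  also have "\<dots> \<le> ell2_norm u * ell2_norm (P B u)"
    using ip_Cauchy_Schwarz[OF u ell2[OF assms]] .
  finally show ?thesis
    by (cases "ell2_norm (P B u) = 0") (auto simp: power2_eq_square less_le)
qed

text \<open>Additivity for the constant family of empty sets makes the partial sums \<open>k P{} u\<close> converge.\<close>

lemma empty:
  assumes "ell2 u"
  shows "P {} u = (\<lambda>x. 0)"
proof
  fix x
  have "(\<lambda>k. \<Sum>i<k. P {} u x) \<longlonglongrightarrow> P {} u x"
    using ell2_lim_pointwise[OF countably_additive[of "\<lambda>i. {}" u], of x] assms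
    by (simp add: disjoint_family_on_def)
  then have "(\<lambda>k. (\<Sum>i<Suc k. P {} u x) - (\<Sum>i<k. P {} u x)) \<longlonglongrightarrow> P {} u x - P {} u x"
    by (intro tendsto_diff LIMSEQ_Suc)
  moreover have "(\<Sum>i<Suc k. P {} u x) - (\<Sum>i<k. P {} u x) = P {} u x" for k :: nat
    by (simp add: algebra_simps)
  ultimately show "P {} u x = 0" by (simp only: LIMSEQ_const_iff diff_self)
qed

lemma union:
  assumes A: "A \<in> sets borel" and B: "B \<in> sets borel" and "A \<inter> B = {}" and u: "ell2 u"
  shows "P (A \<union> B) u = (\<lambda>x. P A u x + P B u x)"
proof
  fix x
  have "range (binaryset A B) \<subseteq> sets borel" using A B by (auto simp: range_binaryset_eq)
  moreover have "disjoint_family (binaryset A B)"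
    using assms(3) by (auto simp: disjoint_family_on_def binaryset_def)
  ultimately have "(\<lambda>k. \<Sum>i<k. P (binaryset A B i) u x) \<longlonglongrightarrow> P (A \<union> B) u x"
    using ell2_lim_pointwise[OF countably_additive[of "binaryset A B" u], of x] u
    by (simp add: UN_binaryset_eq)
  then have "(\<lambda>k. \<Sum>i<Suc (Suc k). P (binaryset A B i) u x) \<longlonglongrightarrow> P (A \<union> B) u x"
    by (intro LIMSEQ_Suc)
  moreover have "(\<Sum>i<Suc (Suc k). P (binaryset A B i) u x) = P A u x + P B u x" for k
    unfolding sum.lessThan_Suc_shift by (simp add: binaryset_def empty[OF u])
  ultimately show "P (A \<union> B) u x = P A u x + P B u x" by (simp add: LIMSEQ_const_iff)
qed

text \<open>\<open>P (A \<union> B)\<close> is a contraction: on the range of \<open>P A\<close> no room is left for a component in the range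
  of \<open>P B\<close>.\<close>

lemma disjoint:
  assumes A: "A \<in> sets borel" and B: "B \<in> sets borel" and AB: "A \<inter> B = {}" and u: "ell2 u"
  shows "P B (P A u) = (\<lambda>x. 0)"
proof -
  let ?w = "P A u"
  have w: "ell2 ?w" using ell2 A u .
  have "complex_of_real ((ell2_norm (P (A \<union> B) ?w))\<^sup>2) = ip ?w (P (A \<union> B) ?w)"
    using ip_proj A B w by simp
  also have "\<dots> = ip ?w (P A ?w) + ip ?w (P B ?w)"
    unfolding union[OF A B AB w] using w ell2 A B by (simp add: ip_add_right)
  also have "\<dots> = complex_of_real ((ell2_norm ?w)\<^sup>2 + (ell2_norm (P B ?w))\<^sup>2)"
    by (simp add: ip_proj[OF B w] idem[OF A u] ip_self[OF w])
  finally have "(ell2_norm (P (A \<union> B) ?w))\<^sup>2 = (ell2_norm ?w)\<^sup>2 + (ell2_norm (P B ?w))\<^sup>2"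
    unfolding of_real_eq_iff .
  moreover have "(ell2_norm (P (A \<union> B) ?w))\<^sup>2 \<le> (ell2_norm ?w)\<^sup>2"
    using norm_le[of "A \<union> B" ?w] A B w by (intro power_mono) auto
  ultimately have "ell2_norm (P B ?w) = 0" by simp
  then show ?thesis using ell2_norm_eq_0 ell2 B w by blast
qed

lemma inter:
  assumes A: "A \<in> sets borel" and B: "B \<in> sets borel" and u: "ell2 u"
  shows "P A (P B u) = P (A \<inter> B) u"
proof -
  have *: "P C (P D u) = P C u" if "C \<subseteq> D" "C \<in> sets borel" "D \<in> sets borel" for C D
  proof -
    have "D = C \<union> (D - C)" using that by blast
    then have "P D u = (\<lambda>x. P C u x + P (D - C) u x)"
      using union[of C "D - C" u] that u by auto
    then have "P C (P D u) = (\<lambda>x. P C (P C u) x + P C (P (D - C) u) x)"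
      using bounded_oper_add[OF bounded[of C] ell2[of C u] ell2[of "D - C" u]] that u by auto
    then show ?thesis using idem[of C u] disjoint[of "D - C" C u] that u by (simp add: Diff_disjoint Int_commute)
  qed
  have "P A (P B u) = (\<lambda>x. P (A \<inter> B) (P B u) x + P (A - B) (P B u) x)"
    using union[of "A \<inter> B" "A - B" "P B u"] ell2[OF B u] A B by (auto simp: Int_Diff_Un)
  then show ?thesis using *[of "A \<inter> B" B] disjoint[of B "A - B" u] A B u by auto
qed

lemma space_scalar_measure [simp]: "space (scalar_measure P u) = UNIV"
  and sets_scalar_measure [simp, measurable_cong]: "sets (scalar_measure P u) = sets borel"
  using sets.sets_measure_of_eq[of borel] by (simp_all add: scalar_measure_def)

lemma emeasure_scalar_measure:
  assumes u: "ell2 u" and B: "B \<in> sets borel"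
  shows "emeasure (scalar_measure P u) B = ennreal ((ell2_norm (P B u))\<^sup>2)"
proof -
  let ?\<mu> = "\<lambda>B. ennreal (Re (ip u (P B u)))"
  have "countably_additive (sets borel) ?\<mu>"
    unfolding countably_additive_def
  proof (intro allI impI)
    fix A :: "nat \<Rightarrow> real set"
    assume A: "range A \<subseteq> sets borel" "disjoint_family A"
    have b: "A i \<in> sets borel" for i using A by auto
    have "(\<lambda>k. ip u (\<lambda>x. \<Sum>i<k. P (A i) u x)) \<longlonglongrightarrow> ip u (P (\<Union>i. A i) u)"
      using ell2_lim_ip[OF ell2_lim_const[OF u] countably_additive[OF A u]] .
    moreover have "ip u (\<lambda>x. \<Sum>i<k. P (A i) u x) = (\<Sum>i<k. ip u (P (A i) u))" for k
      using u ell2[OF b u] by (intro ip_sum_right) auto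
    ultimately have "(\<lambda>k. \<Sum>i<k. ip u (P (A i) u)) \<longlonglongrightarrow> ip u (P (\<Union>i. A i) u)" by simp
    then have "(\<lambda>k. Re (\<Sum>i<k. ip u (P (A i) u))) \<longlonglongrightarrow> Re (ip u (P (\<Union>i. A i) u))"
      by (rule tendsto_Re)
    then have "(\<lambda>i. Re (ip u (P (A i) u))) sums Re (ip u (P (\<Union>i. A i) u))"
      by (simp add: sums_def Re_sum)
    then show "(\<Sum>i. ?\<mu> (A i)) = ?\<mu> (\<Union>i. A i)"
      by (intro suminf_ennreal_eq) (simp_all add: ip_proj[OF b u])
  qed
  moreover have "positive (sets borel) ?\<mu>" by (simp add: positive_def empty[OF u])
  ultimately have "emeasure (scalar_measure P u) B = ?\<mu> B"
    using B sets.sigma_algebra_axioms[of "borel :: real measure"]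
    unfolding scalar_measure_def by (intro emeasure_measure_of_sigma) auto
  then show ?thesis by (simp add: ip_proj[OF B u])
qed

lemma finite_scalar_measure: "ell2 u \<Longrightarrow> finite_measure (scalar_measure P u)"
  by (intro finite_measureI) (simp add: emeasure_scalar_measure)

lemma measure_scalar_measure:
  "ell2 u \<Longrightarrow> B \<in> sets borel \<Longrightarrow> measure (scalar_measure P u) B = (ell2_norm (P B u))\<^sup>2"
  by (simp add: measure_def emeasure_scalar_measure)

text \<open>The projections multiply: \<open>P A (P B u) = P (A \<inter> B) u\<close>.\<close>

lemma scalar_measure_restrict:
  assumes u: "ell2 u" and B: "B \<in> sets borel"
  shows "scalar_measure P (P B u) = density (scalar_measure P u) (indicator B)"
proof (rule measure_eqI)
  fix A assume "A \<in> sets (scalar_measure P (P B u))"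
  then have A: "A \<in> sets borel" by simp
  have "emeasure (density (scalar_measure P u) (indicator B)) A = emeasure (scalar_measure P u) (B \<inter> A)"
    using A B by (simp add: emeasure_density nn_integral_indicator flip: indicator_inter_arith)
  then show "emeasure (scalar_measure P (P B u)) A = emeasure (density (scalar_measure P u) (indicator B)) A"
    using A B u by (simp add: emeasure_scalar_measure ell2 inter Int_commute)
qed simp

end

lemma spectral_measure_iff_pvm:
  "spectral_measure T P \<longleftrightarrow> pvm P \<and>
     (\<forall>u. ell2 u \<longrightarrow> integrable (scalar_measure P u) (\<lambda>t. t) \<and>
        ip u (T u) = complex_of_real (integral\<^sup>L (scalar_measure P u) (\<lambda>t. t)))"
  unfolding spectral_measure_def pvm_def by blast

section \<open>Approximate eigenvectors and spectral projections\<close>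

text \<open>The hypothesis gives the quadratic form of \<open>T\<close> only. It splits along \<open>P B\<close> and \<open>P (- B)\<close>, since the
  scalar measures do, and polarisation kills the mixed terms.\<close>

lemma spectral_measure_reduces:
  assumes T: "bounded_oper T" and S: "spectral_measure T P" and B: "B \<in> sets borel"
    and u: "ell2 u" and w: "ell2 w"
  shows "ip (P B u) (T (P (- B) w)) = 0"
proof -
  interpret pvm P using S by (simp add: spectral_measure_iff_pvm)
  have nB: "- B \<in> sets borel" using B by auto
  have ipT: "ip u (T u) = complex_of_real (integral\<^sup>L (scalar_measure P u) (\<lambda>t. t))"
    and int: "integrable (scalar_measure P u) (\<lambda>t. t)" if "ell2 u" for u
    using S that by (auto simp: spectral_measure_iff_pvm)
  have split: "ip z (T z) = ip (P B z) (T (P B z)) + ip (P (- B) z) (T (P (- B) z))" if z: "ell2 z" for z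
  proof -
    let ?\<mu> = "scalar_measure P z"
    have part: "ip (P C z) (T (P C z)) = complex_of_real (\<integral>t. indicator C t * t \<partial>?\<mu>)" if C: "C \<in> sets borel" for C
    proof -
      have "integral\<^sup>L (density ?\<mu> (\<lambda>x. ennreal (indicator C x))) (\<lambda>t. t) = (\<integral>t. indicator C t *\<^sub>R t \<partial>?\<mu>)"
        using C by (intro integral_density) auto
      then show ?thesis using ipT[OF ell2[OF C z]] scalar_measure_restrict[OF z C]
        by (simp add: ennreal_indicator)
    qed
    have "integral\<^sup>L ?\<mu> (\<lambda>t. t) = (\<integral>t. indicator B t * t + indicator (- B) t * t \<partial>?\<mu>)"
      by (intro Bochner_Integration.integral_cong refl) (auto simp: indicator_def)
    also have "\<dots> = (\<integral>t. indicator B t * t \<partial>?\<mu>) + (\<integral>t. indicator (- B) t * t \<partial>?\<mu>)"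
      using int[OF z] B nB integrable_mult_indicator[of _ ?\<mu> "\<lambda>t. t"]
      by (intro Bochner_Integration.integral_add) auto
    finally show ?thesis using ipT[OF z] part[OF B] part[OF nB] by simp
  qed
  let ?v = "P B u"
  have v: "ell2 ?v" using ell2 B u .
  have Pw: "ell2 (P (- B) w)" using ell2 nB w .
  have cross: "c * ip ?v (T (P (- B) w)) + cnj c * ip (P (- B) w) (T ?v) = 0" for c
  proof -
    let ?w = "\<lambda>x. c * P (- B) w x"
    have w': "ell2 ?w" using Pw by (rule ell2_scale)
    have 1: "P B ?w = (\<lambda>x. 0)" "P (- B) ?w = ?w"
      using disjoint[OF nB B _ w] idem[OF nB w] bounded_oper_scale[OF bounded Pw] B nB by auto
    have 2: "P B ?v = ?v" "P (- B) ?v = (\<lambda>x. 0)"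
      using idem[OF B u] disjoint[OF B nB _ u] by auto
    have "P B (\<lambda>x. ?v x + ?w x) = ?v" "P (- B) (\<lambda>x. ?v x + ?w x) = ?w"
      using bounded_oper_add[OF bounded v w'] B nB 1 2 by auto
    then have "ip (\<lambda>x. ?v x + ?w x) (T (\<lambda>x. ?v x + ?w x)) = ip ?v (T ?v) + ip ?w (T ?w)"
      using split[OF ell2_add[OF v w']] by simp
    moreover have "ip (\<lambda>x. ?v x + ?w x) (T (\<lambda>x. ?v x + ?w x))
        = ip ?v (T ?v) + ip ?v (T ?w) + (ip ?w (T ?v) + ip ?w (T ?w))"
      using v w' bounded_oper_ell2[OF T] by (simp add: bounded_oper_add[OF T v w'] ip_add_left ip_add_right ell2_add)
    ultimately have "ip ?v (T ?w) + ip ?w (T ?v) = 0" by simp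
    then show ?thesis
      using bounded_oper_scale[OF T Pw, of c] by (simp add: ip_scale_right ip_scale_left)
  qed
  have "ip ?v (T (P (- B) w)) + ip (P (- B) w) (T ?v) = 0"
    using cross[of 1] by simp
  moreover have "\<i> * (ip ?v (T (P (- B) w)) - ip (P (- B) w) (T ?v)) = 0"
    using cross[of \<i>] by (simp add: algebra_simps)
  ultimately show ?thesis by simp
qed

text \<open>The scalar measure of a vector in the range of \<open>P C\<close> lives on \<open>C\<close>, which bounds its first moment.\<close>

lemma spectral_measure_half_line_bounds:
  assumes T: "bounded_oper T" and S: "spectral_measure T P" and u: "ell2 u"
  shows "b * (ell2_norm (P {b..} u))\<^sup>2 \<le> Re (ip (P {b..} u) (T (P {b..} u)))"
    and "Re (ip (P {..b} u) (T (P {..b} u))) \<le> b * (ell2_norm (P {..b} u))\<^sup>2"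
proof -
  interpret pvm P using S by (simp add: spectral_measure_iff_pvm)
  have ipT: "ip u (T u) = complex_of_real (integral\<^sup>L (scalar_measure P u) (\<lambda>t. t))"
    and int: "integrable (scalar_measure P u) (\<lambda>t. t)" if "ell2 u" for u
    using S that by (auto simp: spectral_measure_iff_pvm)
  have ae: "AE t in scalar_measure P (P C u). t \<in> C" if C: "C \<in> sets borel" for C
  proof -
    have "AE t in density (scalar_measure P u) (indicator C). t \<in> C"
      using C by (subst AE_density) (auto simp: indicator_def)
    then show ?thesis by (simp only: scalar_measure_restrict[OF u C])
  qed
  have const: "(\<integral>t. b \<partial>scalar_measure P (P C u)) = b * (ell2_norm (P C u))\<^sup>2" if C: "C \<in> sets borel" for C
    using measure_scalar_measure[OF ell2[OF C u], of UNIV] UNIV[OF ell2[OF C u]]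
    by (simp only: lebesgue_integral_const space_scalar_measure) simp
  have fin: "finite_measure (scalar_measure P (P C u))" if C: "C \<in> sets borel" for C
    using finite_scalar_measure ell2 C u by blast
  have ic: "integrable (scalar_measure P (P C u)) (\<lambda>t. b)" if C: "C \<in> sets borel" for C
    using finite_measure.integrable_const[OF fin[OF C]] .
  have "(\<integral>t. b \<partial>scalar_measure P (P {b..} u)) \<le> integral\<^sup>L (scalar_measure P (P {b..} u)) (\<lambda>t. t)"
    using ae[of "{b..}"] by (intro integral_mono_AE ic int ell2 u) auto
  then show "b * (ell2_norm (P {b..} u))\<^sup>2 \<le> Re (ip (P {b..} u) (T (P {b..} u)))"
    using ipT[OF ell2[of "{b..}" u]] u const[of "{b..}"] by (simp del: lebesgue_integral_const)
  have "integral\<^sup>L (scalar_measure P (P {..b} u)) (\<lambda>t. t) \<le> (\<integral>t. b \<partial>scalar_measure P (P {..b} u))"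
    using ae[of "{..b}"] by (intro integral_mono_AE ic int ell2 u) auto
  then show "Re (ip (P {..b} u) (T (P {..b} u))) \<le> b * (ell2_norm (P {..b} u))\<^sup>2"
    using ipT[OF ell2[of "{..b}" u]] u const[of "{..b}"] by (simp del: lebesgue_integral_const)
qed

text \<open>The two components of \<open>u\<close> outside the interval are tested against \<open>(T - E) u\<close>. By the reduction
  only the component itself contributes, and there \<open>T - E\<close> is bounded away from \<open>0\<close> with a definite sign.\<close>

lemma spectral_projection_approx_eigenvector:
  assumes T: "bounded_oper T" and S: "spectral_measure T P" and u: "ell2 u" and E: "a < E" "E < b"
  shows "ell2_norm (\<lambda>x. u x - P {a<..<b} u x)
    \<le> (1 / (b - E) + 1 / (E - a)) * ell2_norm (\<lambda>x. T u x - complex_of_real E * u x)"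
proof -
  interpret pvm P using S by (simp add: spectral_measure_iff_pvm)
  let ?r = "\<lambda>x. T u x - complex_of_real E * u x"
  have Tu: "ell2 (T u)" using bounded_oper_ell2[OF T u] .
  have r: "ell2 ?r" using Tu u by (intro ell2_diff ell2_scale)
  have component: "ip (P C u) ?r = ip (P C u) (T (P C u)) - complex_of_real (E * (ell2_norm (P C u))\<^sup>2)"
    if C: "C \<in> sets borel" for C
  proof -
    have nC: "- C \<in> sets borel" using C by auto
    note PC = ell2[OF C u] and PnC = ell2[OF nC u]
    have "u = (\<lambda>x. P C u x + P (- C) u x)"
      using union[OF C nC _ u] UNIV[OF u] by (simp add: Compl_partition)
    then have "T u = (\<lambda>x. T (P C u) x + T (P (- C) u) x)"
      using bounded_oper_add[OF T PC PnC] by simp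
    then have "ip (P C u) (T u) = ip (P C u) (T (P C u))"
      using spectral_measure_reduces[OF T S C u u] PC bounded_oper_ell2[OF T PC] bounded_oper_ell2[OF T PnC]
      by (simp add: ip_add_right)
    moreover have "ip (P C u) u = complex_of_real ((ell2_norm (P C u))\<^sup>2)"
      using ip_proj[OF C u] symmetric[OF C u u] by simp
    ultimately show ?thesis
      using PC Tu u by (simp add: ip_diff_right ell2_scale ip_scale_right)
  qed
  have bound: "ell2_norm (P C u) \<le> 1 / d * ell2_norm ?r"
    if C: "C \<in> sets borel" and d: "0 < d" "d * (ell2_norm (P C u))\<^sup>2 \<le> \<bar>Re (ip (P C u) ?r)\<bar>" for C d
  proof (cases "ell2_norm (P C u) = 0")
    case True
    then show ?thesis using d by (metis divide_nonneg_pos ell2_norm_nonneg mult_nonneg_nonneg zero_le_one)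
  next
    case False
    have "d * (ell2_norm (P C u))\<^sup>2 \<le> ell2_norm (P C u) * ell2_norm ?r"
      using d(2) abs_Re_le_cmod ip_Cauchy_Schwarz[OF ell2[OF C u] r] by (meson order_trans)
    then have "d * ell2_norm (P C u) \<le> ell2_norm ?r"
      using False by (simp add: power2_eq_square mult.left_commute less_le)
    then show ?thesis using d(1) by (simp add: field_simps)
  qed
  have Re_component: "Re (ip (P C u) ?r) = Re (ip (P C u) (T (P C u))) - E * (ell2_norm (P C u))\<^sup>2"
    if "C \<in> sets borel" for C
    unfolding component[OF that] by simp
  have up: "ell2_norm (P {b..} u) \<le> 1 / (b - E) * ell2_norm ?r"
    by (rule bound) (use spectral_measure_half_line_bounds(1)[OF T S u, of b] Re_component[of "{b..}"] E in \<open>auto simp: algebra_simps\<close>)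
  have dn: "ell2_norm (P {..a} u) \<le> 1 / (E - a) * ell2_norm ?r"
    by (rule bound) (use spectral_measure_half_line_bounds(2)[OF T S u, of a] Re_component[of "{..a}"] E in \<open>auto simp: algebra_simps\<close>)
  have "P ({..a} \<union> {b..} \<union> {a<..<b}) u = (\<lambda>x. P ({..a} \<union> {b..}) u x + P {a<..<b} u x)"
    using u by (intro union) auto
  moreover have "P ({..a} \<union> {b..}) u = (\<lambda>x. P {..a} u x + P {b..} u x)"
    using u E by (intro union) auto
  moreover have "{..a} \<union> {b..} \<union> {a<..<b} = UNIV" by auto
  ultimately have "u = (\<lambda>x. P {..a} u x + P {b..} u x + P {a<..<b} u x)"
    using UNIV[OF u] by simp
  from fun_cong[OF this] have "(\<lambda>x. u x - P {a<..<b} u x) = (\<lambda>x. P {..a} u x + P {b..} u x)"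
    by (simp add: fun_eq_iff)
  then have "ell2_norm (\<lambda>x. u x - P {a<..<b} u x) \<le> ell2_norm (P {..a} u) + ell2_norm (P {b..} u)"
    using ell2_norm_triangle[OF ell2[OF _ u] ell2[OF _ u], of "{..a}" "{b..}"] by simp
  then show ?thesis using up dn by (simp add: distrib_right)
qed

section \<open>Laurent operators\<close>

text \<open>The operators generated by the shifts, paired with their symbols. A shift by \<open>k\<close> multiplies the plane
  wave \<open>e\<^bsup>i n\<theta>\<^esup>\<close> by \<open>e\<^bsup>-i k\<theta>\<^esup>\<close>. The generators are single-coordinate shifts, so that a property of all these
  operators follows by induction from its validity for the shifts and its stability under sums and
  compositions.\<close>

inductive laurent :: "(int^'d::finite) oper \<Rightarrow> (('d \<Rightarrow> real) \<Rightarrow> complex) \<Rightarrow> bool" where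
  shift: "laurent (shift i m) (\<lambda>\<theta>. cis (- (of_int m * \<theta> i)))"
| lincomb: "laurent S \<sigma> \<Longrightarrow> laurent T \<tau> \<Longrightarrow> laurent (\<lambda>u n. a * S u n + b * T u n) (\<lambda>\<theta>. a * \<sigma> \<theta> + b * \<tau> \<theta>)"
| comp: "laurent S \<sigma> \<Longrightarrow> laurent T \<tau> \<Longrightarrow> laurent (\<lambda>u. S (T u)) (\<lambda>\<theta>. \<sigma> \<theta> * \<tau> \<theta>)"

lemma bij_minus_axis: "bij (\<lambda>n :: int^'d::finite. n - axis i m)"
  by (rule bij_betw_byWitness[where f' = "\<lambda>n. n + axis i m"]) auto

lemma ell2_shift: "ell2 u \<Longrightarrow> ell2 (shift i m u)" and ell2_norm_shift: "ell2_norm (shift i m u) = ell2_norm u"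
  unfolding shift_def using ell2_reindex[OF bij_minus_axis, of u i m] by auto

lemma laurent_linear:
  "laurent T \<tau> \<Longrightarrow> T (\<lambda>x. a * u x + b * v x) = (\<lambda>x. a * T u x + b * T v x)"
proof (induction arbitrary: u v a b rule: laurent.induct)
  case (shift i m)
  then show ?case by (simp add: shift_def)
next
  case (lincomb S \<sigma> T \<tau> c d)
  then show ?case by (simp only:) (simp add: algebra_simps)
next
  case (comp S \<sigma> T \<tau>)
  then show ?case by (simp only:)
qed

lemma laurent_linear_sum:
  assumes "laurent T \<tau>" "finite I"
  shows "T (\<lambda>x. \<Sum>i\<in>I. c i * U i x) = (\<lambda>x. \<Sum>i\<in>I. c i * T (U i) x)"
  using assms(2)
proof (induction I rule: finite_induct)
  case empty
  show ?case using laurent_linear[OF assms(1), of 0 "\<lambda>x. 0" 0 "\<lambda>x. 0"] by simp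
next
  case (insert i I)
  then show ?case using laurent_linear[OF assms(1), of "c i" "U i" 1 "\<lambda>x. \<Sum>i\<in>I. c i * U i x"] by simp
qed

lemma laurent_pointwise_continuous:
  "laurent T \<tau> \<Longrightarrow> (\<And>n. (\<lambda>k. U k n) \<longlonglongrightarrow> u n) \<Longrightarrow> (\<lambda>k. T (U k) n) \<longlonglongrightarrow> T u n"
proof (induction arbitrary: U u n rule: laurent.induct)
  case (shift i m)
  then show ?case by (simp add: shift_def)
next
  case (lincomb S \<sigma> T \<tau> a b)
  show ?case
    by (intro tendsto_add tendsto_mult tendsto_const lincomb.IH lincomb.prems)
next
  case (comp S \<sigma> T \<tau>)
  show ?case by (rule comp.IH(1)[OF comp.IH(2)[OF comp.prems]])
qed

lemma laurent_finsupp: "laurent T \<tau> \<Longrightarrow> finsupp u \<Longrightarrow> finsupp (T u)"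
proof (induction arbitrary: u rule: laurent.induct)
  case (shift i m)
  have "finite ((\<lambda>n. n - axis i m) -` {x. u x \<noteq> 0})"
    using shift bij_minus_axis[of i m] by (intro finite_vimageI) (auto simp: finsupp_def bij_def)
  then show ?case by (simp add: finsupp_def shift_def vimage_def)
qed (auto intro: finsupp_lincomb)

lemma laurent_bounded: "laurent (T :: (int^'d::finite) oper) \<tau> \<Longrightarrow> bounded_oper T"
proof (induction rule: laurent.induct)
  case (shift i m)
  show ?case
    by (rule bounded_operI[where K = 1]) (simp_all add: ell2_shift ell2_norm_shift laurent_linear[OF laurent.shift])
next
  case (lincomb S \<sigma> T \<tau> a b)
  obtain K where K: "\<And>u. ell2 u \<Longrightarrow> ell2_norm (S u) \<le> K * ell2_norm u"
    using bounded_oper_bound[OF lincomb.IH(1)] by blast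
  obtain L where L: "\<And>u. ell2 u \<Longrightarrow> ell2_norm (T u) \<le> L * ell2_norm u"
    using bounded_oper_bound[OF lincomb.IH(2)] by blast
  have "ell2_norm (\<lambda>n. a * S u n + b * T u n) \<le> (cmod a * K + cmod b * L) * ell2_norm u" if u: "ell2 u" for u
  proof -
    have "ell2 (S u)" "ell2 (T u)" using lincomb.IH u bounded_oper_ell2 by auto
    then have "ell2_norm (\<lambda>n. a * S u n + b * T u n) \<le> cmod a * ell2_norm (S u) + cmod b * ell2_norm (T u)"
      using ell2_norm_triangle[of "\<lambda>n. a * S u n" "\<lambda>n. b * T u n"] by (simp add: ell2_scale ell2_norm_scale)
    also have "\<dots> \<le> cmod a * (K * ell2_norm u) + cmod b * (L * ell2_norm u)"
      using K L u by (intro add_mono mult_left_mono) auto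
    finally show ?thesis by (simp add: algebra_simps)
  qed
  then show ?case
    using lincomb.IH[THEN bounded_oper_ell2]
    by (intro bounded_operI[where K = "cmod a * K + cmod b * L"] ell2_lincomb
        laurent_linear[OF laurent.lincomb[OF lincomb.hyps]]) auto
next
  case (comp S \<sigma> T \<tau>)
  then show ?case by (rule_tac bounded_oper_comp)
qed

lemma laurent_ell2: "laurent T \<tau> \<Longrightarrow> ell2 u \<Longrightarrow> ell2 (T u)"
  using laurent_bounded bounded_oper_ell2 by blast

lemma laurent_scale: "laurent T \<tau> \<Longrightarrow> laurent (\<lambda>u n. a * T u n) (\<lambda>\<theta>. a * \<tau> \<theta>)"
  using laurent.lincomb[of T \<tau> T \<tau> a 0] by simp

lemma laurent_add: "laurent S \<sigma> \<Longrightarrow> laurent T \<tau> \<Longrightarrow> laurent (\<lambda>u n. S u n + T u n) (\<lambda>\<theta>. \<sigma> \<theta> + \<tau> \<theta>)"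
  using laurent.lincomb[of S \<sigma> T \<tau> 1 1] by simp

lemma laurent_diff: "laurent S \<sigma> \<Longrightarrow> laurent T \<tau> \<Longrightarrow> laurent (\<lambda>u n. S u n - T u n) (\<lambda>\<theta>. \<sigma> \<theta> - \<tau> \<theta>)"
  using laurent.lincomb[of S \<sigma> T \<tau> 1 "-1"] by simp

lemma laurent_const: "laurent (\<lambda>(u :: int^'d::finite \<Rightarrow> complex) n. c * u n) (\<lambda>\<theta>. c)"
proof -
  have [simp]: "axis (i :: 'd) (0 :: int) = 0" for i by (simp add: axis_def vec_eq_iff)
  show ?thesis using laurent_scale[OF laurent.shift[of "undefined :: 'd" 0], of c] by (simp add: shift_def)
qed

lemma laurent_sum:
  "(\<And>i. i \<in> I \<Longrightarrow> laurent (T i) (\<tau> i)) \<Longrightarrow> laurent (\<lambda>u n. \<Sum>i\<in>I. T i u n) (\<lambda>\<theta>. \<Sum>i\<in>I. \<tau> i \<theta>)"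
proof (induction I rule: infinite_finite_induct)
  case (insert i I)
  then show ?case using laurent_add[of "T i" "\<tau> i" "\<lambda>u n. \<Sum>i\<in>I. T i u n" "\<lambda>\<theta>. \<Sum>i\<in>I. \<tau> i \<theta>"] by simp
qed (use laurent_const[of 0] in simp_all)

subsection \<open>Truncated plane waves are approximate eigenvectors\<close>

text \<open>The support is finite, where the commutator is given by its defining expression, and a shift by \<open>m\<close>
  changes only a boundary layer, a fraction of at most \<open>2 |m| / R\<close> of the box.\<close>

definition plane_wave :: "('d::finite \<Rightarrow> real) \<Rightarrow> nat \<Rightarrow> int^'d \<Rightarrow> complex" where
  "plane_wave \<theta> R n = (if \<forall>i. n $ i \<in> {0..<int R} then cis (\<Sum>i\<in>UNIV. of_int (n $ i) * \<theta> i) else 0)"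

lemma card_vec_box:
  assumes "\<And>j. finite (S j)"
  shows "finite {n :: 'a^'d::finite. \<forall>j. n $ j \<in> S j}"
    and "card {n :: 'a^'d. \<forall>j. n $ j \<in> S j} = (\<Prod>j\<in>UNIV. card (S j))"
proof -
  have eq: "{n :: 'a^'d. \<forall>j. n $ j \<in> S j} = vec_lambda ` (Pi\<^sub>E UNIV S)"
  proof (intro equalityI subsetI)
    fix n :: "'a^'d" assume "n \<in> {n. \<forall>j. n $ j \<in> S j}"
    then show "n \<in> vec_lambda ` (Pi\<^sub>E UNIV S)" by (intro image_eqI[of _ _ "vec_nth n"]) auto
  qed auto
  have inj: "inj_on vec_lambda (Pi\<^sub>E UNIV S :: ('d \<Rightarrow> 'a) set)"
    by (rule inj_onI) (metis vec_lambda_inverse UNIV_I)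
  show "finite {n :: 'a^'d. \<forall>j. n $ j \<in> S j}"
    unfolding eq using assms by (intro finite_imageI finite_PiE) auto
  show "card {n :: 'a^'d. \<forall>j. n $ j \<in> S j} = (\<Prod>j\<in>UNIV. card (S j))"
    unfolding eq using inj by (simp add: card_image card_PiE)
qed

lemma finsupp_plane_wave: "finsupp (plane_wave \<theta> R)"
  unfolding finsupp_def
  by (rule finite_subset[OF _ card_vec_box(1)[of "\<lambda>_. {0..<int R}"]]) (auto simp: plane_wave_def)

lemma ell2_plane_wave [simp]: "ell2 (plane_wave \<theta> R)"
  by (simp add: finsupp_ell2 finsupp_plane_wave)

lemma ell2_norm_plane_wave: "(ell2_norm (plane_wave (\<theta> :: 'd::finite \<Rightarrow> real) R))\<^sup>2 = real R ^ CARD('d)"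
proof -
  let ?W = "{n :: int^'d. \<forall>j. n $ j \<in> {0..<int R}}"
  have "(ell2_norm (plane_wave \<theta> R))\<^sup>2 = (\<Sum>\<^sub>\<infinity>n\<in>?W. 1)"
    unfolding ell2_norm_power2 by (rule infsum_cong_neutral) (auto simp: plane_wave_def)
  also have "\<dots> = real (card ?W)" by simp
  also have "card ?W = R ^ CARD('d)" using card_vec_box(2)[of "\<lambda>_ :: 'd. {0..<int R}"] by simp
  finally show ?thesis by simp
qed

lemma shift_plane_wave:
  fixes \<theta> :: "'d::finite \<Rightarrow> real"
  assumes "0 < R"
  shows "(ell2_norm (\<lambda>n. shift i m (plane_wave \<theta> R) n - cis (- (of_int m * \<theta> i)) * plane_wave \<theta> R n))\<^sup>2
    \<le> (2 * \<bar>of_int m\<bar> / real R) * (ell2_norm (plane_wave \<theta> R))\<^sup>2"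
proof -
  let ?v = "\<lambda>n. shift i m (plane_wave \<theta> R) n - cis (- (of_int m * \<theta> i)) * plane_wave \<theta> R n"
  \<comment> \<open>The coordinates \<open>n\<^sub>i\<close> at which exactly one of the box and its translate contains \<open>n\<close>.\<close>
  define X where "X = {min 0 m..<max 0 m} \<union> {int R + min 0 m..<int R + max 0 m}"
  define S where "S = (\<lambda>j. if j = i then X else {0..<int R})"
  let ?W = "{n :: int^'d. \<forall>j. n $ j \<in> S j}"
  have ax: "(n - axis i m) $ j = n $ j - (if j = i then m else 0)" for n :: "int^'d" and j
    by (auto simp: axis_def)
  have finS: "finite (S j)" for j by (auto simp: S_def X_def)
  have phase: "cis (\<Sum>j\<in>UNIV. of_int ((n - axis i m) $ j) * \<theta> j)
      = cis (- (of_int m * \<theta> i)) * cis (\<Sum>j\<in>UNIV. of_int (n $ j) * \<theta> j)" for n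
  proof -
    have "(\<Sum>j\<in>UNIV. of_int ((n - axis i m) $ j) * \<theta> j)
        = (\<Sum>j\<in>UNIV. of_int (n $ j) * \<theta> j - (if j = i then of_int m * \<theta> i else 0))"
      unfolding ax by (intro sum.cong) (auto simp: algebra_simps)
    also have "\<dots> = (\<Sum>j\<in>UNIV. of_int (n $ j) * \<theta> j) - of_int m * \<theta> i"
      by (simp add: sum_subtractf)
    finally show ?thesis by (simp only: cis_mult) (simp add: algebra_simps)
  qed
  have bound: "cmod (?v n) \<le> (if n \<in> ?W then 1 else 0)" for n
  proof (cases "(\<forall>j. n $ j \<in> {0..<int R}) \<longleftrightarrow> (\<forall>j. (n - axis i m) $ j \<in> {0..<int R})")
    case True
    then have "?v n = 0" using phase[of n] by (simp add: shift_def plane_wave_def)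
    then show ?thesis by simp
  next
    case False
    then have other: "n $ j \<in> {0..<int R}" if "j \<noteq> i" for j
      using that unfolding ax by (auto split: if_splits)
    have "(n $ i \<in> {0..<int R}) \<noteq> (n $ i - m \<in> {0..<int R})"
      using False other unfolding ax by (metis diff_0_right)
    then have "n $ i \<in> X" unfolding X_def by (cases "m \<ge> 0") auto
    then have "n \<in> ?W" using other by (auto simp: S_def)
    moreover have "cmod (?v n) \<le> 1"
      using False by (auto simp: shift_def plane_wave_def norm_mult)
    ultimately show ?thesis by simp
  qed
  have fin: "finite ?W" using card_vec_box(1)[of S] finS by blast
  have sup: "ell2_norm ?v ^ 2 \<le> real (card ?W)"
  proof -
    have "(\<Sum>\<^sub>\<infinity>n. (cmod (?v n))\<^sup>2) = (\<Sum>\<^sub>\<infinity>n\<in>?W. (cmod (?v n))\<^sup>2)"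
      by (rule infsum_cong_neutral) (use bound in \<open>force split: if_splits\<close>)+
    also have "\<dots> = (\<Sum>n\<in>?W. (cmod (?v n))\<^sup>2)" using fin by simp
    also have "\<dots> \<le> (\<Sum>n\<in>?W. 1)"
      using bound by (intro sum_mono power_le_one) (metis (full_types) norm_ge_zero, smt (verit))
    finally show ?thesis by (simp add: ell2_norm_power2)
  qed
  have "card X \<le> card {min 0 m..<max 0 m} + card {int R + min 0 m..<int R + max 0 m}"
    unfolding X_def by (rule card_Un_le)
  also have "\<dots> = 2 * nat \<bar>m\<bar>" by (simp add: min_def max_def)
  finally have "real (card X) \<le> 2 * \<bar>of_int m\<bar>" by linarith
  then have cX: "real (card X) * real R ^ (CARD('d) - 1) \<le> 2 * \<bar>of_int m\<bar> * real R ^ (CARD('d) - 1)"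
    by (intro mult_right_mono) auto
  have cW: "card ?W = card X * R ^ (CARD('d) - 1)"
  proof -
    have "card ?W = (\<Prod>j\<in>UNIV. card (S j))" using card_vec_box(2)[of S] finS by blast
    also have "\<dots> = card (S i) * (\<Prod>j\<in>UNIV - {i}. card (S j))" by (intro prod.remove) auto
    also have "(\<Prod>j\<in>UNIV - {i}. card (S j)) = (\<Prod>j\<in>UNIV - {i}. R)"
      by (intro prod.cong) (auto simp: S_def)
    finally show ?thesis by (simp add: S_def)
  qed
  have R: "real R ^ CARD('d) = real R * real R ^ (CARD('d) - 1)"
    by (metis Suc_pred' power_Suc zero_less_card_finite)
  have "(ell2_norm ?v)\<^sup>2 \<le> 2 * \<bar>of_int m\<bar> * real R ^ (CARD('d) - 1)"
    using sup cX unfolding cW by simp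
  also have "\<dots> = (2 * \<bar>of_int m\<bar> / real R) * real R ^ CARD('d)"
    using assms R by simp
  finally show ?thesis unfolding ell2_norm_plane_wave .
qed

text \<open>The statement about vectors, and not about forms, is the one that is stable under composition.\<close>

lemma laurent_plane_wave:
  assumes "laurent T \<tau>"
  shows "(\<lambda>R. ell2_norm (\<lambda>n. T (plane_wave \<theta> R) n - \<tau> \<theta> * plane_wave \<theta> R n) / ell2_norm (plane_wave \<theta> R)) \<longlonglongrightarrow> 0"
  using assms
proof (induction rule: laurent.induct)
  case (shift i m)
  let ?e = "\<lambda>R. ell2_norm (\<lambda>n. shift i m (plane_wave \<theta> R) n - cis (- (of_int m * \<theta> i)) * plane_wave \<theta> R n) / ell2_norm (plane_wave \<theta> R)"
  have ev: "eventually (\<lambda>R. norm (?e R) \<le> sqrt (2 * \<bar>of_int m\<bar> / real R)) sequentially"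
    using eventually_gt_at_top[of 0]
  proof eventually_elim
    case (elim R)
    have "ell2_norm (plane_wave \<theta> R) \<noteq> 0"
      using ell2_norm_plane_wave[of \<theta> R] elim by (metis power_zero_numeral power_not_zero of_nat_0_less_iff less_irrefl)
    then have "(?e R)\<^sup>2 \<le> 2 * \<bar>of_int m\<bar> / real R"
      using shift_plane_wave[OF elim, of i m \<theta>]
      by (simp add: power_divide divide_le_eq less_le)
    then show ?case by (simp add: real_le_rsqrt)
  qed
  have lim: "(\<lambda>R. sqrt (2 * \<bar>of_int m\<bar> / real R)) \<longlonglongrightarrow> 0"
    using tendsto_real_sqrt[OF lim_const_over_n[of "2 * \<bar>of_int m\<bar>"]] by simp
  show ?case by (rule Lim_null_comparison[OF ev lim])
next
  case (lincomb S \<sigma> T \<tau> a b)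
  let ?u = "plane_wave \<theta>" 
  let ?s = "\<lambda>R n. S (?u R) n - \<sigma> \<theta> * ?u R n" and ?t = "\<lambda>R n. T (?u R) n - \<tau> \<theta> * ?u R n"
  show ?case
  proof (rule null_sequence_if_norm_le)
    fix R
    have "ell2 (?s R)" "ell2 (?t R)"
      by (simp_all add: ell2_diff ell2_scale laurent_ell2[OF lincomb.hyps(1)] laurent_ell2[OF lincomb.hyps(2)])
    then have "ell2_norm (\<lambda>n. a * ?s R n + b * ?t R n) \<le> cmod a * ell2_norm (?s R) + cmod b * ell2_norm (?t R)"
      using ell2_norm_triangle[of "\<lambda>n. a * ?s R n" "\<lambda>n. b * ?t R n"] by (simp add: ell2_scale ell2_norm_scale)
    then have "ell2_norm (\<lambda>n. a * ?s R n + b * ?t R n) / ell2_norm (?u R)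
       \<le> cmod a * (ell2_norm (?s R) / ell2_norm (?u R)) + cmod b * (ell2_norm (?t R) / ell2_norm (?u R))"
      by (simp add: divide_right_mono flip: add_divide_distrib)
    then show "norm (ell2_norm (\<lambda>n. (a * S (?u R) n + b * T (?u R) n) - (a * \<sigma> \<theta> + b * \<tau> \<theta>) * ?u R n) / ell2_norm (?u R))
       \<le> cmod a * (ell2_norm (?s R) / ell2_norm (?u R)) + cmod b * (ell2_norm (?t R) / ell2_norm (?u R))"
      by (simp add: algebra_simps)
  next
    show "(\<lambda>R. cmod a * (ell2_norm (?s R) / ell2_norm (?u R)) + cmod b * (ell2_norm (?t R) / ell2_norm (?u R))) \<longlonglongrightarrow> 0"
      using lincomb.IH by (intro tendsto_add_zero tendsto_mult_right_zero)
  qed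
next
  case (comp S \<sigma> T \<tau>)
  let ?u = "plane_wave \<theta>" 
  let ?s = "\<lambda>R n. S (?u R) n - \<sigma> \<theta> * ?u R n" and ?t = "\<lambda>R n. T (?u R) n - \<tau> \<theta> * ?u R n"
  obtain K where K: "\<And>u. ell2 u \<Longrightarrow> ell2_norm (S u) \<le> K * ell2_norm u"
    using bounded_oper_bound[OF laurent_bounded[OF comp.hyps(1)]] by blast
  show ?case
  proof (rule null_sequence_if_norm_le)
    fix R
    have t: "ell2 (?t R)" and s: "ell2 (?s R)"
      by (simp_all add: ell2_diff ell2_scale laurent_ell2[OF comp.hyps(1)] laurent_ell2[OF comp.hyps(2)])
    have "S (?t R) = (\<lambda>n. S (T (?u R)) n - \<tau> \<theta> * S (?u R) n)"
      using laurent_linear[OF comp.hyps(1), of 1 "T (?u R)" "- \<tau> \<theta>" "?u R"] by simp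
    then have "(\<lambda>n. S (T (?u R)) n - \<sigma> \<theta> * \<tau> \<theta> * ?u R n) = (\<lambda>n. S (?t R) n + \<tau> \<theta> * ?s R n)"
      by (simp add: algebra_simps)
    moreover have "ell2_norm (\<lambda>n. S (?t R) n + \<tau> \<theta> * ?s R n) \<le> K * ell2_norm (?t R) + cmod (\<tau> \<theta>) * ell2_norm (?s R)"
      using ell2_norm_triangle[of "S (?t R)" "\<lambda>n. \<tau> \<theta> * ?s R n"] K[OF t] s
        laurent_ell2[OF comp.hyps(1) t] by (simp add: ell2_scale ell2_norm_scale)
    ultimately have "ell2_norm (\<lambda>n. S (T (?u R)) n - \<sigma> \<theta> * \<tau> \<theta> * ?u R n) / ell2_norm (?u R)
       \<le> K * (ell2_norm (?t R) / ell2_norm (?u R)) + cmod (\<tau> \<theta>) * (ell2_norm (?s R) / ell2_norm (?u R))"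
      by (simp add: divide_right_mono flip: add_divide_distrib)
    then show "norm (ell2_norm (\<lambda>n. S (T (?u R)) n - \<sigma> \<theta> * \<tau> \<theta> * ?u R n) / ell2_norm (?u R))
       \<le> K * (ell2_norm (?t R) / ell2_norm (?u R)) + cmod (\<tau> \<theta>) * (ell2_norm (?s R) / ell2_norm (?u R))"
      by simp
  next
    show "(\<lambda>R. K * (ell2_norm (?t R) / ell2_norm (?u R)) + cmod (\<tau> \<theta>) * (ell2_norm (?s R) / ell2_norm (?u R))) \<longlonglongrightarrow> 0"
      using comp.IH by (intro tendsto_add_zero tendsto_mult_right_zero)
  qed
qed

lemma plane_wave_nonzero: "0 < R \<Longrightarrow> 0 < ell2_norm (plane_wave \<theta> R)"
  using ell2_norm_plane_wave[of \<theta> R] by (metis ell2_norm_nonneg less_le of_nat_0_less_iff power_zero_numeral zero_less_power)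

lemma laurent_form_plane_wave:
  assumes "laurent T \<tau>"
  shows "(\<lambda>R. ip (plane_wave \<theta> R) (T (plane_wave \<theta> R)) / complex_of_real ((ell2_norm (plane_wave \<theta> R))\<^sup>2)) \<longlonglongrightarrow> \<tau> \<theta>"
proof -
  let ?u = "plane_wave \<theta>"
  let ?e = "\<lambda>R. ell2_norm (\<lambda>n. T (?u R) n - \<tau> \<theta> * ?u R n) / ell2_norm (?u R)"
  have "eventually (\<lambda>R. norm (ip (?u R) (T (?u R)) / complex_of_real ((ell2_norm (?u R))\<^sup>2) - \<tau> \<theta>) \<le> ?e R) sequentially"
    using eventually_gt_at_top[of 0]
  proof eventually_elim
    case (elim R)
    let ?N = "ell2_norm (?u R)"
    have N: "0 < ?N" using plane_wave_nonzero elim .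
    have T: "ell2 (T (?u R))" using laurent_ell2[OF assms] by simp
    have "ip (?u R) (\<lambda>n. T (?u R) n - \<tau> \<theta> * ?u R n) = ip (?u R) (T (?u R)) - \<tau> \<theta> * complex_of_real (?N\<^sup>2)"
      using T by (simp add: ip_diff_right ell2_scale ip_scale_right ip_self)
    then have "ip (?u R) (T (?u R)) / complex_of_real (?N\<^sup>2) - \<tau> \<theta>
        = ip (?u R) (\<lambda>n. T (?u R) n - \<tau> \<theta> * ?u R n) / complex_of_real (?N\<^sup>2)"
      using N by (simp add: diff_divide_distrib)
    moreover have "cmod (ip (?u R) (\<lambda>n. T (?u R) n - \<tau> \<theta> * ?u R n)) \<le> ?N * ell2_norm (\<lambda>n. T (?u R) n - \<tau> \<theta> * ?u R n)"
      using T by (intro ip_Cauchy_Schwarz ell2_diff ell2_scale) simp_all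
    ultimately have "cmod (ip (?u R) (T (?u R)) / complex_of_real (?N\<^sup>2) - \<tau> \<theta>)
        \<le> ?N * ell2_norm (\<lambda>n. T (?u R) n - \<tau> \<theta> * ?u R n) / ?N\<^sup>2"
      using N by (simp add: norm_divide norm_power divide_right_mono)
    then show ?case using N by (simp add: power2_eq_square)
  qed
  then have "(\<lambda>R. ip (?u R) (T (?u R)) / complex_of_real ((ell2_norm (?u R))\<^sup>2) - \<tau> \<theta>) \<longlonglongrightarrow> 0"
    by (rule Lim_null_comparison[OF _ laurent_plane_wave[OF assms]])
  then show ?thesis by (simp only: LIM_zero_iff)
qed

text \<open>A bounded inverse is incompatible with approximate eigenvectors.\<close>

lemma laurent_symbol_in_spectrum:
  assumes "laurent T \<tau>"
  shows "\<tau> \<theta> \<in> oper_spectrum T"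
proof (rule ccontr)
  let ?u = "plane_wave \<theta>"
  assume "\<tau> \<theta> \<notin> oper_spectrum T"
  then obtain R where R: "bounded_oper R" "\<And>u. ell2 u \<Longrightarrow> R (\<lambda>x. T u x - \<tau> \<theta> * u x) = u"
    by (auto simp: oper_spectrum_def)
  obtain K where K: "\<And>u. ell2 u \<Longrightarrow> ell2_norm (R u) \<le> K * ell2_norm u"
    using bounded_oper_bound[OF R(1)] by blast
  have "eventually (\<lambda>k. 1 \<le> K * (ell2_norm (\<lambda>n. T (?u k) n - \<tau> \<theta> * ?u k n) / ell2_norm (?u k))) sequentially"
    using eventually_gt_at_top[of 0]
  proof eventually_elim
    case (elim k)
    have "ell2 (\<lambda>n. T (?u k) n - \<tau> \<theta> * ?u k n)"
      using laurent_ell2[OF assms] by (intro ell2_diff ell2_scale) simp_all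
    then have "ell2_norm (?u k) \<le> K * ell2_norm (\<lambda>n. T (?u k) n - \<tau> \<theta> * ?u k n)"
      using K R(2)[of "?u k"] by fastforce
    then show ?case using plane_wave_nonzero[OF elim, of \<theta>] by (simp add: field_simps)
  qed
  then have "1 \<le> K * 0"
    by (intro tendsto_lowerbound[OF tendsto_mult_left[OF laurent_plane_wave[OF assms, of \<theta>]]]) simp_all
  then show False by simp
qed

subsection \<open>The Molchanov--Vainberg Laplacian\<close>

text \<open>Partial products are needed to split off the factor \<open>Delta i\<close>, the only one that does not commute
  with \<open>A_coord i m\<close>.\<close>

definition MV_on :: "'d::finite set \<Rightarrow> (int^'d) oper" where
  "MV_on A = Finite_Set.fold (\<lambda>i T. Delta i \<circ> T) id A"

lemma MV_on_empty [simp]: "MV_on {} u = u"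
  by (simp add: MV_on_def)

lemma MV_on_insert: "i \<notin> A \<Longrightarrow> MV_on (insert i A) u = Delta i (MV_on A u)"
proof -
  interpret comp_fun_commute "\<lambda>(i :: 'a) T. Delta i \<circ> T"
    by unfold_locales (metis (no_types, opaque_lifting) Delta_commute comp_apply fun.map_comp ext)
  assume "i \<notin> A"
  then show ?thesis unfolding MV_on_def by (subst fold_insert) simp_all
qed

lemma MV_eq_MV_on: "MV = MV_on UNIV"
  by (simp add: MV_def MV_on_def)

lemma MV_split: "MV u = Delta i (MV_on (- {i}) u)"
  using MV_on_insert[of i "- {i}" u] by (simp add: MV_eq_MV_on insert_absorb Compl_insert)

lemma MV_on_commute:
  assumes "\<And>l u. l \<in> A \<Longrightarrow> F (Delta l u) = Delta l (F u)"
  shows "F (MV_on A u) = MV_on A (F u)"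
proof -
  have "finite A" by simp
  then show ?thesis using assms by (induction A rule: finite_induct) (simp_all add: MV_on_insert)
qed

lemma laurent_Delta: "laurent (Delta i) (\<lambda>\<theta>. complex_of_real (cos (\<theta> i)))"
proof -
  have "laurent (\<lambda>u n. 1/2 * shift i 1 u n + 1/2 * shift i (- 1) u n)
      (\<lambda>\<theta>. 1/2 * cis (- (of_int 1 * \<theta> i)) + 1/2 * cis (- (of_int (- 1) * \<theta> i)))"
    by (intro laurent.intros)
  moreover have "1/2 * cis (- (of_int 1 * \<theta> i)) + 1/2 * cis (- (of_int (- 1) * \<theta> i)) = complex_of_real (cos (\<theta> i))" for \<theta>
    by (simp add: complex_eq_iff)
  ultimately show ?thesis by (simp add: Delta_def[abs_def] add_divide_distrib)
qed

lemma laurent_MV_on: "laurent (MV_on A) (\<lambda>\<theta>. complex_of_real (\<Prod>i\<in>A. cos (\<theta> i)))"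
proof -
  have "finite A" by simp
  then show ?thesis
  proof (induction A rule: finite_induct)
    case empty
    then show ?case using laurent_const[of 1] by (simp add: MV_on_def id_def)
  next
    case (insert i A)
    then show ?case using laurent.comp[OF laurent_Delta[of i] insert.IH]
      by (simp add: MV_on_insert[OF insert.hyps(2), abs_def])
  qed
qed

lemma laurent_MV: "laurent MV (\<lambda>\<theta>. complex_of_real (\<Prod>i\<in>UNIV. cos (\<theta> i)))"
  using laurent_MV_on[of UNIV] by (simp add: MV_eq_MV_on)

section \<open>The torus and multiplication operators\<close>

text \<open>Normalised arc length, in the angle.\<close>

definition circle :: "real measure" where
  "circle = distr (restrict_space lborel {0..1}) borel (\<lambda>t. 2 * pi * t)"

definition torus :: "('d::finite \<Rightarrow> real) measure" where
  "torus = PiM UNIV (\<lambda>_. circle)"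

lemma sets_circle [simp, measurable_cong]: "sets circle = sets borel"
  by (simp add: circle_def)

lemma space_circle [simp]: "space circle = UNIV"
  by (simp add: circle_def)

lemma emeasure_circle_UNIV: "emeasure circle UNIV = 1"
proof -
  have "emeasure circle UNIV = emeasure (restrict_space lborel {0..1 :: real}) {0..1}"
    unfolding circle_def by (subst emeasure_distr) (auto simp: space_restrict_space intro!: measurable_restrict_space1)
  then show ?thesis by (simp add: emeasure_restrict_space)
qed

lemma finite_measure_circle: "finite_measure circle"
  by (rule finite_measureI) (simp add: emeasure_circle_UNIV)

lemma product_sigma_finite_circle: "product_sigma_finite (\<lambda>_ :: 'd. circle)"
  unfolding product_sigma_finite_def
  using finite_measure.axioms(1)[OF finite_measure_circle] by blast

lemma space_torus [simp]: "space torus = UNIV"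
  by (simp add: torus_def space_PiM)

lemma emeasure_torus_UNIV: "emeasure (torus :: ('d::finite \<Rightarrow> real) measure) UNIV = 1"
proof -
  interpret product_sigma_finite "\<lambda>_ :: 'd. circle" by (rule product_sigma_finite_circle)
  show ?thesis
    using emeasure_PiM[of UNIV "\<lambda>_. UNIV"] by (simp add: torus_def emeasure_circle_UNIV)
qed

lemma finite_measure_torus: "finite_measure torus"
  by (rule finite_measureI) (simp add: emeasure_torus_UNIV)

interpretation torus: finite_measure torus
  by (rule finite_measure_torus)

lemma measure_torus_UNIV [simp]: "measure torus UNIV = 1"
  by (simp add: measure_def emeasure_torus_UNIV)

lemma measurable_torus_component: "(\<lambda>\<theta>. \<theta> i) \<in> borel_measurable torus"
proof -
  have "(\<lambda>\<theta>. \<theta> i) \<in> measurable torus circle"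
    unfolding torus_def by (rule measurable_component_singleton) simp
  then show ?thesis by (simp add: measurable_def)
qed

lemma integral_cis_circle: "(\<integral>s. cis (of_int k * s) \<partial>circle) = (if k = 0 then 1 else 0)"
proof -
  have "(\<integral>s. cis (of_int k * s) \<partial>circle) = (\<integral>t. cis (of_int k * (2 * pi * t)) \<partial>restrict_space lborel {0..1})"
  proof -
    have "(\<lambda>t. 2 * pi * t) \<in> measurable (restrict_space lborel {0..1}) borel"
      by (intro measurable_restrict_space1) simp
    moreover have "(\<lambda>s. cis (of_int k * s)) \<in> borel_measurable borel"
      by (intro borel_measurable_continuous_onI continuous_intros)
    ultimately show ?thesis unfolding circle_def by (rule integral_distr)
  qed
  also have "\<dots> = (\<integral>t. indicator {0..1} t *\<^sub>R cis (of_int k * (2 * pi * t)) \<partial>lborel)"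
    by (intro integral_restrict_space) simp
  also have "\<dots> = (if k = 0 then 1 else 0)"
  proof (cases "k = 0")
    case True
    have "(\<integral>t. indicator {0..1 :: real} t *\<^sub>R (1 :: complex) \<partial>lborel) = 1"
      by (subst integral_scaleR_left) simp_all
    then show ?thesis using True by simp
  next
    case False
    let ?c = "2 * pi * of_int k"
    let ?F = "\<lambda>t. cis (?c * t) / (\<i> * complex_of_real ?c)"
    have c: "?c \<noteq> 0" using False by simp
    have "(?F has_vector_derivative cis (?c * t)) (at t within {0..1})" for t
    proof -
      let ?e = "\<lambda>z. exp (\<i> * (complex_of_real ?c * z))"
      have "(?e has_field_derivative \<i> * complex_of_real ?c * ?e (complex_of_real t)) (at (complex_of_real t))"
        by (auto intro!: derivative_eq_intros)
      from has_vector_derivative_divide[OF has_vector_derivative_real_field[OF this], of "\<i> * complex_of_real ?c"] c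
      show ?thesis by (simp add: cis_conv_exp mult_ac)
    qed
    then have "(\<integral>t. indicator {0..1} t *\<^sub>R cis (?c * t) \<partial>lborel) = ?F 1 - ?F 0"
      by (intro integral_FTC_atLeastAtMost) (auto intro!: continuous_intros)
    also have "\<dots> = 0"
      using cis_multiple_2pi[of "of_int k"] by (simp add: mult.commute)
    finally show ?thesis using False by (simp add: mult_ac)
  qed
  finally show ?thesis .
qed

definition character :: "int^'d::finite \<Rightarrow> ('d \<Rightarrow> real) \<Rightarrow> complex" where
  "character n \<theta> = cis (\<Sum>i\<in>UNIV. of_int (n $ i) * \<theta> i)"

lemma measurable_character [measurable]: "character n \<in> borel_measurable torus"
proof -
  have cis: "cis \<in> borel_measurable borel"
    by (intro borel_measurable_continuous_onI continuous_intros)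
  show ?thesis unfolding character_def[abs_def]
    by (intro measurable_compose[OF _ cis] borel_measurable_sum borel_measurable_times
        borel_measurable_const measurable_torus_component)
qed

lemma norm_character [simp]: "cmod (character n \<theta>) = 1"
  by (simp add: character_def)

lemma character_0 [simp]: "character 0 \<theta> = 1"
  by (simp add: character_def)

lemma character_diff: "character (n - m) \<theta> = character n \<theta> * cnj (character m \<theta>)"
  by (simp add: character_def cis_cnj cis_mult sum_subtractf algebra_simps)

lemma character_axis: "character (axis i m) \<theta> = cis (of_int m * \<theta> i)"
proof -
  have "(\<Sum>j\<in>UNIV. of_int (axis i m $ j) * \<theta> j) = (\<Sum>j\<in>UNIV. if j = i then of_int m * \<theta> i else 0)"
    by (intro sum.cong) (auto simp: axis_def)
  then show ?thesis by (simp add: character_def)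
qed

lemma integral_character: "(\<integral>\<theta>. character n \<theta> \<partial>torus) = (if n = 0 then 1 else 0)"
proof -
  interpret product_sigma_finite "\<lambda>_ :: 'a. circle" by (rule product_sigma_finite_circle)
  have cis: "(\<lambda>s. cis (of_int k * s)) \<in> borel_measurable circle" for k
    by (subst measurable_cong_sets[OF sets_circle refl]) (intro borel_measurable_continuous_onI continuous_intros)
  have "(\<integral>\<theta>. character n \<theta> \<partial>torus) = (\<integral>\<theta>. (\<Prod>i\<in>UNIV. cis (of_int (n $ i) * \<theta> i)) \<partial>torus)"
  proof (intro Bochner_Integration.integral_cong refl)
    fix \<theta> :: "'a \<Rightarrow> real"
    show "character n \<theta> = (\<Prod>i\<in>UNIV. cis (of_int (n $ i) * \<theta> i))"
      unfolding character_def by (simp add: cis_conv_exp exp_sum sum_distrib_left)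
  qed
  also have "\<dots> = (\<Prod>i\<in>UNIV. \<integral>s. cis (of_int (n $ i) * s) \<partial>circle)"
    unfolding torus_def
    by (rule product_integral_prod)
      (auto intro!: finite_measure.integrable_const_bound[OF finite_measure_circle, of _ 1] cis)
  also have "\<dots> = (if n = 0 then 1 else 0)"
    by (auto simp: integral_cis_circle vec_eq_iff)
  finally show ?thesis .
qed

definition bounded_symbol :: "real \<Rightarrow> (('d::finite \<Rightarrow> real) \<Rightarrow> complex) \<Rightarrow> bool" where
  "bounded_symbol B \<phi> \<longleftrightarrow> \<phi> \<in> borel_measurable torus \<and> (\<forall>\<theta>. cmod (\<phi> \<theta>) \<le> B)"

lemma bounded_symbol_nonneg: "bounded_symbol B \<phi> \<Longrightarrow> 0 \<le> B"
  using norm_ge_zero order_trans unfolding bounded_symbol_def by blast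

lemma bounded_symbol_measurable: "bounded_symbol B \<phi> \<Longrightarrow> \<phi> \<in> borel_measurable torus"
  by (simp add: bounded_symbol_def)

lemma bounded_symbol_integrable: "bounded_symbol B \<phi> \<Longrightarrow> integrable torus \<phi>"
  unfolding bounded_symbol_def by (intro torus.integrable_const_bound[of _ B]) auto

lemma bounded_symbol_mono: "bounded_symbol A \<phi> \<Longrightarrow> A \<le> B \<Longrightarrow> bounded_symbol B \<phi>"
  unfolding bounded_symbol_def using order_trans by blast

lemma bounded_symbol_mult:
  assumes "bounded_symbol A \<phi>" "bounded_symbol B \<psi>"
  shows "bounded_symbol (A * B) (\<lambda>\<theta>. \<phi> \<theta> * \<psi> \<theta>)"
  using assms bounded_symbol_nonneg[OF assms(1)] unfolding bounded_symbol_def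
  by (auto simp: norm_mult intro!: mult_mono)

lemma bounded_symbol_add:
  assumes "bounded_symbol A \<phi>" "bounded_symbol B \<psi>"
  shows "bounded_symbol (A + B) (\<lambda>\<theta>. \<phi> \<theta> + \<psi> \<theta>)"
  using assms unfolding bounded_symbol_def
  by (auto intro!: order_trans[OF norm_triangle_ineq] add_mono)

lemma bounded_symbol_const: "bounded_symbol (cmod c) (\<lambda>\<theta>. c)"
  by (simp add: bounded_symbol_def)

lemma bounded_symbol_character: "bounded_symbol 1 (character n)"
  by (simp add: bounded_symbol_def)

lemma bounded_symbol_cnj: "bounded_symbol B \<phi> \<Longrightarrow> bounded_symbol B (\<lambda>\<theta>. cnj (\<phi> \<theta>))"
  unfolding bounded_symbol_def
  by (auto intro: measurable_compose[OF _ borel_measurable_continuous_onI[of cnj]] continuous_on_cnj continuous_on_id)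

definition conv_kernel :: "(('d::finite \<Rightarrow> real) \<Rightarrow> complex) \<Rightarrow> int^'d \<Rightarrow> int^'d \<Rightarrow> complex" where
  "conv_kernel \<phi> n m = cnj (\<integral>\<theta>. \<phi> \<theta> * character (n - m) \<theta> \<partial>torus)"

text \<open>Multiplication by \<open>\<phi>\<close> after the Fourier transform, written as a convolution so that only transforms
  of finitely supported sequences occur.\<close>

definition mult_op :: "(('d::finite \<Rightarrow> real) \<Rightarrow> complex) \<Rightarrow> (int^'d) oper" where
  "mult_op \<phi> u n = ip (conv_kernel \<phi> n) u"

definition fourier :: "(int^'d::finite \<Rightarrow> complex) \<Rightarrow> ('d \<Rightarrow> real) \<Rightarrow> complex" where
  "fourier u \<theta> = (\<Sum>m | u m \<noteq> 0. u m * cnj (character m \<theta>))"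

lemma bounded_symbol_fourier: "bounded_symbol (\<Sum>m | u m \<noteq> 0. cmod (u m)) (fourier u)"
proof -
  have "fourier u \<in> borel_measurable torus"
    unfolding fourier_def[abs_def]
    using bounded_symbol_measurable[OF bounded_symbol_cnj[OF bounded_symbol_character]] by measurable
  moreover have "cmod (fourier u \<theta>) \<le> (\<Sum>m | u m \<noteq> 0. cmod (u m))" for \<theta>
    unfolding fourier_def by (rule order_trans[OF norm_sum]) (simp add: norm_mult)
  ultimately show ?thesis by (simp add: bounded_symbol_def)
qed

lemma mult_form_finsupp:
  assumes v: "finsupp v" and u: "finsupp u" and \<phi>: "bounded_symbol B \<phi>"
  shows "ip v (mult_op \<phi> u) = (\<integral>\<theta>. \<phi> \<theta> * (cnj (fourier v \<theta>) * fourier u \<theta>) \<partial>torus)"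
proof -
  let ?V = "{n. v n \<noteq> 0}" and ?U = "{m. u m \<noteq> 0}"
  have fin: "finite ?V" "finite ?U" using u v by (auto simp: finsupp_def)
  have int: "integrable torus (\<lambda>\<theta>. \<phi> \<theta> * character (n - m) \<theta>)" for n m
    using bounded_symbol_integrable[OF bounded_symbol_mult[OF \<phi> bounded_symbol_character]] .
  have row: "mult_op \<phi> u n = (\<Sum>m\<in>?U. (\<integral>\<theta>. \<phi> \<theta> * character (n - m) \<theta> \<partial>torus) * u m)" for n
  proof -
    have "mult_op \<phi> u n = cnj (ip u (conv_kernel \<phi> n))" by (simp add: mult_op_def ip_cnj)
    also have "ip u (conv_kernel \<phi> n) = (\<Sum>m\<in>?U. cnj (u m) * conv_kernel \<phi> n m)"
      using fin by (intro ip_finsupp_left) auto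
    finally show ?thesis by (simp add: conv_kernel_def mult.commute)
  qed
  have "ip v (mult_op \<phi> u) = (\<Sum>n\<in>?V. \<Sum>m\<in>?U. cnj (v n) * u m * (\<integral>\<theta>. \<phi> \<theta> * character (n - m) \<theta> \<partial>torus))"
    using fin by (subst ip_finsupp_left[OF fin(1)]) (auto simp: row sum_distrib_left mult_ac)
  also have "\<dots> = (\<integral>\<theta>. (\<Sum>n\<in>?V. \<Sum>m\<in>?U. cnj (v n) * u m * (\<phi> \<theta> * character (n - m) \<theta>)) \<partial>torus)"
    using int by (subst Bochner_Integration.integral_sum; simp)+
  also have "\<dots> = (\<integral>\<theta>. \<phi> \<theta> * (cnj (fourier v \<theta>) * fourier u \<theta>) \<partial>torus)"
    by (intro Bochner_Integration.integral_cong refl)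
      (simp add: fourier_def character_diff sum_product sum_distrib_left mult_ac)
  finally show ?thesis .
qed

lemma mult_1_finsupp:
  assumes "finsupp u"
  shows "mult_op (\<lambda>\<theta>. 1) u = u"
proof
  fix n :: "int^'a"
  have "conv_kernel (\<lambda>\<theta>. 1) n = delta n"
    by (auto simp: conv_kernel_def integral_character delta_def fun_eq_iff)
  then show "mult_op (\<lambda>\<theta>. 1) u n = u n" by (simp add: mult_op_def)
qed

text \<open>The multiplication by \<open>1\<close> is the identity, whose form is the integral of \<open>|fourier u|\<^sup>2\<close>.\<close>

lemma Parseval_finsupp:
  assumes "finsupp u"
  shows "(\<integral>\<theta>. (cmod (fourier u \<theta>))\<^sup>2 \<partial>torus) = (ell2_norm u)\<^sup>2"
proof -
  have "complex_of_real ((ell2_norm u)\<^sup>2) = ip u (mult_op (\<lambda>\<theta>. 1) u)"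
    using assms by (simp add: mult_1_finsupp ip_self finsupp_ell2)
  also have "\<dots> = (\<integral>\<theta>. complex_of_real ((cmod (fourier u \<theta>))\<^sup>2) \<partial>torus)"
    unfolding mult_form_finsupp[OF assms assms bounded_symbol_const]
    by (intro Bochner_Integration.integral_cong refl) (metis complex_norm_square mult.commute mult_1)
  also have "\<dots> = complex_of_real (\<integral>\<theta>. (cmod (fourier u \<theta>))\<^sup>2 \<partial>torus)" by (rule integral_complex_of_real)
  finally show ?thesis unfolding of_real_eq_iff by (rule sym)
qed

lemma integrable_fourier_square: "integrable torus (\<lambda>\<theta>. (cmod (fourier u \<theta>))\<^sup>2)"
proof (rule torus.integrable_const_bound[of _ "(\<Sum>m | u m \<noteq> 0. cmod (u m))\<^sup>2"])
  show "AE \<theta> in torus. norm ((cmod (fourier u \<theta>))\<^sup>2) \<le> (\<Sum>m | u m \<noteq> 0. cmod (u m))\<^sup>2"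
    using bounded_symbol_fourier[of u] by (auto simp: bounded_symbol_def intro!: power_mono)
  show "(\<lambda>\<theta>. (cmod (fourier u \<theta>))\<^sup>2) \<in> borel_measurable torus"
    using bounded_symbol_measurable[OF bounded_symbol_fourier[of u]] by measurable
qed

text \<open>The image of \<open>u\<close> is tested against its own restriction \<open>w\<close> to a finite set. Under the integral,
  \<open>2 B |fourier u| |fourier w| \<le> B\<^sup>2 |fourier u|\<^sup>2 + |fourier w|\<^sup>2\<close>, and the norm of \<open>w\<close> can be absorbed.\<close>

lemma mult_finsupp_bound:
  assumes u: "finsupp u" and \<phi>: "bounded_symbol B \<phi>" and F: "finite F"
  shows "(\<Sum>n\<in>F. (cmod (mult_op \<phi> u n))\<^sup>2) \<le> (B * ell2_norm u)\<^sup>2"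
proof -
  define w where "w = (\<lambda>n. if n \<in> F then mult_op \<phi> u n else 0)"
  have w: "finsupp w" unfolding finsupp_def by (rule finite_subset[OF _ F]) (auto simp: w_def)
  let ?s = "\<Sum>n\<in>F. (cmod (mult_op \<phi> u n))\<^sup>2"
  have sq: "cnj z * z = complex_of_real ((cmod z)\<^sup>2)" for z by (metis complex_norm_square mult.commute)
  have "ip w (mult_op \<phi> u) = complex_of_real ?s"
    by (subst ip_finsupp_left[OF F]) (auto simp: w_def sq)
  moreover have "(ell2_norm w)\<^sup>2 = ?s"
  proof -
    have "(ell2_norm w)\<^sup>2 = (\<Sum>\<^sub>\<infinity>n\<in>F. (cmod (mult_op \<phi> u n))\<^sup>2)"
      unfolding ell2_norm_power2 by (rule infsum_cong_neutral) (auto simp: w_def)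
    then show ?thesis using F by simp
  qed
  ultimately have "?s = cmod (\<integral>\<theta>. \<phi> \<theta> * (cnj (fourier w \<theta>) * fourier u \<theta>) \<partial>torus)"
    using mult_form_finsupp[OF w u \<phi>] by (metis norm_of_real abs_of_nonneg sum_nonneg zero_le_power2)
  also have "\<dots> \<le> (\<integral>\<theta>. (B\<^sup>2 * (cmod (fourier u \<theta>))\<^sup>2 + (cmod (fourier w \<theta>))\<^sup>2) / 2 \<partial>torus)"
  proof (rule order_trans[OF integral_norm_bound integral_mono])
    show "integrable torus (\<lambda>\<theta>. norm (\<phi> \<theta> * (cnj (fourier w \<theta>) * fourier u \<theta>)))"
      by (rule integrable_norm[OF bounded_symbol_integrable[OF bounded_symbol_mult[OF \<phi>
            bounded_symbol_mult[OF bounded_symbol_cnj[OF bounded_symbol_fourier] bounded_symbol_fourier]]]])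
    show "integrable torus (\<lambda>\<theta>. (B\<^sup>2 * (cmod (fourier u \<theta>))\<^sup>2 + (cmod (fourier w \<theta>))\<^sup>2) / 2)"
      by (intro Bochner_Integration.integrable_divide Bochner_Integration.integrable_add
          integrable_mult_right integrable_fourier_square)
    fix \<theta> :: "'a \<Rightarrow> real"
    have "cmod (\<phi> \<theta> * (cnj (fourier w \<theta>) * fourier u \<theta>)) = cmod (\<phi> \<theta>) * (cmod (fourier w \<theta>) * cmod (fourier u \<theta>))"
      by (simp add: norm_mult)
    also have "\<dots> \<le> B * (cmod (fourier w \<theta>) * cmod (fourier u \<theta>))"
      using \<phi> by (intro mult_right_mono) (auto simp: bounded_symbol_def)
    also have "\<dots> \<le> (B\<^sup>2 * (cmod (fourier u \<theta>))\<^sup>2 + (cmod (fourier w \<theta>))\<^sup>2) / 2"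
      using sum_squares_bound[of "B * cmod (fourier u \<theta>)" "cmod (fourier w \<theta>)"]
      by (simp add: power_mult_distrib mult_ac)
    finally show "norm (\<phi> \<theta> * (cnj (fourier w \<theta>) * fourier u \<theta>))
        \<le> (B\<^sup>2 * (cmod (fourier u \<theta>))\<^sup>2 + (cmod (fourier w \<theta>))\<^sup>2) / 2" .
  qed
  also have "\<dots> = (B\<^sup>2 * (ell2_norm u)\<^sup>2 + (ell2_norm w)\<^sup>2) / 2"
    using integrable_fourier_square[of u] integrable_fourier_square[of w]
    by (simp add: Parseval_finsupp u w)
  finally show ?thesis using \<open>(ell2_norm w)\<^sup>2 = ?s\<close> by (simp add: power_mult_distrib)
qed

lemma ell2_conv_kernel:
  assumes "bounded_symbol B \<phi>"
  shows "ell2 (conv_kernel \<phi> n)"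
proof -
  have "ell2 (mult_op \<phi> (delta 0))"
    using mult_finsupp_bound[OF finsupp_delta assms] ell2_iff_bounded_sums by blast
  moreover have "bij (\<lambda>m :: int^'a. n - m)"
    by (rule bij_betw_byWitness[where f' = "\<lambda>m. n - m"]) auto
  ultimately have "ell2 (\<lambda>m. mult_op \<phi> (delta 0) (n - m))" using ell2_reindex(1) by blast
  moreover have "cmod (mult_op \<phi> (delta 0) (n - m)) = cmod (conv_kernel \<phi> n m)" for m
  proof -
    have "mult_op \<phi> (delta 0) (n - m) = cnj (ip (delta 0) (conv_kernel \<phi> (n - m)))" by (simp only: mult_op_def ip_cnj)
    then show ?thesis by (simp add: conv_kernel_def)
  qed
  ultimately show ?thesis by (simp add: ell2_def)
qed

lemma mult_pointwise_lim:
  "bounded_symbol B \<phi> \<Longrightarrow> ell2_lim U u \<Longrightarrow> (\<lambda>k. mult_op \<phi> (U k) n) \<longlonglongrightarrow> mult_op \<phi> u n"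
  unfolding mult_op_def by (intro ell2_lim_ip ell2_lim_const ell2_conv_kernel)

text \<open>Truncations of \<open>u\<close> converge in each entry of the image, because the rows of the kernel are
  square-summable.\<close>

lemma mult_bound:
  assumes \<phi>: "bounded_symbol B \<phi>" and u: "ell2 u"
  shows "ell2 (mult_op \<phi> u)" "ell2_norm (mult_op \<phi> u) \<le> B * ell2_norm u"
proof -
  obtain U where U: "\<And>k. finsupp (U k)" "ell2_lim U u" using ell2_finsupp_approx[OF u] by blast
  have "(\<Sum>n\<in>F. (cmod (mult_op \<phi> u n))\<^sup>2) \<le> (B * ell2_norm u)\<^sup>2" if "finite F" for F
  proof (rule LIMSEQ_le)
    show "(\<lambda>k. \<Sum>n\<in>F. (cmod (mult_op \<phi> (U k) n))\<^sup>2) \<longlonglongrightarrow> (\<Sum>n\<in>F. (cmod (mult_op \<phi> u n))\<^sup>2)"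
      by (intro tendsto_intros mult_pointwise_lim[OF \<phi> U(2)])
    show "(\<lambda>k. B\<^sup>2 * (ell2_norm (U k))\<^sup>2) \<longlonglongrightarrow> (B * ell2_norm u)\<^sup>2"
      unfolding power_mult_distrib by (intro tendsto_mult tendsto_const ell2_lim_norm U)
    show "\<exists>N. \<forall>k\<ge>N. (\<Sum>n\<in>F. (cmod (mult_op \<phi> (U k) n))\<^sup>2) \<le> B\<^sup>2 * (ell2_norm (U k))\<^sup>2"
      using mult_finsupp_bound[OF U(1) \<phi> that] by (simp add: power_mult_distrib)
  qed
  then show "ell2 (mult_op \<phi> u)" "ell2_norm (mult_op \<phi> u) \<le> B * ell2_norm u"
    using bounded_symbol_nonneg[OF \<phi>] by (auto intro!: ell2_normI)
qed

lemma mult_bounded: "bounded_symbol B \<phi> \<Longrightarrow> bounded_oper (mult_op \<phi>)"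
proof (rule bounded_operI[where K = B])
  fix u v :: "int^'a \<Rightarrow> complex" and a b
  assume \<phi>: "bounded_symbol B \<phi>" and "ell2 u" "ell2 v"
  then show "mult_op \<phi> (\<lambda>x. a * u x + b * v x) = (\<lambda>x. a * mult_op \<phi> u x + b * mult_op \<phi> v x)"
    by (auto simp: mult_op_def fun_eq_iff ip_add_right ell2_scale ip_scale_right ell2_conv_kernel[OF \<phi>])
qed (auto intro: mult_bound)

lemma mult_symbol_lincomb:
  assumes \<phi>: "bounded_symbol A \<phi>" and \<psi>: "bounded_symbol B \<psi>" and u: "ell2 u"
  shows "mult_op (\<lambda>\<theta>. a * \<phi> \<theta> + b * \<psi> \<theta>) u = (\<lambda>n. a * mult_op \<phi> u n + b * mult_op \<psi> u n)"
proof
  fix n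
  have "conv_kernel (\<lambda>\<theta>. a * \<phi> \<theta> + b * \<psi> \<theta>) n = (\<lambda>m. cnj a * conv_kernel \<phi> n m + cnj b * conv_kernel \<psi> n m)"
    using bounded_symbol_integrable[OF bounded_symbol_mult[OF \<phi> bounded_symbol_character]]
      bounded_symbol_integrable[OF bounded_symbol_mult[OF \<psi> bounded_symbol_character]]
    by (simp add: conv_kernel_def distrib_right mult.assoc fun_eq_iff del: complex_cnj_cnj)
  then show "mult_op (\<lambda>\<theta>. a * \<phi> \<theta> + b * \<psi> \<theta>) u n = a * mult_op \<phi> u n + b * mult_op \<psi> u n"
    by (simp add: mult_op_def ip_add_left ell2_scale ell2_conv_kernel[OF \<phi>] ell2_conv_kernel[OF \<psi>] u ip_scale_left)
qed

lemma mult_symbol_scale: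
  "bounded_symbol B \<phi> \<Longrightarrow> ell2 u \<Longrightarrow> mult_op (\<lambda>\<theta>. c * \<phi> \<theta>) u = (\<lambda>n. c * mult_op \<phi> u n)"
  using mult_symbol_lincomb[of B \<phi> B \<phi> u c 0] by simp

lemma mult_symbol_sum:
  assumes "\<And>i. i \<in> I \<Longrightarrow> bounded_symbol B (\<phi> i)" and u: "ell2 u" and "finite I"
  shows "mult_op (\<lambda>\<theta>. \<Sum>i\<in>I. \<phi> i \<theta>) u = (\<lambda>n. \<Sum>i\<in>I. mult_op (\<phi> i) u n)"
    and "\<exists>C. bounded_symbol C (\<lambda>\<theta>. \<Sum>i\<in>I. \<phi> i \<theta>)"
  using assms(3,1)
proof (induction I rule: finite_induct)
  case empty
  { case 1
    have "mult_op (\<lambda>\<theta>. 0) u = (\<lambda>n. 0 * mult_op (\<lambda>\<theta>. 0) u n + 0 * mult_op (\<lambda>\<theta>. 0) u n)"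
      using mult_symbol_lincomb[OF bounded_symbol_const[of 0] bounded_symbol_const[of 0] u, of 0 0] by simp
    then show ?case by simp
  next
    case 2
    then show ?case using bounded_symbol_const[of 0] by auto }
next
  case (insert i I)
  { case 1
    then obtain C where C: "bounded_symbol C (\<lambda>\<theta>. \<Sum>i\<in>I. \<phi> i \<theta>)" using insert.IH(2) by auto
    show ?case using mult_symbol_lincomb[OF _ C u, of B "\<phi> i" 1 1] insert 1 by simp
  next
    case 2
    then obtain C where C: "bounded_symbol C (\<lambda>\<theta>. \<Sum>i\<in>I. \<phi> i \<theta>)" using insert.IH(2) by auto
    show ?case using bounded_symbol_add[OF _ C, of B "\<phi> i"] insert.hyps 2 by auto }
qed

lemma mult_1: "ell2 u \<Longrightarrow> mult_op (\<lambda>\<theta>. 1) u = u"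
proof -
  assume u: "ell2 u"
  have "bounded_oper (\<lambda>u :: int^'a \<Rightarrow> complex. u)" by (rule bounded_operI[where K = 1]) auto
  then show ?thesis
    using bounded_oper_eqI[OF mult_bounded[OF bounded_symbol_const[of 1]], of "\<lambda>u. u" u] mult_1_finsupp u by blast
qed

lemma mult_adjoint:
  assumes \<phi>: "bounded_symbol B \<phi>" and v: "ell2 v" and u: "ell2 u"
  shows "ip v (mult_op \<phi> u) = ip (mult_op (\<lambda>\<theta>. cnj (\<phi> \<theta>)) v) u"
proof -
  note \<phi>' = bounded_symbol_cnj[OF \<phi>]
  obtain U where U: "\<And>k. finsupp (U k)" "ell2_lim U u" using ell2_finsupp_approx[OF u] by blast
  obtain V where V: "\<And>k. finsupp (V k)" "ell2_lim V v" using ell2_finsupp_approx[OF v] by blast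
  have "ip (V k) (mult_op \<phi> (U k)) = ip (mult_op (\<lambda>\<theta>. cnj (\<phi> \<theta>)) (V k)) (U k)" for k
  proof -
    have "cnj (ip (U k) (mult_op (\<lambda>\<theta>. cnj (\<phi> \<theta>)) (V k))) = ip (V k) (mult_op \<phi> (U k))"
      unfolding mult_form_finsupp[OF U(1) V(1) \<phi>'] mult_form_finsupp[OF V(1) U(1) \<phi>]
      by (rule trans[OF Bochner_Integration.integral_cnj[symmetric]])
        (rule Bochner_Integration.integral_cong, simp_all add: mult_ac)
    then show ?thesis by (simp add: ip_cnj)
  qed
  moreover have "(\<lambda>k. ip (V k) (mult_op \<phi> (U k))) \<longlonglongrightarrow> ip v (mult_op \<phi> u)"
    by (intro ell2_lim_ip V bounded_oper_lim[OF mult_bounded[OF \<phi>]] U)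
  moreover have "(\<lambda>k. ip (mult_op (\<lambda>\<theta>. cnj (\<phi> \<theta>)) (V k)) (U k)) \<longlonglongrightarrow> ip (mult_op (\<lambda>\<theta>. cnj (\<phi> \<theta>)) v) u"
    by (intro ell2_lim_ip V bounded_oper_lim[OF mult_bounded[OF \<phi>']] U)
  ultimately show ?thesis using LIMSEQ_unique by auto
qed

lemma mult_nonneg:
  assumes \<phi>: "bounded_symbol B (\<lambda>\<theta>. complex_of_real (f \<theta>))" and f: "\<And>\<theta>. 0 \<le> f \<theta>" and u: "ell2 u"
  shows "ip u (mult_op (\<lambda>\<theta>. complex_of_real (f \<theta>)) u) \<in> \<real>\<^sub>\<ge>\<^sub>0"
proof -
  obtain U where U: "\<And>k. finsupp (U k)" "ell2_lim U u" using ell2_finsupp_approx[OF u] by blast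
  have "ip (U k) (mult_op (\<lambda>\<theta>. complex_of_real (f \<theta>)) (U k)) \<in> \<real>\<^sub>\<ge>\<^sub>0" for k
  proof -
    have "ip (U k) (mult_op (\<lambda>\<theta>. complex_of_real (f \<theta>)) (U k))
        = (\<integral>\<theta>. complex_of_real (f \<theta> * (cmod (fourier (U k) \<theta>))\<^sup>2) \<partial>torus)"
      unfolding mult_form_finsupp[OF U(1) U(1) \<phi>]
      by (intro Bochner_Integration.integral_cong refl) (metis complex_norm_square mult.commute of_real_mult)
    also have "\<dots> = complex_of_real (\<integral>\<theta>. f \<theta> * (cmod (fourier (U k) \<theta>))\<^sup>2 \<partial>torus)"
      by (rule integral_complex_of_real)
    finally show ?thesis using f by (simp add: complex_nonneg_Reals_iff integral_nonneg)
  qed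
  moreover have "(\<lambda>k. ip (U k) (mult_op (\<lambda>\<theta>. complex_of_real (f \<theta>)) (U k)))
      \<longlonglongrightarrow> ip u (mult_op (\<lambda>\<theta>. complex_of_real (f \<theta>)) u)"
    by (intro ell2_lim_ip bounded_oper_lim[OF mult_bounded[OF \<phi>]] U)
  ultimately show ?thesis
    by (rule closed_sequentially[OF closed_nonneg_Reals_complex])
qed

subsection \<open>Laurent operators as multiplication operators\<close>

text \<open>Convolutions commute with translations; this makes the calculus multiplicative as soon as one of the
  two symbols is a trigonometric polynomial.\<close>

lemma laurent_mult:
  assumes "laurent T \<tau>"
  shows "(\<exists>K. bounded_symbol K \<tau>) \<and> (\<forall>B \<psi> u. bounded_symbol B \<psi> \<longrightarrow> ell2 u \<longrightarrow>
    T (mult_op \<psi> u) = mult_op (\<lambda>\<theta>. \<tau> \<theta> * \<psi> \<theta>) u \<and> mult_op \<psi> (T u) = mult_op (\<lambda>\<theta>. \<tau> \<theta> * \<psi> \<theta>) u)"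
  using assms
proof (induction rule: laurent.induct)
  case (shift i m)
  have c: "cis (- (of_int m * \<theta> i)) = cnj (character (axis i m) \<theta>)" for \<theta> :: "'a \<Rightarrow> real"
    by (simp add: character_axis cis_cnj)
  have k: "conv_kernel (\<lambda>\<theta>. cis (- (of_int m * \<theta> i)) * \<psi> \<theta>) n k = conv_kernel \<psi> (n - axis i m) k" for n k \<psi>
  proof -
    have "n - axis i m - k = (n - k) - axis i m" by simp
    then show ?thesis by (simp only: conv_kernel_def c character_diff[of "n - k" "axis i m"]) (simp add: mult_ac)
  qed
  have k': "conv_kernel \<psi> (n - axis i m) k = conv_kernel \<psi> n (k + axis i m)" for n k \<psi>
    by (simp add: conv_kernel_def algebra_simps)
  have "shift i m (mult_op \<psi> u) = mult_op (\<lambda>\<theta>. cis (- (of_int m * \<theta> i)) * \<psi> \<theta>) u" for \<psi> u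
    using k by (simp add: shift_def mult_op_def fun_eq_iff ip_def)
  moreover have "mult_op \<psi> (shift i m u) = mult_op (\<lambda>\<theta>. cis (- (of_int m * \<theta> i)) * \<psi> \<theta>) u" for \<psi> u
  proof
    fix n
    have "(\<Sum>\<^sub>\<infinity>k. cnj (conv_kernel \<psi> n k) * u (k - axis i m))
        = (\<Sum>\<^sub>\<infinity>k. cnj (conv_kernel \<psi> n (k - axis i m + axis i m)) * u (k - axis i m))" by simp
    also have "\<dots> = (\<Sum>\<^sub>\<infinity>k. cnj (conv_kernel \<psi> n (k + axis i m)) * u k)"
      by (rule infsum_reindex_bij_betw[OF bij_minus_axis, of "\<lambda>k. cnj (conv_kernel \<psi> n (k + axis i m)) * u k"])
    finally show "mult_op \<psi> (shift i m u) n = mult_op (\<lambda>\<theta>. cis (- (of_int m * \<theta> i)) * \<psi> \<theta>) u n"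
      by (simp add: shift_def mult_op_def ip_def k k')
  qed
  moreover have "bounded_symbol 1 (\<lambda>\<theta>. cis (- (of_int m * \<theta> i)))"
    unfolding c by (intro bounded_symbol_cnj bounded_symbol_character)
  ultimately show ?case by blast
next
  case (lincomb S \<sigma> T \<tau> a b)
  obtain K L where K: "bounded_symbol K \<sigma>" and L: "bounded_symbol L \<tau>" using lincomb.IH by blast
  have "bounded_symbol (cmod a * K + cmod b * L) (\<lambda>\<theta>. a * \<sigma> \<theta> + b * \<tau> \<theta>)"
    by (intro bounded_symbol_add bounded_symbol_mult bounded_symbol_const K L)
  moreover have "(\<lambda>n. a * mult_op (\<lambda>\<theta>. \<sigma> \<theta> * \<psi> \<theta>) u n + b * mult_op (\<lambda>\<theta>. \<tau> \<theta> * \<psi> \<theta>) u n)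
      = mult_op (\<lambda>\<theta>. (a * \<sigma> \<theta> + b * \<tau> \<theta>) * \<psi> \<theta>) u" if "bounded_symbol B \<psi>" "ell2 u" for B \<psi> u
    using mult_symbol_lincomb[OF bounded_symbol_mult[OF K that(1)] bounded_symbol_mult[OF L that(1)] that(2), of a b]
    by (simp add: algebra_simps)
  moreover have "mult_op \<psi> (\<lambda>n. a * S u n + b * T u n) = (\<lambda>n. a * mult_op \<psi> (S u) n + b * mult_op \<psi> (T u) n)"
    if "bounded_symbol B \<psi>" "ell2 u" for B \<psi> u
    using bounded_oper_lincomb[OF mult_bounded[OF that(1)] laurent_ell2[OF lincomb.hyps(1) that(2)]
        laurent_ell2[OF lincomb.hyps(2) that(2)]] .
  ultimately show ?case using lincomb.IH by auto
next
  case (comp S \<sigma> T \<tau>)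
  obtain K L where K: "bounded_symbol K \<sigma>" and L: "bounded_symbol L \<tau>" using comp.IH by blast
  have "S (T (mult_op \<psi> u)) = mult_op (\<lambda>\<theta>. \<sigma> \<theta> * \<tau> \<theta> * \<psi> \<theta>) u"
    if "bounded_symbol B \<psi>" "ell2 u" for B \<psi> u
    using comp.IH that bounded_symbol_mult[OF L that(1)] by (simp add: mult.assoc)
  moreover have "mult_op \<psi> (S (T u)) = mult_op (\<lambda>\<theta>. \<sigma> \<theta> * \<tau> \<theta> * \<psi> \<theta>) u"
    if "bounded_symbol B \<psi>" "ell2 u" for B \<psi> u
  proof -
    have "mult_op \<psi> (S (T u)) = mult_op (\<lambda>\<theta>. \<sigma> \<theta> * \<psi> \<theta>) (T u)"
      using comp.IH(1) that laurent_ell2[OF comp.hyps(2) that(2)] by blast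
    also have "\<dots> = mult_op (\<lambda>\<theta>. \<tau> \<theta> * (\<sigma> \<theta> * \<psi> \<theta>)) u"
      using comp.IH(2) that bounded_symbol_mult[OF K that(1)] by blast
    finally show ?thesis by (simp add: mult_ac)
  qed
  ultimately show ?case using bounded_symbol_mult[OF K L] by blast
qed

lemma laurent_bounded_symbol:
  assumes "laurent T \<tau>"
  obtains K where "bounded_symbol K \<tau>"
  using laurent_mult[OF assms] by blast

lemma laurent_comp_mult:
  "laurent T \<tau> \<Longrightarrow> bounded_symbol B \<psi> \<Longrightarrow> ell2 u \<Longrightarrow> T (mult_op \<psi> u) = mult_op (\<lambda>\<theta>. \<tau> \<theta> * \<psi> \<theta>) u"
  and laurent_commutes_mult:
  "laurent T \<tau> \<Longrightarrow> bounded_symbol B \<psi> \<Longrightarrow> ell2 u \<Longrightarrow> T (mult_op \<psi> u) = mult_op \<psi> (T u)"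
  using laurent_mult by metis+

lemma laurent_eq_mult: "laurent T \<tau> \<Longrightarrow> ell2 u \<Longrightarrow> T u = mult_op \<tau> u"
  using laurent_comp_mult[OF _ bounded_symbol_const[of 1], of T \<tau> u] by (simp add: mult_1)

lemma laurent_norm_bound:
  assumes "laurent T \<tau>" "\<And>\<theta>. cmod (\<tau> \<theta>) \<le> B" "ell2 u"
  shows "ell2_norm (T u) \<le> B * ell2_norm u"
proof -
  obtain K where "bounded_symbol K \<tau>" using laurent_bounded_symbol[OF assms(1)] .
  then have "bounded_symbol B \<tau>" using assms(2) by (simp add: bounded_symbol_def)
  then show ?thesis using mult_bound(2) assms(3) laurent_eq_mult[OF assms(1,3)] by metis
qed

section \<open>The spectral measure of a self-adjoint Laurent operator\<close>

text \<open>Regularity squeezes \<open>B\<close> between a compact and an open set of nearly the same measure, Urysohn's lemma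
  interpolates between them, and the Weierstrass theorem replaces the result by a polynomial. The bound
  \<open>2\<close> will keep the operators with these symbols uniformly bounded.\<close>

lemma polynomial_approx_indicator:
  fixes M :: "real measure"
  assumes sets: "sets M = sets borel" and fin: "finite_measure M" and supp: "AE x in M. \<bar>x\<bar> \<le> K"
    and B: "B \<in> sets borel" and e: "0 < e"
  obtains f where "real_polynomial_function f" "\<And>x. \<bar>x\<bar> \<le> K \<Longrightarrow> \<bar>f x\<bar> \<le> 2"
    "(\<integral>x. \<bar>f x - indicator B x\<bar> \<partial>M) \<le> e"
proof -
  interpret finite_measure M by (rule fin)
  have space: "space M = UNIV" using sets_eq_imp_space_eq[OF sets] by simp
  \<comment> \<open>The two regularity errors and the uniform error of the polynomial add up to \<open>(2 + measure M UNIV) d\<close>.\<close>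
  define d where "d = min 1 (e / (2 + measure M UNIV))"
  have d: "0 < d" "d \<le> 1" "d * (2 + measure M UNIV) \<le> e"
    using e measure_nonneg[of M UNIV] by (auto simp: d_def min_def field_simps add_pos_nonneg)
  have top: "emeasure M (space M) \<noteq> \<infinity>" by simp
  have "\<exists>C. C \<subseteq> B \<and> compact C \<and> measure M B - d < measure M C"
  proof (rule ccontr)
    assume contra: "\<not> ?thesis"
    then have "emeasure M C \<le> ennreal (measure M B - d)" if "C \<subseteq> B" "compact C" for C
      using that by (auto simp: emeasure_eq_measure not_less intro!: ennreal_leI)
    then have "emeasure M B \<le> ennreal (measure M B - d)"
      unfolding inner_regular[OF sets top B] by (intro SUP_least) auto
    moreover have "0 \<le> measure M B - d" using contra by (auto simp: not_less dest: spec[of _ "{}"])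
    ultimately show False using d by (simp add: emeasure_eq_measure)
  qed
  then obtain C where C: "C \<subseteq> B" "compact C" "measure M B - d < measure M C" by blast
  have "\<exists>U. B \<subseteq> U \<and> open U \<and> measure M U < measure M B + d"
  proof (rule ccontr)
    assume "\<not> ?thesis"
    then have "ennreal (measure M B + d) \<le> emeasure M U" if "B \<subseteq> U" "open U" for U
      using that by (auto simp: emeasure_eq_measure not_less intro!: ennreal_leI)
    then have "ennreal (measure M B + d) \<le> emeasure M B"
      unfolding outer_regular[OF sets top B] by (intro INF_greatest) auto
    then show False using d by (simp add: emeasure_eq_measure)
  qed
  then obtain U where U: "B \<subseteq> U" "open U" "measure M U < measure M B + d" by blast
  obtain h :: "real \<Rightarrow> real" where h: "continuous_on UNIV h" "\<And>x. h x \<in> closed_segment 0 1"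
      "\<And>x. x \<in> - U \<Longrightarrow> h x = 0" "\<And>x. x \<in> C \<Longrightarrow> h x = 1"
    using Urysohn[of "- U" C 0 "1 :: real"] U C compact_imp_closed by (metis (no_types) ComplI closed_Compl compl_le_compl_iff disjoint_eq_subset_Compl dual_order.trans double_complement)
  have h01: "0 \<le> h x" "h x \<le> 1" for x using h(2)[of x] by (auto simp: closed_segment_eq_real_ivl)
  obtain f where f: "real_polynomial_function f" "\<And>x. x \<in> {-K..K} \<Longrightarrow> \<bar>h x - f x\<bar> < d"
    using Stone_Weierstrass_real_polynomial_function[of "{-K..K}" h d] h(1) d
    by (metis compact_Icc continuous_on_subset subset_UNIV)
  show ?thesis
  proof (rule that)
    show "real_polynomial_function f" by (rule f)
    show "\<bar>f x\<bar> \<le> 2" if "\<bar>x\<bar> \<le> K" for x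
    proof -
      have "\<bar>h x - f x\<bar> < d" using f(2)[of x] that by (simp add: abs_le_iff)
      then show ?thesis using h01[of x] d by linarith
    qed
    have meas: "C \<in> sets M" "U \<in> sets M" using C(2) U(2) sets borel_compact by auto
    have "(\<integral>x. \<bar>f x - indicator B x\<bar> \<partial>M) \<le> (\<integral>x. indicator (U - C) x + d \<partial>M)"
    proof (rule integral_mono_AE')
      show "integrable M (\<lambda>x. indicator (U - C) x + d)"
        using meas by (intro Bochner_Integration.integrable_add integrable_const integrable_real_indicator)
          (auto simp: emeasure_eq_measure)
      show "AE x in M. \<bar>f x - indicator B x\<bar> \<le> indicator (U - C) x + d"
        using supp
      proof eventually_elim
        case (elim x)
        have "\<bar>h x - indicator B x\<bar> \<le> indicator (U - C) x"
          using h01[of x] h(3,4)[of x] C(1) U(1) by (auto simp: indicator_def abs_if)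
        then show ?case using f(2)[of x] elim by (auto simp: abs_le_iff abs_if split: if_splits)
      qed
      show "AE x in M. 0 \<le> indicator (U - C) x + d" using d by simp
    qed
    also have "\<dots> = measure M (U - C) + d * measure M UNIV"
      using meas by (subst Bochner_Integration.integral_add)
        (auto simp: space emeasure_eq_measure intro!: integrable_real_indicator)
    also have "measure M (U - C) = measure M U - measure M C"
      using C(1) U(1) meas by (intro finite_measure_Diff) auto
    also have "\<dots> + d * measure M UNIV \<le> d * (2 + measure M UNIV)"
      using C(3) U(3) by (simp add: algebra_simps)
    finally show "(\<integral>x. \<bar>f x - indicator B x\<bar> \<partial>M) \<le> e" using d(3) by linarith
  qed
qed

text \<open>At finitely supported sequences the form is the integral of the symbol against a bounded function. The
  operators are uniformly bounded, so that the limit extends to all sequences.\<close>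

lemma mult_op_form_tendsto:
  assumes \<phi>: "\<And>k. bounded_symbol B (\<phi> k)" and \<psi>: "bounded_symbol B \<psi>"
    and L1: "(\<lambda>k. \<integral>\<theta>. cmod (\<phi> k \<theta> - \<psi> \<theta>) \<partial>torus) \<longlonglongrightarrow> 0"
    and v: "ell2 v" and u: "ell2 u"
  shows "(\<lambda>k. ip v (mult_op (\<phi> k) u)) \<longlonglongrightarrow> ip v (mult_op \<psi> u)"
proof -
  have fs: "(\<lambda>k. ip z (mult_op (\<phi> k) w)) \<longlonglongrightarrow> ip z (mult_op \<psi> w)" if z: "finsupp z" and w: "finsupp w" for z w
  proof -
    obtain C where C: "bounded_symbol C (\<lambda>\<theta>. cnj (fourier z \<theta>) * fourier w \<theta>)"
      using bounded_symbol_mult[OF bounded_symbol_cnj[OF bounded_symbol_fourier] bounded_symbol_fourier] by blast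
    let ?h = "\<lambda>\<theta>. cnj (fourier z \<theta>) * fourier w \<theta>"
    have "cmod (ip z (mult_op (\<phi> k) w) - ip z (mult_op \<psi> w)) \<le> C * (\<integral>\<theta>. cmod (\<phi> k \<theta> - \<psi> \<theta>) \<partial>torus)" for k
    proof -
      have i: "integrable torus (\<lambda>\<theta>. \<phi> k \<theta> - \<psi> \<theta>)"
        using bounded_symbol_integrable[OF \<phi>] bounded_symbol_integrable[OF \<psi>] by simp
      have i1: "integrable torus (\<lambda>\<theta>. \<phi> k \<theta> * ?h \<theta>)" "integrable torus (\<lambda>\<theta>. \<psi> \<theta> * ?h \<theta>)"
        by (rule bounded_symbol_integrable[OF bounded_symbol_mult[OF \<phi> C]],
            rule bounded_symbol_integrable[OF bounded_symbol_mult[OF \<psi> C]])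
      have "ip z (mult_op (\<phi> k) w) - ip z (mult_op \<psi> w) = (\<integral>\<theta>. (\<phi> k \<theta> - \<psi> \<theta>) * ?h \<theta> \<partial>torus)"
        unfolding mult_form_finsupp[OF z w \<phi>] mult_form_finsupp[OF z w \<psi>]
        using Bochner_Integration.integral_diff[OF i1] by (simp only: left_diff_distrib)
      also have "cmod \<dots> \<le> (\<integral>\<theta>. C * cmod (\<phi> k \<theta> - \<psi> \<theta>) \<partial>torus)"
      proof (rule order_trans[OF integral_norm_bound integral_mono])
        show "integrable torus (\<lambda>\<theta>. norm ((\<phi> k \<theta> - \<psi> \<theta>) * ?h \<theta>))"
          using Bochner_Integration.integrable_diff[OF i1] by (simp add: left_diff_distrib)
        show "integrable torus (\<lambda>\<theta>. C * cmod (\<phi> k \<theta> - \<psi> \<theta>))" using i by simp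
        show "norm ((\<phi> k \<theta> - \<psi> \<theta>) * ?h \<theta>) \<le> C * cmod (\<phi> k \<theta> - \<psi> \<theta>)" for \<theta>
          unfolding norm_mult[of "\<phi> k \<theta> - \<psi> \<theta>"] mult.commute[of C]
          using C by (intro mult_left_mono) (auto simp: bounded_symbol_def)
      qed
      finally show ?thesis by simp
    qed
    moreover have "(\<lambda>k. C * (\<integral>\<theta>. cmod (\<phi> k \<theta> - \<psi> \<theta>) \<partial>torus)) \<longlonglongrightarrow> 0"
      using L1 by (rule tendsto_mult_right_zero)
    ultimately have "(\<lambda>k. ip z (mult_op (\<phi> k) w) - ip z (mult_op \<psi> w)) \<longlonglongrightarrow> 0"
      by (rule null_sequence_if_norm_le)
    then show ?thesis by (simp only: LIM_zero_iff)
  qed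
  obtain U where U: "\<And>k. finsupp (U k)" "ell2_lim U u" using ell2_finsupp_approx[OF u] by blast
  obtain V where V: "\<And>k. finsupp (V k)" "ell2_lim V v" using ell2_finsupp_approx[OF v] by blast
  have ellU: "ell2 (U j)" and ellV: "ell2 (V j)" for j using U V by (auto simp: finsupp_ell2)
  have B: "0 \<le> B" using bounded_symbol_nonneg[OF \<psi>] .
  let ?c = "\<lambda>j. ell2_norm (\<lambda>x. V j x - v x) * (B * ell2_norm u) + ell2_norm (V j) * (B * ell2_norm (\<lambda>x. U j x - u x))"
  have close: "cmod (ip (V j) (mult_op \<eta> (U j)) - ip v (mult_op \<eta> u)) \<le> ?c j"
    if \<eta>: "bounded_symbol B \<eta>" for \<eta> j
  proof -
    note bo = mult_bounded[OF \<eta>]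
    have "ip (V j) (mult_op \<eta> (U j)) - ip v (mult_op \<eta> u)
        = ip (\<lambda>x. V j x - v x) (mult_op \<eta> u) + ip (V j) (mult_op \<eta> (\<lambda>x. U j x - u x))"
      using ellU ellV u v bounded_oper_ell2[OF bo]
      by (simp add: bounded_oper_diff[OF bo] ip_diff_left ip_diff_right)
    also have "cmod \<dots> \<le> ?c j"
    proof (rule norm_triangle_mono)
      have "ell2_norm (mult_op \<eta> u) \<le> B * ell2_norm u" by (rule mult_bound[OF \<eta> u])
      then show "cmod (ip (\<lambda>x. V j x - v x) (mult_op \<eta> u)) \<le> ell2_norm (\<lambda>x. V j x - v x) * (B * ell2_norm u)"
        using ip_Cauchy_Schwarz[OF ell2_diff[OF ellV v] bounded_oper_ell2[OF bo u]]
        by (meson ell2_norm_nonneg mult_left_mono order_trans)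
      have "ell2_norm (mult_op \<eta> (\<lambda>x. U j x - u x)) \<le> B * ell2_norm (\<lambda>x. U j x - u x)"
        by (rule mult_bound[OF \<eta> ell2_diff[OF ellU u]])
      then show "cmod (ip (V j) (mult_op \<eta> (\<lambda>x. U j x - u x))) \<le> ell2_norm (V j) * (B * ell2_norm (\<lambda>x. U j x - u x))"
        using ip_Cauchy_Schwarz[OF ellV bounded_oper_ell2[OF bo ell2_diff[OF ellU u]]]
        by (meson ell2_norm_nonneg mult_left_mono order_trans)
    qed
    finally show ?thesis .
  qed
  have c0: "?c \<longlonglongrightarrow> 0"
  proof -
    have "(\<lambda>j. ell2_norm (V j)) \<longlonglongrightarrow> ell2_norm v"
      using tendsto_real_sqrt[OF ell2_lim_norm[OF V(2)]] by simp
    moreover have "(\<lambda>j. ell2_norm (\<lambda>x. V j x - v x)) \<longlonglongrightarrow> 0" "(\<lambda>j. ell2_norm (\<lambda>x. U j x - u x)) \<longlonglongrightarrow> 0"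
      using U V by (simp_all add: ell2_lim_def)
    ultimately have "?c \<longlonglongrightarrow> 0 * (B * ell2_norm u) + ell2_norm v * (B * 0)"
      by (intro tendsto_add tendsto_mult tendsto_const)
    then show ?thesis by simp
  qed
  show ?thesis
  proof (rule LIMSEQ_I)
    fix e :: real assume "0 < e"
    then obtain j where j: "?c j < e / 3"
      using order_tendstoD(2)[OF c0, of "e/3"] by (auto simp: eventually_sequentially)
    obtain k0 where k0: "\<And>k. k \<ge> k0 \<Longrightarrow> cmod (ip (V j) (mult_op (\<phi> k) (U j)) - ip (V j) (mult_op \<psi> (U j))) < e / 3"
      using LIMSEQ_D[OF fs[OF V(1) U(1), of j j], of "e/3"] \<open>0 < e\<close> by auto
    show "\<exists>k0. \<forall>k\<ge>k0. norm (ip v (mult_op (\<phi> k) u) - ip v (mult_op \<psi> u)) < e"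
    proof (intro exI allI impI)
      fix k assume k: "k \<ge> k0"
      let ?a = "ip v (mult_op (\<phi> k) u)" and ?a' = "ip (V j) (mult_op (\<phi> k) (U j))"
      let ?b = "ip v (mult_op \<psi> u)" and ?b' = "ip (V j) (mult_op \<psi> (U j))"
      have "cmod (?a - ?b) \<le> cmod (?a' - ?a) + cmod (?a' - ?b') + cmod (?b' - ?b)"
        using dist_triangle[of ?a ?b ?a'] dist_triangle[of ?a' ?b ?b']
        unfolding dist_norm norm_minus_commute[of ?a ?a'] by linarith
      then show "norm (?a - ?b) < e"
        using close[OF \<phi>, of j k] close[OF \<psi>, of j] j k0[OF k] by linarith
    qed
  qed
qed

lemma laurent_polynomial:
  assumes T: "laurent T (\<lambda>\<theta>. complex_of_real (p \<theta>))" and f: "real_polynomial_function f"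
  shows "\<exists>S. laurent S (\<lambda>\<theta>. complex_of_real (f (p \<theta>)))"
  using f
proof (induction rule: real_polynomial_function.induct)
  case (linear f)
  have "f x = f 1 * x" for x
    using linear_scale[OF bounded_linear.linear[OF linear], of x 1] by (simp add: mult.commute)
  then have "complex_of_real (f 1) * complex_of_real (p \<theta>) = complex_of_real (f (p \<theta>))" for \<theta>
    by (metis of_real_mult)
  then show ?case using laurent_scale[OF T, of "complex_of_real (f 1)"] by auto
next
  case (const c)
  then show ?case using laurent_const by blast
next
  case (add f g)
  then obtain S S' where "laurent S (\<lambda>\<theta>. complex_of_real (f (p \<theta>)))" "laurent S' (\<lambda>\<theta>. complex_of_real (g (p \<theta>)))"
    by blast
  from laurent_add[OF this] show ?case by auto
next
  case (mult f g)
  then obtain S S' where "laurent S (\<lambda>\<theta>. complex_of_real (f (p \<theta>)))" "laurent S' (\<lambda>\<theta>. complex_of_real (g (p \<theta>)))"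
    by blast
  from laurent.comp[OF this] show ?case by auto
qed

definition spectral_projection :: "(('d::finite \<Rightarrow> real) \<Rightarrow> real) \<Rightarrow> real set \<Rightarrow> (int^'d) oper" where
  "spectral_projection p B = mult_op (\<lambda>\<theta>. complex_of_real (indicator B (p \<theta>)))"

context
  fixes T :: "(int^'d::finite) oper" and p :: "('d \<Rightarrow> real) \<Rightarrow> real" and K :: real
  assumes T: "laurent T (\<lambda>\<theta>. complex_of_real (p \<theta>))" and K: "bounded_symbol K (\<lambda>\<theta>. complex_of_real (p \<theta>))"
begin

lemma symbol_measurable: "p \<in> borel_measurable torus"
  using measurable_compose[OF bounded_symbol_measurable[OF K] borel_measurable_Re] by simp

lemma symbol_le: "\<bar>p \<theta>\<bar> \<le> K"
  using K by (simp add: bounded_symbol_def)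

lemma bounded_symbol_comp:
  assumes "f \<in> borel_measurable borel" "\<And>x. \<bar>x\<bar> \<le> K \<Longrightarrow> \<bar>f x\<bar> \<le> C"
  shows "bounded_symbol C (\<lambda>\<theta>. complex_of_real (f (p \<theta>)))"
  using assms symbol_le symbol_measurable unfolding bounded_symbol_def by auto

lemma bounded_symbol_indicator:
  "B \<in> sets borel \<Longrightarrow> bounded_symbol 1 (\<lambda>\<theta>. complex_of_real (indicator B (p \<theta>)))"
  by (rule bounded_symbol_comp) (auto simp: indicator_def)

text \<open>For polynomials \<open>f\<close> the operator with symbol \<open>f \<circ> p\<close> is \<open>f(T)\<close>, and composing it with
  \<open>mult_op \<psi>\<close> multiplies the symbols. Both sides pass to mean limits of the symbols.\<close>

lemma indicator_comp_mult:
  assumes B: "B \<in> sets borel" and \<psi>: "bounded_symbol C \<psi>" and u: "ell2 u"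
  shows "spectral_projection p B (mult_op \<psi> u) = mult_op (\<lambda>\<theta>. complex_of_real (indicator B (p \<theta>)) * \<psi> \<theta>) u"
proof -
  let ?M = "distr torus borel p"
  let ?i = "\<lambda>\<theta>. complex_of_real (indicator B (p \<theta>))"
  have fin: "finite_measure ?M" by (rule torus.finite_measure_distr[OF symbol_measurable])
  have supp: "AE x in ?M. \<bar>x\<bar> \<le> K"
    by (subst AE_distr_iff[OF symbol_measurable]) (simp_all add: symbol_le)
  have "\<exists>f. real_polynomial_function f \<and> (\<forall>x. \<bar>x\<bar> \<le> K \<longrightarrow> \<bar>f x\<bar> \<le> 2) \<and>
      (\<integral>x. \<bar>f x - indicator B x\<bar> \<partial>?M) \<le> inverse (real (Suc k))" for k
    using polynomial_approx_indicator[OF _ fin supp B, of "inverse (real (Suc k))"] by auto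
  then obtain f where f: "\<And>k. real_polynomial_function (f k)" "\<And>k x. \<bar>x\<bar> \<le> K \<Longrightarrow> \<bar>f k x\<bar> \<le> 2"
      "\<And>k. (\<integral>x. \<bar>f k x - indicator B x\<bar> \<partial>?M) \<le> inverse (real (Suc k))" by metis
  have fm: "f k \<in> borel_measurable borel" for k
    using f(1) by (intro borel_measurable_continuous_onI continuous_on_polymonial_function) (simp add: real_polynomial_function_eq)
  have C: "0 \<le> C" using bounded_symbol_nonneg[OF \<psi>] .
  let ?f = "\<lambda>k \<theta>. complex_of_real (f k (p \<theta>))"
  have bf: "bounded_symbol 2 (?f k)" for k using bounded_symbol_comp[OF fm f(2)] .
  have bi: "bounded_symbol 2 ?i" 
    by (rule bounded_symbol_comp[OF borel_measurable_indicator[OF B]]) (auto simp: indicator_def)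
  have L1: "(\<integral>\<theta>. cmod (?f k \<theta> - ?i \<theta>) \<partial>torus) \<le> inverse (real (Suc k))" for k
  proof -
    have "(\<integral>\<theta>. cmod (?f k \<theta> - ?i \<theta>) \<partial>torus) = (\<integral>\<theta>. \<bar>f k (p \<theta>) - indicator B (p \<theta>)\<bar> \<partial>torus)"
      by (intro Bochner_Integration.integral_cong refl) (metis norm_of_real of_real_diff real_norm_def)
    also have "\<dots> = (\<integral>x. \<bar>f k x - indicator B x\<bar> \<partial>?M)"
      using B fm by (intro integral_distr[symmetric] symbol_measurable borel_measurable_abs
          borel_measurable_diff borel_measurable_indicator)
    finally show ?thesis using f(3)[of k] by simp
  qed
  have nn: "0 \<le> (\<integral>\<theta>. cmod (?f k \<theta> - ?i \<theta>) \<partial>torus)" for k by (rule Bochner_Integration.integral_nonneg) simp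
  have lim1: "(\<lambda>k. \<integral>\<theta>. cmod (?f k \<theta> - ?i \<theta>) \<partial>torus) \<longlonglongrightarrow> 0"
    by (rule null_sequence_if_norm_le[OF _ LIMSEQ_inverse_real_of_nat]) (use L1 nn in simp)
  have lim2: "(\<lambda>k. \<integral>\<theta>. cmod (?f k \<theta> * \<psi> \<theta> - ?i \<theta> * \<psi> \<theta>) \<partial>torus) \<longlonglongrightarrow> 0"
  proof (rule null_sequence_if_norm_le)
    show "(\<lambda>k. (\<integral>\<theta>. cmod (?f k \<theta> - ?i \<theta>) \<partial>torus) * C) \<longlonglongrightarrow> 0"
      using lim1 by (rule tendsto_mult_left_zero)
    fix k
    have int: "integrable torus (\<lambda>\<theta>. ?f k \<theta> - ?i \<theta>)"
      using bounded_symbol_integrable[OF bf] bounded_symbol_integrable[OF bi] by simp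
    have "(\<integral>\<theta>. cmod (?f k \<theta> * \<psi> \<theta> - ?i \<theta> * \<psi> \<theta>) \<partial>torus) \<le> (\<integral>\<theta>. cmod (?f k \<theta> - ?i \<theta>) * C \<partial>torus)"
    proof (rule integral_mono')
      show "integrable torus (\<lambda>\<theta>. cmod (?f k \<theta> - ?i \<theta>) * C)" using int by simp
      show "cmod (?f k \<theta> * \<psi> \<theta> - ?i \<theta> * \<psi> \<theta>) \<le> cmod (?f k \<theta> - ?i \<theta>) * C" for \<theta>
        using \<psi> unfolding left_diff_distrib[symmetric] norm_mult
        by (intro mult_left_mono) (auto simp: bounded_symbol_def)
    qed (use C in auto)
    then show "norm (\<integral>\<theta>. cmod (?f k \<theta> * \<psi> \<theta> - ?i \<theta> * \<psi> \<theta>) \<partial>torus) \<le> (\<integral>\<theta>. cmod (?f k \<theta> - ?i \<theta>) \<partial>torus) * C"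
      by (simp add: Bochner_Integration.integral_nonneg)
  qed
  have \<psi>u: "ell2 (mult_op \<psi> u)" using mult_bound(1)[OF \<psi> u] .
  have step: "mult_op (?f k) (mult_op \<psi> u) = mult_op (\<lambda>\<theta>. ?f k \<theta> * \<psi> \<theta>) u" for k
  proof -
    obtain S where S: "laurent S (?f k)" using laurent_polynomial[OF T f(1)] by blast
    show ?thesis using laurent_eq_mult[OF S \<psi>u] laurent_comp_mult[OF S \<psi> u] by simp
  qed
  show ?thesis
  proof
    fix n
    have "(\<lambda>k. ip (delta n) (mult_op (?f k) (mult_op \<psi> u))) \<longlonglongrightarrow> ip (delta n) (mult_op ?i (mult_op \<psi> u))"
      by (rule mult_op_form_tendsto[OF bf bi lim1 _ \<psi>u]) (simp add: finsupp_ell2)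
    moreover have "(\<lambda>k. ip (delta n) (mult_op (\<lambda>\<theta>. ?f k \<theta> * \<psi> \<theta>) u)) \<longlonglongrightarrow> ip (delta n) (mult_op (\<lambda>\<theta>. ?i \<theta> * \<psi> \<theta>) u)"
      by (rule mult_op_form_tendsto[OF bounded_symbol_mult[OF bf \<psi>] bounded_symbol_mult[OF bi \<psi>] lim2 _ u]) (simp add: finsupp_ell2)
    ultimately show "spectral_projection p B (mult_op \<psi> u) n = mult_op (\<lambda>\<theta>. ?i \<theta> * \<psi> \<theta>) u n"
      unfolding step spectral_projection_def using LIMSEQ_unique by fastforce
  qed
qed

lemma orth_projection_spectral_projection:
  assumes B: "B \<in> sets borel"
  shows "orth_projection (spectral_projection p B)"
  unfolding orth_projection_def
proof (intro conjI allI impI)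
  note b = bounded_symbol_indicator[OF B]
  show "bounded_oper (spectral_projection p B)"
    unfolding spectral_projection_def by (rule mult_bounded[OF b])
  fix u :: "int^'d \<Rightarrow> complex" assume u: "ell2 u"
  show "spectral_projection p B (spectral_projection p B u) = spectral_projection p B u"
    using indicator_comp_mult[OF B b u] unfolding spectral_projection_def
    by (simp flip: of_real_mult add: indicator_inter_arith[symmetric])
  fix v :: "int^'d \<Rightarrow> complex" assume v: "ell2 v"
  show "ip (spectral_projection p B u) v = ip u (spectral_projection p B v)"
    using mult_adjoint[OF b u v] unfolding spectral_projection_def by simp
qed

text \<open>For the countable additivity, the remainders after \<open>k\<close> terms have symbols that tend to \<open>0\<close> pointwise;
  being projections, they satisfy \<open>\<parallel>P u\<parallel>\<^sup>2 = \<langle>u, P u\<rangle>\<close>, so that convergence of the forms is convergence in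
  norm.\<close>

lemma pvm_spectral_projection: "pvm (spectral_projection p)"
proof
  show "orth_projection (spectral_projection p B)" if "B \<in> sets borel" for B
    using orth_projection_spectral_projection that .
  show "spectral_projection p UNIV u = u" if "ell2 u" for u
    using mult_1[OF that] by (simp add: spectral_projection_def)
  fix F :: "nat \<Rightarrow> real set" and u :: "int^'d \<Rightarrow> complex"
  assume F: "range F \<subseteq> sets borel" "disjoint_family F" and u: "ell2 u"
  let ?P = "spectral_projection p"
  let ?i = "\<lambda>B \<theta>. complex_of_real (indicator B (p \<theta>))"
  let ?R = "\<lambda>k. \<Union>i\<in>{k..}. F i"
  have Fi: "F i \<in> sets borel" for i using F by auto
  have R: "?R k \<in> sets borel" for k using Fi by (intro sets.countable_UN') auto
  have A: "(\<Union>i. F i) \<in> sets borel" using Fi by auto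
  have ell: "ell2 (?P B u)" if "B \<in> sets borel" for B
    unfolding spectral_projection_def using mult_bound(1)[OF bounded_symbol_indicator[OF that] u] .
  have part: "?P (\<Union>i. F i) u = (\<lambda>x. (\<Sum>i<k. ?P (F i) u x) + ?P (?R k) u x)" for k
  proof -
    have ind: "indicator (\<Union>i. F i) x = (\<Sum>i<k. indicator (F i) x) + (indicator (?R k) x :: real)" for x
    proof -
      have iu: "A \<inter> B = {} \<Longrightarrow> indicator (A \<union> B) x = indicator A x + (indicator B x :: real)" for A B
        by (auto simp: indicator_def)
      have eq: "(\<Union>i. F i) = (\<Union>i<k. F i) \<union> ?R k" by (auto) (metis atLeast_iff lessThan_iff not_le)
      have disj: "(\<Union>i<k. F i) \<inter> ?R k = {}"
      proof (intro equals0I)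
        fix y assume "y \<in> (\<Union>i<k. F i) \<inter> ?R k"
        then obtain i j where "i < k" "k \<le> j" "y \<in> F i" "y \<in> F j" by auto
        moreover from this have "F i \<inter> F j = {}" using F(2) by (auto simp: disjoint_family_on_def)
        ultimately show False by blast
      qed
      have "indicator (\<Union>i<k. F i) x = (\<Sum>i<k. indicator (F i) x :: real)"
        using F(2) by (intro indicator_UN_disjoint) (auto intro: disjoint_family_on_mono)
      moreover have "indicator ((\<Union>i<k. F i) \<union> ?R k) x = indicator (\<Union>i<k. F i) x + (indicator (?R k) x :: real)"
        using iu[OF disj] .
      ultimately show ?thesis unfolding eq by simp
    qed
    obtain C where C: "bounded_symbol C (\<lambda>\<theta>. \<Sum>i<k. ?i (F i) \<theta>)"
      using mult_symbol_sum(2)[of "{..<k}" 1 "\<lambda>i. ?i (F i)" u] bounded_symbol_indicator[OF Fi] u by auto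
    have "?P (\<Union>i. F i) u = mult_op (\<lambda>\<theta>. 1 * (\<Sum>i<k. ?i (F i) \<theta>) + 1 * ?i (?R k) \<theta>) u"
      unfolding spectral_projection_def ind by simp
    also have "\<dots> = (\<lambda>x. 1 * mult_op (\<lambda>\<theta>. \<Sum>i<k. ?i (F i) \<theta>) u x + 1 * mult_op (?i (?R k)) u x)"
      by (rule mult_symbol_lincomb[OF C bounded_symbol_indicator[OF R] u])
    finally show ?thesis
      using mult_symbol_sum(1)[of "{..<k}" 1 "\<lambda>i. ?i (F i)" u] bounded_symbol_indicator[OF Fi] u
      by (simp add: spectral_projection_def)
  qed
  have normR: "(ell2_norm (?P (?R k) u))\<^sup>2 = Re (ip u (?P (?R k) u))" for k
  proof -
    note o = orth_projection_spectral_projection[OF R, of k]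
    have "ip u (?P (?R k) u) = ip (?P (?R k) u) (?P (?R k) u)"
      using o u ell[OF R, of k] unfolding orth_projection_def by metis
    then show ?thesis using ip_self[OF ell[OF R, of k]] by simp
  qed
  have "(\<lambda>k. ip u (mult_op (?i (?R k)) u)) \<longlonglongrightarrow> ip u (mult_op (\<lambda>\<theta>. 0) u)"
  proof (rule mult_op_form_tendsto[OF bounded_symbol_indicator[OF R] _ _ u u])
    show "bounded_symbol 1 (\<lambda>\<theta>. 0)" by (simp add: bounded_symbol_def)
    have "(\<lambda>k. \<integral>\<theta>. cmod (?i (?R k) \<theta> - 0) \<partial>torus) \<longlonglongrightarrow> (\<integral>\<theta>. (0 :: real) \<partial>(torus :: ('d \<Rightarrow> real) measure))"
    proof (rule integral_dominated_convergence[where w = "\<lambda>\<theta>. 1"])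
      show "(\<lambda>\<theta>. cmod (?i (?R k) \<theta> - 0)) \<in> borel_measurable torus" for k
        using bounded_symbol_measurable[OF bounded_symbol_indicator[OF R]] by measurable
      show "AE \<theta> in torus. (\<lambda>k. cmod (?i (?R k) \<theta> - 0)) \<longlonglongrightarrow> 0"
      proof (intro AE_I2 tendsto_eventually)
        fix \<theta> :: "'d \<Rightarrow> real"
        have "\<exists>k0. \<forall>k\<ge>k0. p \<theta> \<notin> ?R k"
        proof (cases "\<exists>i. p \<theta> \<in> F i")
          case True
          then obtain i where i: "p \<theta> \<in> F i" by blast
          have "p \<theta> \<notin> F j" if "j > i" for j
          proof -
            have "F i \<inter> F j = {}" using F(2) that by (simp add: disjoint_family_on_def)
            then show ?thesis using i by blast
          qed
          then show ?thesis by (intro exI[of _ "Suc i"]) auto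
        qed auto
        then obtain k0 where "\<forall>k\<ge>k0. p \<theta> \<notin> ?R k" by blast
        then have "\<forall>k\<ge>k0. indicator (?R k) (p \<theta>) = (0 :: real)" by (simp only: indicator_eq_0_iff)
        then have "\<forall>k\<ge>k0. cmod (?i (?R k) \<theta> - 0) = 0" by simp
        then show "eventually (\<lambda>k. cmod (?i (?R k) \<theta> - 0) = 0) sequentially"
          unfolding eventually_sequentially by blast
      qed
    qed (auto simp: indicator_def)
    then show "(\<lambda>k. \<integral>\<theta>. cmod (?i (?R k) \<theta> - 0) \<partial>torus) \<longlonglongrightarrow> 0" by simp
  qed
  moreover have "mult_op (\<lambda>\<theta>. 0) u = (\<lambda>x. 0)" using mult_symbol_sum(1)[of "{}"] u by simp
  ultimately have "(\<lambda>k. Re (ip u (?P (?R k) u))) \<longlonglongrightarrow> Re 0"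
    unfolding spectral_projection_def by (intro tendsto_Re) simp
  then have "(\<lambda>k. sqrt ((ell2_norm (?P (?R k) u))\<^sup>2)) \<longlonglongrightarrow> sqrt 0"
    unfolding normR by (intro tendsto_real_sqrt) simp
  moreover have "(\<lambda>x. ?P (\<Union>i. F i) u x - (\<Sum>i<k. ?P (F i) u x)) = ?P (?R k) u" for k
    unfolding part[of k] by simp
  ultimately have "(\<lambda>k. ell2_norm (\<lambda>x. ?P (\<Union>i. F i) u x - (\<Sum>i<k. ?P (F i) u x))) \<longlonglongrightarrow> 0"
    by (simp only: real_sqrt_abs abs_of_nonneg ell2_norm_nonneg real_sqrt_zero)
  then show "ell2_lim (\<lambda>k x. \<Sum>i<k. ?P (F i) u x) (?P (\<Union>i. F i) u)"
    using ell Fi A by (auto simp: ell2_lim_def ell2_norm_minus[of "?P (\<Union>i. F i) u"] intro!: ell2_sum)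
qed

lemma spectral_projection_support:
  assumes u: "ell2 u"
  shows "spectral_projection p (- {-K..K}) u = (\<lambda>x. 0)"
proof -
  have "p \<theta> \<in> {-K..K}" for \<theta> using symbol_le[of \<theta>] by auto
  then have "spectral_projection p (- {-K..K}) u = mult_op (\<lambda>\<theta>. 0) u"
    by (simp add: spectral_projection_def indicator_def)
  then show ?thesis using mult_symbol_sum(1)[of "{}"] u by simp
qed

text \<open>The first moment is computed from the step functions \<open>t \<mapsto> \<lfloor>n t\<rfloor> / n\<close>, which are within
  \<open>1 / n\<close> of the identity both under the integral and as symbols.\<close>

lemma spectral_measure_spectral_projection: "spectral_measure T (spectral_projection p)"
  unfolding spectral_measure_iff_pvm
proof (intro conjI allI impI)
  show "pvm (spectral_projection p)" by (rule pvm_spectral_projection)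
  interpret pvm "spectral_projection p" by (rule pvm_spectral_projection)
  fix u :: "int^'d \<Rightarrow> complex" assume u: "ell2 u"
  let ?P = "spectral_projection p"
  let ?\<mu> = "scalar_measure ?P u"
  interpret \<mu>: finite_measure ?\<mu> by (rule finite_scalar_measure[OF u])
  have "emeasure ?\<mu> (- {-K..K}) = 0"
    by (subst emeasure_scalar_measure[OF u]) (simp_all add: spectral_projection_support[OF u])
  then have ae: "AE t in ?\<mu>. \<bar>t\<bar> \<le> K"
    by (intro AE_I[of _ _ "- {-K..K}"]) auto
  have total: "measure ?\<mu> UNIV = (ell2_norm u)\<^sup>2"
    using measure_scalar_measure[OF u, of UNIV] UNIV[OF u] by simp
  have id_meas: "(\<lambda>t. t) \<in> borel_measurable ?\<mu>" by (rule measurable_ident_sets) simp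
  show int: "integrable ?\<mu> (\<lambda>t. t)"
    using ae id_meas by (intro \<mu>.integrable_const_bound[of _ K]) simp_all
  have Tu: "T u = mult_op (\<lambda>\<theta>. complex_of_real (p \<theta>)) u" by (rule laurent_eq_mult[OF T u])
  have ellT: "ell2 (T u)" by (rule laurent_ell2[OF T u])
  have "cnj (ip u (T u)) = ip u (T u)"
    unfolding ip_cnj using mult_adjoint[OF K u u] by (simp add: Tu)
  then have real: "ip u (T u) = complex_of_real (Re (ip u (T u)))"
    by (simp add: complex_eq_iff)
  have "\<bar>Re (ip u (T u)) - (\<integral>t. t \<partial>?\<mu>)\<bar> \<le> 2 * (ell2_norm u)\<^sup>2 / real n" if n: "0 < n" for n :: nat
  proof -
    define s :: "real \<Rightarrow> real" where "s = (\<lambda>t. of_int \<lfloor>real n * t\<rfloor> / real n)"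
    define J where "J = {\<lfloor>- (real n * K)\<rfloor>..\<lfloor>real n * K\<rfloor>}"
    define Bm where "Bm = (\<lambda>m :: int. {t :: real. \<lfloor>real n * t\<rfloor> = m})"
    let ?i = "\<lambda>m \<theta>. complex_of_real (indicator (Bm m) (p \<theta>))"
    have close: "\<bar>t - s t\<bar> \<le> 1 / real n" for t
    proof -
      have "\<bar>real n * t - of_int \<lfloor>real n * t\<rfloor>\<bar> \<le> 1" by linarith
      moreover have "t - s t = (real n * t - of_int \<lfloor>real n * t\<rfloor>) / real n"
        using n by (simp add: s_def diff_divide_distrib)
      ultimately show ?thesis by (simp add: divide_right_mono)
    qed
    have s_meas: "s \<in> borel_measurable borel" unfolding s_def by measurable
    have Bm: "Bm m \<in> sets borel" for m unfolding Bm_def by measurable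
    have s_sum: "s t = (\<Sum>m\<in>J. of_int m / real n * indicator (Bm m) t)" if "\<bar>t\<bar> \<le> K" for t
    proof -
      have "- (real n * K) \<le> real n * t" "real n * t \<le> real n * K"
        using that n mult_left_mono[of "-K" t "real n"] mult_left_mono[of t K "real n"] by (auto simp: abs_le_iff)
      then have "\<lfloor>real n * t\<rfloor> \<in> J" by (auto simp: J_def intro: floor_mono)
      moreover have "(\<Sum>m\<in>J. of_int m / real n * indicator (Bm m) t)
          = (\<Sum>m\<in>J. if m = \<lfloor>real n * t\<rfloor> then of_int m / real n else 0)"
        by (intro sum.cong) (auto simp: Bm_def)
      ultimately show ?thesis by (simp add: s_def J_def)
    qed
    have "(\<integral>t. s t \<partial>?\<mu>) = (\<integral>t. (\<Sum>m\<in>J. of_int m / real n * indicator (Bm m) t) \<partial>?\<mu>)"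
    proof (rule integral_cong_AE)
      show "s \<in> borel_measurable ?\<mu>" using s_meas by measurable
      show "(\<lambda>t. \<Sum>m\<in>J. of_int m / real n * indicator (Bm m) t) \<in> borel_measurable ?\<mu>"
        using Bm by measurable
      show "AE t in ?\<mu>. s t = (\<Sum>m\<in>J. of_int m / real n * indicator (Bm m) t)"
        using ae by eventually_elim (rule s_sum)
    qed
    also have "\<dots> = (\<Sum>m\<in>J. of_int m / real n * (ell2_norm (?P (Bm m) u))\<^sup>2)"
      using Bm by (subst Bochner_Integration.integral_sum)
        (auto simp: measure_scalar_measure[OF u] emeasure_scalar_measure[OF u] intro!: integrable_real_indicator)
    finally have ints: "(\<integral>t. s t \<partial>?\<mu>) = (\<Sum>m\<in>J. of_int m / real n * (ell2_norm (?P (Bm m) u))\<^sup>2)" .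
    have bs: "bounded_symbol (K + 1 / real n) (\<lambda>\<theta>. complex_of_real (s (p \<theta>)))"
    proof (rule bounded_symbol_comp[OF s_meas])
      show "\<bar>s x\<bar> \<le> K + 1 / real n" if "\<bar>x\<bar> \<le> K" for x using close[of x] that by linarith
    qed
    have "mult_op (\<lambda>\<theta>. complex_of_real (s (p \<theta>))) u = mult_op (\<lambda>\<theta>. \<Sum>m\<in>J. complex_of_real (of_int m / real n) * ?i m \<theta>) u"
      using s_sum[OF symbol_le] by simp
    also have "\<dots> = (\<lambda>x. \<Sum>m\<in>J. mult_op (\<lambda>\<theta>. complex_of_real (of_int m / real n) * ?i m \<theta>) u x)"
    proof (rule mult_symbol_sum(1)[OF _ u])
      show "bounded_symbol (\<Sum>m\<in>J. \<bar>of_int m / real n\<bar>) (\<lambda>\<theta>. complex_of_real (of_int m / real n) * ?i m \<theta>)" if "m \<in> J" for m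
      proof -
        have "\<bar>of_int m / real n\<bar> \<le> (\<Sum>m\<in>J. \<bar>of_int m / real n\<bar>)"
          using that by (intro member_le_sum) (auto simp: J_def)
        then show ?thesis
          using bounded_symbol_mult[OF bounded_symbol_const[of "complex_of_real (of_int m / real n)"] bounded_symbol_indicator[OF Bm, of m]]
          by (elim bounded_symbol_mono) (simp only: norm_of_real mult_1_right)
      qed
    qed (simp add: J_def)
    also have "\<dots> = (\<lambda>x. \<Sum>m\<in>J. complex_of_real (of_int m / real n) * ?P (Bm m) u x)"
      by (simp only: mult_symbol_scale[OF bounded_symbol_indicator[OF Bm] u] spectral_projection_def)
    finally have "ip u (mult_op (\<lambda>\<theta>. complex_of_real (s (p \<theta>))) u)
        = (\<Sum>m\<in>J. ip u (\<lambda>x. complex_of_real (of_int m / real n) * ?P (Bm m) u x))"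
      using ip_sum_right[OF u ell2_scale[OF ell2[OF Bm u]]] by (simp only:)
    also have "\<dots> = complex_of_real (\<integral>t. s t \<partial>?\<mu>)"
      unfolding ip_scale_right ip_proj[OF Bm u] ints by (simp only: of_real_sum of_real_mult)
    finally have "ip u (mult_op (\<lambda>\<theta>. complex_of_real (s (p \<theta>))) u) = complex_of_real (\<integral>t. s t \<partial>?\<mu>)" .
    moreover have "cmod (ip u (T u) - ip u (mult_op (\<lambda>\<theta>. complex_of_real (s (p \<theta>))) u)) \<le> (ell2_norm u)\<^sup>2 / real n"
    proof -
      have b: "bounded_symbol (1 / real n) (\<lambda>\<theta>. 1 * complex_of_real (p \<theta>) + (-1) * complex_of_real (s (p \<theta>)))"
      proof -
        have "bounded_symbol (1 / real n) (\<lambda>\<theta>. complex_of_real ((\<lambda>t. t - s t) (p \<theta>)))"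
          using s_meas close by (intro bounded_symbol_comp) auto
        then show ?thesis by simp
      qed
      have eq: "(\<lambda>x. T u x - mult_op (\<lambda>\<theta>. complex_of_real (s (p \<theta>))) u x)
          = mult_op (\<lambda>\<theta>. 1 * complex_of_real (p \<theta>) + (-1) * complex_of_real (s (p \<theta>))) u"
        unfolding mult_symbol_lincomb[OF K bs u] Tu by simp
      have "ip u (T u) - ip u (mult_op (\<lambda>\<theta>. complex_of_real (s (p \<theta>))) u)
          = ip u (mult_op (\<lambda>\<theta>. 1 * complex_of_real (p \<theta>) + (-1) * complex_of_real (s (p \<theta>))) u)"
        unfolding eq[symmetric] using ip_diff_right[OF u ellT mult_bound(1)[OF bs u]] by simp
      also have "cmod \<dots> \<le> ell2_norm u * (1 / real n * ell2_norm u)"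
        using ip_Cauchy_Schwarz[OF u mult_bound(1)[OF b u]] mult_bound(2)[OF b u]
        by (meson ell2_norm_nonneg mult_left_mono order_trans)
      finally show ?thesis by (simp add: power2_eq_square)
    qed
    moreover have "\<bar>(\<integral>t. s t \<partial>?\<mu>) - (\<integral>t. t \<partial>?\<mu>)\<bar> \<le> (ell2_norm u)\<^sup>2 / real n"
    proof -
      have int_s: "integrable ?\<mu> s"
      proof (rule \<mu>.integrable_const_bound[of _ "K + 1 / real n"])
        show "AE t in ?\<mu>. norm (s t) \<le> K + 1 / real n"
          using ae
        proof eventually_elim
          case (elim t)
          then show ?case using close[of t] by (simp only: real_norm_def)
        qed
        show "s \<in> borel_measurable ?\<mu>" using s_meas by measurable
      qed
      have "(\<integral>t. s t \<partial>?\<mu>) - (\<integral>t. t \<partial>?\<mu>) = (\<integral>t. s t - t \<partial>?\<mu>)"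
        using int int_s by simp
      also have "\<bar>\<dots>\<bar> \<le> (\<integral>t. \<bar>s t - t\<bar> \<partial>?\<mu>)" by (rule integral_abs_bound)
      also have "\<dots> \<le> (\<integral>t. 1 / real n \<partial>?\<mu>)"
        using close int int_s by (intro integral_mono) (auto simp: abs_minus_commute)
      also have "\<dots> = (ell2_norm u)\<^sup>2 / real n" by (simp add: total)
      finally show ?thesis .
    qed
    moreover have "\<bar>Re (ip u (T u)) - Re (ip u (mult_op (\<lambda>\<theta>. complex_of_real (s (p \<theta>))) u))\<bar>
        \<le> cmod (ip u (T u) - ip u (mult_op (\<lambda>\<theta>. complex_of_real (s (p \<theta>))) u))"
      using abs_Re_le_cmod[of "ip u (T u) - ip u (mult_op (\<lambda>\<theta>. complex_of_real (s (p \<theta>))) u)"] by simp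
    ultimately show ?thesis by simp
  qed
  then have "\<exists>N. \<forall>n\<ge>N. \<bar>Re (ip u (T u)) - (\<integral>t. t \<partial>?\<mu>)\<bar> \<le> 2 * (ell2_norm u)\<^sup>2 / real n"
    by (intro exI[of _ 1]) auto
  from LIMSEQ_le_const[OF lim_const_over_n this] have "Re (ip u (T u)) = (\<integral>t. t \<partial>?\<mu>)" by simp
  with real show "ip u (T u) = complex_of_real (\<integral>t. t \<partial>?\<mu>)" by simp
qed

end

section \<open>The commutator with the conjugate operators\<close>

lemma axis_int_simps:
  fixes n :: "int^'d::finite"
  shows "n - axis i a - axis i b = n - axis i (a + b)" "n - axis i 0 = n"
    and "(n - axis i a) $ i = n $ i - a" "l \<noteq> i \<Longrightarrow> (n - axis l a) $ i = n $ i"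
  by (auto simp: axis_def vec_eq_iff)

lemma A_coord_eq:
  "A_coord i m u n = 1 / (4 * \<i>) * (of_int (2 * n $ i - int m) * u (n - axis i (int m))
      - of_int (2 * n $ i + int m) * u (n - axis i (- int m)))"
  by (simp add: A_coord_def shift_def position_def axis_int_simps algebra_simps)

text \<open>This is \<open>- 1/4 (S\<^sup>m - S\<^sup>-\<^sup>m) (S - S\<^sup>-\<^sup>1)\<close> for the shift \<open>S\<close> in the coordinate \<open>i\<close>, with symbol
  \<open>sin (m \<theta>\<^sub>i) sin \<theta>\<^sub>i\<close>: the position operator in \<open>A_coord i m\<close> cancels.\<close>

definition commutator_coord :: "'d::finite \<Rightarrow> int \<Rightarrow> (int^'d) oper" where
  "commutator_coord i m u = (\<lambda>n. - (1/4) * ((shift i (m + 1) u n + shift i (- m - 1) u n)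
      - (shift i (m - 1) u n + shift i (1 - m) u n)))"

lemma Delta_A_coord_commutator:
  "Delta i (\<lambda>k. \<i> * A_coord i m u k) n - \<i> * A_coord i m (Delta i u) n = commutator_coord i (int m) u n"
proof -
  have args: "1 + int m = int m + 1" "1 + - int m = 1 - int m" "- 1 + int m = int m - 1"
    "- 1 + - int m = - int m - 1" "int m + - 1 = int m - 1" "- int m + 1 = 1 - int m" "- int m + - 1 = - int m - 1"
    by simp_all
  show ?thesis
    by (simp only: Delta_def A_coord_eq shift_def axis_int_simps(1,3) commutator_coord_def args) (simp add: field_simps)
qed

lemma Delta_A_coord_commute:
  assumes "l \<noteq> i"
  shows "Delta l (\<lambda>k. \<i> * A_coord i m u k) = (\<lambda>k. \<i> * A_coord i m (Delta l u) k)"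
proof
  fix n
  have swap: "n - axis l a - axis i b = n - axis i b - axis l a" for a b :: int
    by simp
  show "Delta l (\<lambda>k. \<i> * A_coord i m u k) n = \<i> * A_coord i m (Delta l u) n"
    by (simp only: Delta_def A_coord_eq shift_def axis_int_simps(4)[OF assms] swap) (simp add: field_simps)
qed

definition commutator :: "nat \<Rightarrow> (int^'d::finite) oper" where
  "commutator m u = (\<lambda>n. \<Sum>i\<in>UNIV. commutator_coord i (int m) (MV_on (- {i}) u) n)"

text \<open>With \<open>x\<^sub>i = cos \<theta>\<^sub>i\<close> this is \<open>\<Sum>\<^sub>i (1 - x\<^sub>i\<^sup>2) U\<^bsub>m-1\<^esub>(x\<^sub>i) \<Prod>\<^bsub>l\<noteq>i\<^esub> x\<^sub>l\<close>.\<close>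

definition commutator_symbol :: "nat \<Rightarrow> ('d::finite \<Rightarrow> real) \<Rightarrow> real" where
  "commutator_symbol m \<theta> = (\<Sum>i\<in>UNIV. sin (real m * \<theta> i) * sin (\<theta> i) * (\<Prod>l\<in>- {i}. cos (\<theta> l)))"

lemma MV_A_sum_commutator:
  "MV (\<lambda>k. \<i> * A_sum m u k) n - \<i> * A_sum m (MV u) n = commutator m u n"
proof -
  have "MV (\<lambda>k. \<i> * A_coord i m u k) n - \<i> * A_coord i m (MV u) n
      = commutator_coord i (int m) (MV_on (- {i}) u) n" for i
  proof -
    have "MV_on (- {i}) (\<lambda>k. \<i> * A_coord i m u k) = (\<lambda>k. \<i> * A_coord i m (MV_on (- {i}) u) k)"
      by (rule sym, rule MV_on_commute[where F = "\<lambda>u k. \<i> * A_coord i m u k"])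
        (rule Delta_A_coord_commute[symmetric], simp)
    then show ?thesis
      using Delta_A_coord_commutator[of i m "MV_on (- {i}) u" n] MV_split[of _ i] by metis
  qed
  moreover have "MV (\<lambda>k. \<i> * A_sum m u k) n = (\<Sum>i\<in>UNIV. MV (\<lambda>k. \<i> * A_coord i m u k) n)"
    using laurent_linear_sum[OF laurent_MV, of UNIV "\<lambda>i. 1" "\<lambda>i k. \<i> * A_coord i m u k"]
    by (simp add: A_sum_def sum_distrib_left)
  ultimately show ?thesis
    by (simp add: A_sum_def commutator_def sum_distrib_left flip: sum_subtractf)
qed

lemma laurent_commutator: "laurent (commutator m :: (int^'d::finite) oper) (\<lambda>\<theta>. complex_of_real (commutator_symbol m \<theta>))"
proof -
  have coord: "laurent (commutator_coord i (int m)) (\<lambda>\<theta>. complex_of_real (sin (real m * \<theta> i) * sin (\<theta> i)))" for i :: 'd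
  proof -
    have "laurent (commutator_coord i (int m))
      (\<lambda>\<theta>. - (1/4) * ((cis (- (of_int (int m + 1) * \<theta> i)) + cis (- (of_int (- int m - 1) * \<theta> i)))
        - (cis (- (of_int (int m - 1) * \<theta> i)) + cis (- (of_int (1 - int m) * \<theta> i)))))"
      unfolding commutator_coord_def[abs_def]
      by (intro laurent_scale laurent_diff laurent_add laurent.shift)
    moreover have "- (1/4) * ((cis (- (of_int (int m + 1) * t)) + cis (- (of_int (- int m - 1) * t)))
        - (cis (- (of_int (int m - 1) * t)) + cis (- (of_int (1 - int m) * t))))
      = complex_of_real (sin (real m * t) * sin t)" for t
      by (simp add: complex_eq_iff distrib_right left_diff_distrib cos_add cos_diff sin_add sin_diff)
    ultimately show ?thesis by (simp only:)
  qed
  have "laurent (\<lambda>(u :: int^'d \<Rightarrow> complex) n. \<Sum>i\<in>UNIV. commutator_coord i (int m) (MV_on (- {i}) u) n)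
     (\<lambda>\<theta>. \<Sum>i\<in>UNIV. complex_of_real (sin (real m * \<theta> i) * sin (\<theta> i)) * complex_of_real (\<Prod>l\<in>- {i}. cos (\<theta> l)))"
    by (intro laurent_sum laurent.comp[OF coord laurent_MV_on])
  then show ?thesis by (simp add: commutator_def[abs_def] commutator_symbol_def)
qed

lemma abs_commutator_symbol_le: "\<bar>commutator_symbol m (\<theta> :: 'd::finite \<Rightarrow> real)\<bar> \<le> real CARD('d)"
proof -
  have "\<bar>sin (real m * \<theta> i) * sin (\<theta> i) * (\<Prod>l\<in>- {i}. cos (\<theta> l))\<bar> \<le> 1 * 1 * 1" for i
    unfolding abs_mult abs_prod by (intro mult_mono prod_le_1) (auto intro: prod_nonneg)
  then have "\<bar>commutator_symbol m \<theta>\<bar> \<le> (\<Sum>i\<in>(UNIV :: 'd set). 1)"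
    unfolding commutator_symbol_def by (intro order_trans[OF sum_abs] sum_mono) simp
  then show ?thesis by simp
qed

section \<open>Infinite linear combinations\<close>

lemma A_comb_core_subset: "A_comb_core \<kappa> \<rho> \<subseteq> A_comb \<kappa> \<rho>"
proof (safe)
  fix u f assume "(u, f) \<in> A_comb_core \<kappa> \<rho>"
  then have "finsupp u" "ell2 f" and core: "\<forall>k :: nat. (u, f) \<in> A_comb_core \<kappa> \<rho>"
    by (auto simp: A_comb_core_def ell2_lim_def)
  then have "(\<forall>k :: nat. ((\<lambda>k. u) k, (\<lambda>k. f) k) \<in> A_comb_core \<kappa> \<rho>) \<and> ell2_lim (\<lambda>k. u) u \<and> ell2_lim (\<lambda>k. f) f"
    by (simp add: ell2_lim_const finsupp_ell2)
  then show "(u, f) \<in> A_comb \<kappa> \<rho>"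
    unfolding A_comb_def graph_closure_def mem_Collect_eq case_prod_conv
    by (intro exI[of _ "\<lambda>k. u"] exI[of _ "\<lambda>k. f"])
qed

lemma A_sum_delta:
  fixes i :: "'d::finite"
  assumes "0 < m" "0 < p"
  shows "A_sum m (delta 0) (axis i (int p)) = (if m = p then of_nat m / (4 * \<i>) else 0)"
proof -
  have d: "delta 0 (axis i (int p) - axis l b) = (if l = i \<and> b = int p then 1 else 0)" for l b
    using assms(2) by (auto simp: delta_def axis_def vec_eq_iff)
  have "A_coord l m (delta 0) (axis i (int p)) = (if l = i \<and> m = p then of_nat m / (4 * \<i>) else 0)" for l
  proof -
    have "axis i (int p) $ l = (if l = i then int p else 0)" by (simp add: axis_def)
    then show ?thesis using assms by (auto simp: A_coord_eq d)
  qed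
  then show ?thesis by (simp add: A_sum_def)
qed

text \<open>The combination must be defined at \<open>delta 0\<close>, and its value there has the entries
  \<open>j \<kappa> \<rho> j / (4 \<i>)\<close>. Hence \<open>j \<rho> j\<close> is square-summable, and so is \<open>1 / j\<close>.\<close>

lemma coefficients_summable:
  assumes dom: "{u. finsupp u} \<subseteq> Domain (A_comb_core \<kappa> \<rho> :: (int^'d::finite) graph)" and \<kappa>: "0 < \<kappa>"
  shows "summable (\<lambda>j. \<bar>\<rho> (Suc j)\<bar>)"
proof -
  have "delta (0 :: int^'d) \<in> {u. finsupp u}" by simp
  then obtain f where "(delta (0 :: int^'d), f) \<in> A_comb_core \<kappa> \<rho>" using dom by blast
  then have f: "ell2_lim (\<lambda>k n. \<Sum>j=1..k. complex_of_real (\<rho> j) * A_sum (j * \<kappa>) (delta (0 :: int^'d)) n) f"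
    unfolding A_comb_core_def by blast
  then have ellf: "ell2 f" by (simp add: ell2_lim_def)
  fix i :: 'd
  let ?x = "\<lambda>j. axis i (int (Suc j * \<kappa>))"
  have val: "f (?x j) = complex_of_real (\<rho> (Suc j)) * (of_nat (Suc j * \<kappa>) / (4 * \<i>))" for j
  proof -
    have "eventually (\<lambda>k. (\<Sum>j'=1..k. complex_of_real (\<rho> j') * A_sum (j' * \<kappa>) (delta 0) (?x j))
        = complex_of_real (\<rho> (Suc j)) * (of_nat (Suc j * \<kappa>) / (4 * \<i>))) sequentially"
      using eventually_ge_at_top[of "Suc j"]
    proof eventually_elim
      case (elim k)
      have "(\<Sum>j'=1..k. complex_of_real (\<rho> j') * A_sum (j' * \<kappa>) (delta 0) (?x j))
          = (\<Sum>j'=1..k. if j' = Suc j then complex_of_real (\<rho> (Suc j)) * (of_nat (Suc j * \<kappa>) / (4 * \<i>)) else 0)"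
        using \<kappa> by (intro sum.cong refl) (subst A_sum_delta, auto simp del: mult_Suc)
      then show ?case using elim by simp
    qed
    then show ?thesis
      using LIMSEQ_unique[OF ell2_lim_pointwise[OF f, of "?x j"] tendsto_eventually] by simp
  qed
  have sq: "(real (Suc j) * \<rho> (Suc j))\<^sup>2 \<le> 16 * (cmod (f (?x j)))\<^sup>2" for j
  proof -
    have "(cmod (f (?x j)))\<^sup>2 = (real (Suc j) * \<rho> (Suc j))\<^sup>2 * (real \<kappa>)\<^sup>2 / 16"
      unfolding val by (simp only: norm_mult norm_divide norm_of_real norm_of_nat norm_ii of_nat_mult power_mult_distrib power_divide)
        (simp del: of_nat_Suc add: power_mult_distrib)
    moreover have "1 \<le> (real \<kappa>)\<^sup>2" using \<kappa> by (simp add: Suc_le_eq one_le_power)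
    then have "(real (Suc j) * \<rho> (Suc j))\<^sup>2 * 1 \<le> (real (Suc j) * \<rho> (Suc j))\<^sup>2 * (real \<kappa>)\<^sup>2"
      by (intro mult_left_mono) auto
    ultimately show ?thesis by simp
  qed
  have inj: "inj ?x"
  proof (rule injI)
    fix a b assume "?x a = ?x b"
    then have "?x a $ i = ?x b $ i" by simp
    then show "a = b" using \<kappa> by (simp add: axis_def)
  qed
  \<comment> \<open>The points \<open>?x j\<close> are distinct, so these squares are dominated by the norm of \<open>f\<close>.\<close>
  have "summable (\<lambda>j. (real (Suc j) * \<rho> (Suc j))\<^sup>2)"
  proof (rule summableI_nonneg_bounded)
    fix N
    have "(\<Sum>j<N. (real (Suc j) * \<rho> (Suc j))\<^sup>2) \<le> (\<Sum>j<N. 16 * (cmod (f (?x j)))\<^sup>2)"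
      by (intro sum_mono sq)
    also have "\<dots> = 16 * (\<Sum>n\<in>?x ` {..<N}. (cmod (f n))\<^sup>2)"
      using inj by (subst sum.reindex) (auto intro: inj_on_subset simp: sum_distrib_left)
    also have "\<dots> \<le> 16 * (ell2_norm f)\<^sup>2"
      using ell2_sum_le_norm[OF ellf, of "?x ` {..<N}"] by simp
    finally show "(\<Sum>j<N. (real (Suc j) * \<rho> (Suc j))\<^sup>2) \<le> 16 * (ell2_norm f)\<^sup>2" .
  qed auto
  moreover have "summable (\<lambda>j. inverse ((real (Suc j))\<^sup>2))"
    using inverse_power_summable[of 2, where 'a = real] by (subst summable_Suc_iff) simp
  ultimately have sum: "summable (\<lambda>j. ((real (Suc j) * \<rho> (Suc j))\<^sup>2 + inverse ((real (Suc j))\<^sup>2)) / 2)"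
    by (intro summable_divide summable_add)
  show ?thesis
  proof (rule summable_comparison_test'[OF sum])
    fix j :: nat
    let ?a = "real (Suc j) * \<bar>\<rho> (Suc j)\<bar>" and ?b = "inverse (real (Suc j))"
    have "\<bar>\<rho> (Suc j)\<bar> = ?a * ?b" by simp
    also have "\<dots> \<le> (?a\<^sup>2 + ?b\<^sup>2) / 2" using sum_squares_bound[of ?a ?b] by simp
    finally show "norm \<bar>\<rho> (Suc j)\<bar> \<le> ((real (Suc j) * \<rho> (Suc j))\<^sup>2 + inverse ((real (Suc j))\<^sup>2)) / 2"
      by (simp add: power_mult_distrib power_inverse)
  qed
qed

text \<open>Norm convergence of the two series of conjugate operators gives pointwise convergence of the series of
  commutators, which is all that the form at a finitely supported sequence sees.\<close>

lemma commutator_ext_series: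
  fixes C :: "(int^'d::finite) oper"
  assumes dom: "{u. finsupp u} \<subseteq> Domain (A_comb_core \<kappa> \<rho> :: (int^'d) graph)"
    and C: "commutator_ext MV (A_comb \<kappa> \<rho>) C" and u: "finsupp u"
  shows "(\<lambda>j. complex_of_real (\<rho> (Suc j)) * ip u (commutator (Suc j * \<kappa>) u)) sums ip u (C u)"
proof -
  let ?S = "\<lambda>u k n. \<Sum>j=1..k. complex_of_real (\<rho> j) * A_sum (j * \<kappa>) u n"
  have Du: "finsupp (MV u)" by (rule laurent_finsupp[OF laurent_MV u])
  obtain f where f: "(u, f) \<in> A_comb_core \<kappa> \<rho>" using dom u by auto
  obtain g where g: "(MV u, g) \<in> A_comb_core \<kappa> \<rho>" using dom Du by auto
  have lim: "ell2_lim (?S u) f" "ell2_lim (?S (MV u)) g" using f g by (auto simp: A_comb_core_def)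
  have Cu: "C u = (\<lambda>x. MV (\<lambda>y. \<i> * f y) x - \<i> * g x)"
    using C u f g A_comb_core_subset unfolding commutator_ext_def by blast
  have partial: "MV (\<lambda>y. \<i> * ?S u k y) n - \<i> * ?S (MV u) k n
      = (\<Sum>j=1..k. complex_of_real (\<rho> j) * commutator (j * \<kappa>) u n)" for k n
  proof -
    have "MV (\<lambda>y. \<i> * ?S u k y) n = (\<Sum>j=1..k. complex_of_real (\<rho> j) * MV (\<lambda>y. \<i> * A_sum (j * \<kappa>) u y) n)"
      using laurent_linear_sum[OF laurent_MV, of "{1..k}" "\<lambda>j. complex_of_real (\<rho> j)" "\<lambda>j y. \<i> * A_sum (j * \<kappa>) u y"]
      by (simp add: sum_distrib_left mult_ac)
    then show ?thesis
      unfolding MV_A_sum_commutator[symmetric]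
      by (simp add: sum_distrib_left right_diff_distrib sum_subtractf mult_ac)
  qed
  have "(\<lambda>k. MV (\<lambda>y. \<i> * ?S u k y) n - \<i> * ?S (MV u) k n) \<longlonglongrightarrow> C u n" for n
    unfolding Cu
    by (intro tendsto_diff tendsto_mult tendsto_const laurent_pointwise_continuous[OF laurent_MV]
        ell2_lim_pointwise[OF lim(1)] ell2_lim_pointwise[OF lim(2)])
  then have pw: "(\<lambda>k. \<Sum>j=1..k. complex_of_real (\<rho> j) * commutator (j * \<kappa>) u n) \<longlonglongrightarrow> C u n" for n
    unfolding partial .
  let ?U = "{x. u x \<noteq> 0}"
  have fin: "finite ?U" using u by (simp add: finsupp_def)
  have form: "ip u v = (\<Sum>n\<in>?U. cnj (u n) * v n)" for v
    using fin by (intro ip_finsupp_left) auto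
  have "(\<lambda>k. \<Sum>n\<in>?U. cnj (u n) * (\<Sum>j=1..k. complex_of_real (\<rho> j) * commutator (j * \<kappa>) u n)) \<longlonglongrightarrow> ip u (C u)"
    unfolding form by (intro tendsto_sum tendsto_mult tendsto_const pw)
  moreover have "(\<Sum>n\<in>?U. cnj (u n) * (\<Sum>j=1..k. complex_of_real (\<rho> j) * commutator (j * \<kappa>) u n))
      = (\<Sum>j<k. complex_of_real (\<rho> (Suc j)) * ip u (commutator (Suc j * \<kappa>) u))" for k
  proof -
    have "(\<Sum>n\<in>?U. cnj (u n) * (\<Sum>j=1..k. complex_of_real (\<rho> j) * commutator (j * \<kappa>) u n))
        = (\<Sum>j=1..k. complex_of_real (\<rho> j) * ip u (commutator (j * \<kappa>) u))"
      unfolding form sum_distrib_left by (subst sum.swap) (simp add: mult_ac)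
    also have "\<dots> = (\<Sum>j<k. complex_of_real (\<rho> (Suc j)) * ip u (commutator (Suc j * \<kappa>) u))"
      using sum.shift_bounds_Suc_ivl[of "\<lambda>j. complex_of_real (\<rho> j) * ip u (commutator (j * \<kappa>) u)" 0 k]
      by (simp add: atLeastLessThanSuc_atLeastAtMost lessThan_atLeast0)
    finally show ?thesis .
  qed
  ultimately show ?thesis by (simp add: sums_def)
qed

section \<open>A necessary condition for the Mourre estimate\<close>

text \<open>If the part \<open>q\<close> of \<open>u\<close> that the projection removes is small, the estimate passes from \<open>P u\<close> to \<open>u\<close> up to
  an error of order \<open>\<parallel>u\<parallel> \<parallel>q\<parallel>\<close>.\<close>

lemma Mourre_form_lower_bound:
  assumes P: "orth_projection P" and C: "bounded_oper C"
    and le: "oper_le (\<lambda>u n. complex_of_real \<gamma> * P u n) (\<lambda>u. P (C (P u)))"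
    and K: "0 \<le> K" "\<And>u. ell2 u \<Longrightarrow> ell2_norm (C u) \<le> K * ell2_norm u" and u: "ell2 u"
  defines "q \<equiv> \<lambda>x. u x - P u x"
  shows "\<gamma> * ((ell2_norm u)\<^sup>2 - (ell2_norm q)\<^sup>2) - 2 * K * ell2_norm u * ell2_norm q \<le> Re (ip u (C u))"
proof -
  have bP: "bounded_oper P" and idem: "P (P u) = P u" and sym: "\<And>v. ell2 v \<Longrightarrow> ip (P u) v = ip u (P v)"
    using P u by (auto simp: orth_projection_def)
  let ?w = "P u"
  have w: "ell2 ?w" and q: "ell2 q" and Cw: "ell2 (C ?w)" and Cq: "ell2 (C q)"
    using bounded_oper_ell2[OF bP] bounded_oper_ell2[OF C] u ell2_diff[of u "P u"] by (auto simp: q_def)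
  have uwq: "u = (\<lambda>x. ?w x + q x)" by (simp add: q_def)
  have "ip ?w u = ip ?w ?w" using sym[OF u] sym[OF w] idem by simp
  then have orth: "ip ?w q = 0" unfolding q_def using w u by (simp add: ip_diff_right)
  have pyth: "(ell2_norm u)\<^sup>2 = (ell2_norm ?w)\<^sup>2 + (ell2_norm q)\<^sup>2"
    using norm_add_Pythagoras[OF w q orth] uwq by metis
  then have "(ell2_norm ?w)\<^sup>2 \<le> (ell2_norm u)\<^sup>2" by simp
  then have w_le: "ell2_norm ?w \<le> ell2_norm u" by (rule power2_le_imp_le) simp
  have PCw: "ell2 (P (C ?w))" using bounded_oper_ell2[OF bP Cw] .
  have "ip u (\<lambda>x. P (C ?w) x - complex_of_real \<gamma> * ?w x) \<in> \<real>\<^sub>\<ge>\<^sub>0"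
    using le u by (simp add: oper_le_def)
  then have "0 \<le> Re (ip u (P (C ?w)) - complex_of_real \<gamma> * ip u ?w)"
    using u w PCw by (simp add: ip_diff_right ell2_scale ip_scale_right complex_nonneg_Reals_iff)
  moreover have "ip u (P (C ?w)) = ip ?w (C ?w)" using sym[OF Cw] by simp
  moreover have "ip u ?w = complex_of_real ((ell2_norm ?w)\<^sup>2)" using sym[OF w] idem ip_self[OF w] by simp
  ultimately have main: "\<gamma> * (ell2_norm ?w)\<^sup>2 \<le> Re (ip ?w (C ?w))" by simp
  have "C u = (\<lambda>x. C ?w x + C q x)" using bounded_oper_add[OF C w q] uwq by metis
  then have "ip u (C u) = ip u (C ?w) + ip u (C q)" using u Cw Cq by (simp add: ip_add_right)
  moreover have "ip u (C ?w) = ip ?w (C ?w) + ip q (C ?w)"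
    using ip_add_left[OF w q Cw] uwq by metis
  ultimately have eq: "Re (ip u (C u)) = Re (ip ?w (C ?w)) + Re (ip q (C ?w)) + Re (ip u (C q))" by simp
  have "cmod (ip q (C ?w)) \<le> ell2_norm q * (K * ell2_norm u)"
    using ip_Cauchy_Schwarz[OF q Cw] K(2)[OF w] mult_left_mono[OF w_le K(1)]
    by (meson ell2_norm_nonneg mult_left_mono order_trans)
  moreover have "cmod (ip u (C q)) \<le> ell2_norm u * (K * ell2_norm q)"
    using ip_Cauchy_Schwarz[OF u Cq] K(2)[OF q]
    by (meson ell2_norm_nonneg mult_left_mono order_trans)
  moreover have "2 * K * ell2_norm u * ell2_norm q = ell2_norm q * (K * ell2_norm u) + ell2_norm u * (K * ell2_norm q)"
    by simp
  moreover have "(ell2_norm u)\<^sup>2 - (ell2_norm q)\<^sup>2 = (ell2_norm ?w)\<^sup>2" using pyth by simp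
  ultimately show ?thesis
    using main eq abs_Re_le_cmod[of "ip q (C ?w)"] abs_Re_le_cmod[of "ip u (C q)"] by (simp only:)
qed

text \<open>The lower bound is applied to truncated plane waves on the level set of \<open>E\<close>, divided by their squared
  norm. The form becomes the series of symbols by Tannery's theorem, whose majorant comes from the
  summability of the coefficients and the uniform bound on the symbols.\<close>

theorem mu_set_symbol_positive:
  assumes E: "E \<in> mu_set TYPE('d::finite) \<kappa>" and \<kappa>: "0 < \<kappa>"
  obtains \<rho> where "summable (\<lambda>j. \<bar>\<rho> (Suc j)\<bar>)"
    "\<And>\<theta> :: 'd \<Rightarrow> real. (\<Prod>i\<in>UNIV. cos (\<theta> i)) = E \<Longrightarrow> 0 < (\<Sum>j. \<rho> (Suc j) * commutator_symbol (Suc j * \<kappa>) \<theta>)"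
proof -
  obtain \<rho> and C :: "(int^'d) oper" and P a b \<gamma>
    where dom: "{u. finsupp u} \<subseteq> Domain (A_comb_core \<kappa> \<rho> :: (int^'d) graph)"
      and C: "commutator_ext MV (A_comb \<kappa> \<rho>) C" and P: "spectral_measure MV P"
      and ab: "a < E" "E < b" and \<gamma>: "0 < \<gamma>"
      and le: "oper_le (\<lambda>u n. complex_of_real \<gamma> * P {a<..<b} u n) (\<lambda>u. P {a<..<b} (C (P {a<..<b} u)))"
    using E unfolding mu_set_def admissible_def by blast
  have sum: "summable (\<lambda>j. \<bar>\<rho> (Suc j)\<bar>)" by (rule coefficients_summable[OF dom \<kappa>])
  have bC: "bounded_oper C" using C by (simp add: commutator_ext_def)
  obtain K where K: "0 \<le> K" "\<And>u. ell2 u \<Longrightarrow> ell2_norm (C u) \<le> K * ell2_norm u"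
    using bounded_oper_bound[OF bC] by blast
  have proj: "orth_projection (P {a<..<b})" using P by (auto simp: spectral_measure_def)
  have "0 < (\<Sum>j. \<rho> (Suc j) * commutator_symbol (Suc j * \<kappa>) \<theta>)"
    if \<theta>: "(\<Prod>i\<in>UNIV. cos (\<theta> i)) = E" for \<theta> :: "'d \<Rightarrow> real"
  proof -
    let ?u = "plane_wave \<theta>" and ?N = "\<lambda>R. ell2_norm (plane_wave \<theta> R)"
    let ?q = "\<lambda>R x. ?u R x - P {a<..<b} (?u R) x"
    let ?a = "\<lambda>j R. \<rho> (Suc j) * (Re (ip (?u R) (commutator (Suc j * \<kappa>) (?u R))) / (?N R)\<^sup>2)"
    have lim: "(\<lambda>R. ?a j R) \<longlonglongrightarrow> \<rho> (Suc j) * commutator_symbol (Suc j * \<kappa>) \<theta>" for j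
    proof -
      have "(\<lambda>R. Re (ip (?u R) (commutator (Suc j * \<kappa>) (?u R)) / complex_of_real ((?N R)\<^sup>2)))
          \<longlonglongrightarrow> Re (complex_of_real (commutator_symbol (Suc j * \<kappa>) \<theta>))"
        by (intro tendsto_Re laurent_form_plane_wave[OF laurent_commutator])
      then show ?thesis by (intro tendsto_mult tendsto_const) (simp only: Re_divide_of_real Re_complex_of_real)
    qed
    have bound: "norm (?a j R) \<le> \<bar>\<rho> (Suc j)\<bar> * real CARD('d)" for j R
    proof -
      let ?z = "ip (?u R) (commutator (Suc j * \<kappa>) (?u R))"
      have "ell2_norm (commutator (Suc j * \<kappa>) (?u R)) \<le> real CARD('d) * ?N R"
        using abs_commutator_symbol_le by (intro laurent_norm_bound[OF laurent_commutator]) simp_all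
      then have "cmod ?z \<le> ?N R * (real CARD('d) * ?N R)"
        using ip_Cauchy_Schwarz[OF ell2_plane_wave laurent_ell2[OF laurent_commutator ell2_plane_wave]]
        by (meson ell2_norm_nonneg mult_left_mono order_trans)
      then have "\<bar>Re ?z\<bar> \<le> real CARD('d) * (?N R)\<^sup>2"
        using abs_Re_le_cmod[of ?z] by (simp add: power2_eq_square mult_ac)
      then have "\<bar>Re ?z / (?N R)\<^sup>2\<bar> \<le> real CARD('d)"
        by (cases "?N R = 0") (auto simp: divide_le_eq less_le)
      then show ?thesis by (simp only: real_norm_def abs_mult) (intro mult_left_mono, auto)
    qed
    have tannery: "(\<lambda>R. \<Sum>j. ?a j R) \<longlonglongrightarrow> (\<Sum>j. \<rho> (Suc j) * commutator_symbol (Suc j * \<kappa>) \<theta>)"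
    proof -
      have "eventually (\<lambda>(j, R). norm (?a j R) \<le> \<bar>\<rho> (Suc j)\<bar> * real CARD('d)) (sequentially \<times>\<^sub>F sequentially)"
        by (rule always_eventually) (simp only: split_paired_All case_prod_conv bound simp_thms)
      from tannerys_theorem[where a = ?a, OF lim this summable_mult2[OF sum] sequentially_bot]
      show ?thesis by blast
    qed
    have form: "(\<Sum>j. ?a j R) = Re (ip (?u R) (C (?u R))) / (?N R)\<^sup>2" for R
    proof -
      have "(\<lambda>j. Re (complex_of_real (\<rho> (Suc j)) * ip (?u R) (commutator (Suc j * \<kappa>) (?u R))))
          sums Re (ip (?u R) (C (?u R)))"
        using commutator_ext_series[OF dom C finsupp_plane_wave] by (rule sums_Re)
      then have "(\<lambda>j. Re (complex_of_real (\<rho> (Suc j)) * ip (?u R) (commutator (Suc j * \<kappa>) (?u R))) / (?N R)\<^sup>2)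
          sums (Re (ip (?u R) (C (?u R))) / (?N R)\<^sup>2)" by (rule sums_divide)
      then show ?thesis by (intro sums_unique[symmetric]) simp
    qed
    let ?d = "\<lambda>R. ell2_norm (?q R) / ?N R"
    have d0: "?d \<longlonglongrightarrow> 0"
    proof (rule null_sequence_if_norm_le)
      let ?c = "1 / (b - E) + 1 / (E - a)"
      let ?r = "\<lambda>R. ell2_norm (\<lambda>x. MV (?u R) x - complex_of_real E * ?u R x) / ?N R"
      have "?r \<longlonglongrightarrow> 0" using laurent_plane_wave[OF laurent_MV, of \<theta>] unfolding \<theta> .
      then show "(\<lambda>R. ?c * ?r R) \<longlonglongrightarrow> 0" by (rule tendsto_mult_right_zero)
      show "norm (?d R) \<le> ?c * ?r R" for R
        using spectral_projection_approx_eigenvector[OF laurent_bounded[OF laurent_MV] P ell2_plane_wave ab, of \<theta> R]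
        by (simp add: divide_right_mono)
    qed
    have "(\<lambda>R. \<gamma> * (1 - (?d R)\<^sup>2) - 2 * K * ?d R) \<longlonglongrightarrow> \<gamma> * (1 - 0\<^sup>2) - 2 * K * 0"
      by (intro tendsto_intros d0)
    then have "\<gamma> * (1 - 0\<^sup>2) - 2 * K * 0 \<le> (\<Sum>j. \<rho> (Suc j) * commutator_symbol (Suc j * \<kappa>) \<theta>)"
    proof (rule LIMSEQ_le[OF _ tannery])
      have "\<gamma> * (1 - (?d R)\<^sup>2) - 2 * K * ?d R \<le> (\<Sum>j. ?a j R)" if "1 \<le> R" for R
      proof -
        have N: "0 < ?N R" using plane_wave_nonzero[of R \<theta>] that by linarith
        have "\<gamma> * (1 - (?d R)\<^sup>2) - 2 * K * ?d R
            = (\<gamma> * ((?N R)\<^sup>2 - (ell2_norm (?q R))\<^sup>2) - 2 * K * ?N R * ell2_norm (?q R)) / (?N R)\<^sup>2"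
          using N by (simp add: field_simps power2_eq_square)
        then show ?thesis unfolding form
          using Mourre_form_lower_bound[OF proj bC le K ell2_plane_wave, of \<theta> R] by (simp add: divide_right_mono)
      qed
      then show "\<exists>N. \<forall>R\<ge>N. \<gamma> * (1 - (?d R)\<^sup>2) - 2 * K * ?d R \<le> (\<Sum>j. ?a j R)" by blast
    qed
    then show ?thesis using \<gamma> by simp
  qed
  with sum show ?thesis using that by blast
qed

section \<open>Essential self-adjointness of the conjugate operators\<close>

lemma ip_translate:
  fixes u v :: "'a::ab_group_add \<Rightarrow> complex"
  shows "ip v (\<lambda>n. c n * u (n - a)) = ip (\<lambda>n. cnj (c (n + a)) * v (n + a)) u"
proof -
  have "bij (\<lambda>n :: 'a. n + a)" by (rule bij_betw_byWitness[where f' = "\<lambda>n. n - a"]) auto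
  from infsum_reindex_bij_betw[OF this, of "\<lambda>n. cnj (v n) * (c n * u (n - a))"]
  show ?thesis by (simp add: ip_def mult_ac)
qed

text \<open>With \<open>\<alpha> n = (2 n\<^sub>i - m) / (4 \<i>)\<close> the operator is \<open>u \<mapsto> \<alpha> u(\<cdot> - m e\<^sub>i) - \<alpha>(\<cdot> + m e\<^sub>i) u(\<cdot> + m e\<^sub>i)\<close>.
  The translations exchange the two terms, and \<open>\<alpha>\<close> is purely imaginary.\<close>

definition A_coeff :: "'d::finite \<Rightarrow> nat \<Rightarrow> int^'d \<Rightarrow> complex" where
  "A_coeff i m n = of_int (2 * n $ i - int m) / (4 * \<i>)"

lemma minus_axis_minus: "n - axis i (- b) = n + axis i b" for n :: "int^'d::finite"
  by (auto simp: vec_eq_iff axis_def)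

lemma A_coord_coeff:
  "A_coord i m u n = A_coeff i m n * u (n - axis i (int m)) - A_coeff i m (n + axis i (int m)) * u (n + axis i (int m))"
proof -
  have "(n + axis i (int m)) $ i = n $ i + int m" by (simp add: axis_def)
  then show ?thesis by (simp only: A_coord_eq A_coeff_def minus_axis_minus) (simp add: field_simps)
qed

lemma cnj_A_coeff: "cnj (A_coeff i m n) = - A_coeff i m n"
  by (simp add: A_coeff_def)

lemma finsupp_translate: "finsupp u \<Longrightarrow> finsupp (\<lambda>n :: int^'d::finite. c n * u (n - axis i b))"
  using laurent_finsupp[OF laurent.shift, of u i b] unfolding finsupp_def shift_def
  by (rule finite_subset[rotated]) auto

lemma finsupp_translate': "finsupp u \<Longrightarrow> finsupp (\<lambda>n :: int^'d::finite. c n * u (n + axis i b))"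
  using finsupp_translate[of u c i "- b"] by (simp only: minus_axis_minus)

lemma finsupp_A_coord: "finsupp u \<Longrightarrow> finsupp (A_coord i m u)"
  using finsupp_lincomb[OF finsupp_translate finsupp_translate', of u u 1 "A_coeff i m" i "int m" "-1"
      "\<lambda>n. A_coeff i m (n + axis i (int m))" i "int m"]
  by (simp add: A_coord_coeff[abs_def])

lemma finsupp_A_sum: "finsupp u \<Longrightarrow> finsupp (A_sum m u)"
  unfolding A_sum_def[abs_def] by (intro finsupp_sum finsupp_A_coord) simp_all

lemma A_sum_symmetric:
  assumes v: "finsupp v"
  shows "ip v (A_sum m u) = ip (A_sum m v) u"
proof -
  have "ip v (A_coord i m u) = ip (A_coord i m v) u" for i
  proof -
    let ?a = "axis i (int m)" and ?\<alpha> = "A_coeff i m"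
    have 1: "ip v (\<lambda>n. ?\<alpha> n * u (n - ?a)) = ip (\<lambda>n. (-1) * (?\<alpha> (n + ?a) * v (n + ?a))) u"
      unfolding ip_translate by (simp add: cnj_A_coeff)
    have 2: "ip v (\<lambda>n. ?\<alpha> (n + ?a) * u (n + ?a)) = ip (\<lambda>n. (-1) * (?\<alpha> n * v (n - ?a))) u"
      using ip_translate[of v "\<lambda>n. ?\<alpha> (n + ?a)" u "- ?a"] by (simp add: cnj_A_coeff)
    have "ip v (A_coord i m u) = ip v (\<lambda>n. ?\<alpha> n * u (n - ?a)) - ip v (\<lambda>n. ?\<alpha> (n + ?a) * u (n + ?a))"
      unfolding A_coord_coeff[abs_def] by (rule ip_finsupp_diff_right[OF v])
    also have "\<dots> = ip (\<lambda>n. ?\<alpha> n * v (n - ?a)) u - ip (\<lambda>n. ?\<alpha> (n + ?a) * v (n + ?a)) u"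
      unfolding 1 2 ip_scale_left by simp
    also have "\<dots> = ip (A_coord i m v) u"
      unfolding A_coord_coeff[abs_def]
      by (rule ip_finsupp_diff_left[symmetric]) (intro finsupp_translate finsupp_translate' v)+
    finally show ?thesis .
  qed
  moreover have "ip v (A_sum m u) = (\<Sum>i\<in>UNIV. ip v (A_coord i m u))"
    unfolding A_sum_def[abs_def] by (rule ip_finsupp_sum_right[OF v])
  moreover have "ip (A_sum m v) u = (\<Sum>i\<in>UNIV. ip (A_coord i m v) u)"
    unfolding A_sum_def[abs_def] by (rule ip_finsupp_sum_left) (simp_all add: finsupp_A_coord v)
  ultimately show ?thesis by simp
qed

lemma A_sum_pointwise_lim:
  assumes "\<And>n. (\<lambda>k. U k n) \<longlonglongrightarrow> u n"
  shows "(\<lambda>k. A_sum m (U k) n) \<longlonglongrightarrow> A_sum m u n"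
  unfolding A_sum_def A_coord_coeff by (intro tendsto_intros assms)

definition cutoff :: "nat \<Rightarrow> int^'d::finite \<Rightarrow> real" where
  "cutoff k n = max 0 (1 - (\<Sum>i\<in>UNIV. \<bar>of_int (n $ i)\<bar>) / real (Suc k))"

lemma cutoff_range: "0 \<le> cutoff k n" "cutoff k n \<le> 1"
  by (simp_all add: cutoff_def sum_nonneg)

lemma cutoff_lim: "(\<lambda>k. cutoff k n) \<longlonglongrightarrow> 1"
proof -
  let ?r = "\<Sum>i\<in>UNIV. \<bar>real_of_int (n $ i)\<bar>"
  have "(\<lambda>k. max 0 (1 - ?r / real (Suc k))) \<longlonglongrightarrow> max 0 (1 - 0)"
    by (intro tendsto_max tendsto_diff tendsto_const LIMSEQ_Suc[OF lim_const_over_n])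
  then show ?thesis by (simp add: cutoff_def)
qed

lemma finsupp_cutoff: "finsupp (\<lambda>n. complex_of_real (cutoff k n) * v n)"
  unfolding finsupp_def
proof (rule finite_subset)
  show "finite {n :: int^'a. \<forall>j. n $ j \<in> {- int (Suc k)..int (Suc k)}}"
    by (intro card_vec_box(1)) simp
  show "{n. complex_of_real (cutoff k n) * v n \<noteq> 0} \<subseteq> {n :: int^'a. \<forall>j. n $ j \<in> {- int (Suc k)..int (Suc k)}}"
  proof (safe)
    fix n :: "int^'a" and j
    assume "complex_of_real (cutoff k n) * v n \<noteq> 0"
    then have "cutoff k n \<noteq> 0" by auto
    then have "(\<Sum>i\<in>UNIV. \<bar>real_of_int (n $ i)\<bar>) < real (Suc k)"
      by (auto simp: cutoff_def max_def field_simps split: if_splits)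
    moreover have "\<bar>real_of_int (n $ j)\<bar> \<le> (\<Sum>i\<in>UNIV. \<bar>real_of_int (n $ i)\<bar>)"
      by (rule member_le_sum) auto
    ultimately have "\<bar>n $ j\<bar> \<le> int (Suc k)" by linarith
    then show "n $ j \<in> {- int (Suc k)..int (Suc k)}" by auto
  qed
qed

text \<open>The cutoff has slope \<open>1 / (k + 1)\<close> and vanishes at distance \<open>k + 1\<close> from the origin, so that its
  increments compensate the linear growth of the coefficients.\<close>

lemma A_coeff_cutoff_bound:
  fixes n n' :: "int^'d::finite"
  assumes n': "n' = n + axis i b" and b: "\<bar>b\<bar> = int m" and c: "c = A_coeff i m n \<or> c = A_coeff i m (n + axis i (int m))"
  shows "cmod c * \<bar>cutoff k n' - cutoff k n\<bar> \<le> (2 + 3 * real m) * real m"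
proof -
  let ?r = "\<lambda>n :: int^'d. \<Sum>i\<in>UNIV. \<bar>real_of_int (n $ i)\<bar>"
  let ?k = "real (Suc k)"
  have diff: "\<bar>?r n' - ?r n\<bar> \<le> real m"
  proof -
    have "\<bar>?r n' - ?r n\<bar> \<le> (\<Sum>j\<in>UNIV. \<bar>\<bar>real_of_int (n' $ j)\<bar> - \<bar>real_of_int (n $ j)\<bar>\<bar>)"
      unfolding sum_subtractf[symmetric] by (rule sum_abs)
    also have "\<dots> \<le> (\<Sum>j\<in>UNIV. if j = i then real m else 0)"
    proof (rule sum_mono)
      fix j
      have "\<bar>real_of_int b\<bar> = real m" using b by linarith
      then show "\<bar>\<bar>real_of_int (n' $ j)\<bar> - \<bar>real_of_int (n $ j)\<bar>\<bar> \<le> (if j = i then real m else 0)"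
        using n' by (auto simp: axis_def)
    qed
    finally show ?thesis by simp
  qed
  have comp: "\<bar>real_of_int (n $ i)\<bar> \<le> ?r n" by (rule member_le_sum) auto
  have cb: "cmod c \<le> 2 * \<bar>real_of_int (n $ i)\<bar> + real m"
  proof -
    have *: "cmod (of_int z / (4 * \<i>)) = \<bar>real_of_int z\<bar> / 4" for z by (simp add: norm_divide norm_mult)
    have "(n + axis i (int m)) $ i = n $ i + int m" by (simp add: axis_def)
    then show ?thesis using c unfolding A_coeff_def by (auto simp only: *) auto
  qed
  have lip: "\<bar>cutoff k n' - cutoff k n\<bar> \<le> real m / ?k"
  proof -
    have "\<bar>cutoff k n' - cutoff k n\<bar> \<le> \<bar>?r n' / ?k - ?r n / ?k\<bar>" unfolding cutoff_def by linarith
    also have "\<dots> = \<bar>?r n' - ?r n\<bar> / ?k" by (simp flip: diff_divide_distrib)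
    also have "\<dots> \<le> real m / ?k" using diff by (intro divide_right_mono) auto
    finally show ?thesis .
  qed
  show ?thesis
  proof (cases "?r n < ?k + real m")
    case True
    have "\<bar>real_of_int (n $ i)\<bar> \<le> ?k + real m" by (rule order_trans[OF comp less_imp_le[OF True]])
    then have "cmod c \<le> 2 * (?k + real m) + real m"
      by (intro order_trans[OF cb] add_right_mono mult_left_mono) simp_all
    also have "\<dots> \<le> ?k * (2 + 3 * real m)"
    proof -
      have "real m * 1 \<le> real m * ?k" by (intro mult_left_mono) auto
      then show ?thesis by (simp add: algebra_simps)
    qed
    finally have "cmod c * \<bar>cutoff k n' - cutoff k n\<bar> \<le> (?k * (2 + 3 * real m)) * (real m / ?k)"
      using lip by (intro mult_mono) auto
    then show ?thesis by (simp del: of_nat_Suc)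
  next
    case False
    then have "cutoff k n = 0" "cutoff k n' = 0"
      using diff by (auto simp: cutoff_def max_def field_simps)
    then show ?thesis by simp
  qed
qed

text \<open>The commutator of \<open>A_sum m\<close> with the cutoff is bounded uniformly in \<open>k\<close>, and it tends to \<open>0\<close> pointwise;
  dominated convergence turns this into convergence in norm.\<close>

lemma cutoff_approximation:
  assumes v: "ell2 v" and Av: "ell2 (A_sum m v)"
  shows "ell2_lim (\<lambda>k. A_sum m (\<lambda>n. complex_of_real (cutoff k n) * v n)) (A_sum m (v :: int^'d::finite \<Rightarrow> complex))"
proof -
  let ?B = "(2 + 3 * real m) * real m"
  let ?a = "\<lambda>i :: 'd. axis i (int m)"
  define w where "w n = cmod (A_sum m v n) + (\<Sum>i\<in>UNIV. ?B * (cmod (v (n - ?a i)) + cmod (v (n + ?a i))))" for n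
  have w: "ell2 (\<lambda>n. complex_of_real (w n))"
  proof -
    have norm: "ell2 u \<Longrightarrow> ell2 (\<lambda>n. complex_of_real (cmod (u n)))" for u :: "int^'d \<Rightarrow> complex"
      by (erule ell2_dominated(1)) simp
    have "ell2 (\<lambda>n. v (n + ?a i))" for i
      using ell2_shift[OF v, of i "- int m"] by (simp only: shift_def minus_axis_minus)
    moreover have "ell2 (\<lambda>n. v (n - ?a i))" for i
      using ell2_shift[OF v, of i "int m"] by (simp add: shift_def)
    ultimately show ?thesis
      unfolding w_def of_real_add of_real_sum of_real_mult[of ?B]
      by (intro ell2_add ell2_sum ell2_scale norm Av) auto
  qed
  have w0: "0 \<le> w n" for n unfolding w_def by (intro add_nonneg_nonneg sum_nonneg) simp_all
  show ?thesis
  proof (rule ell2_dominated_convergence[OF w _ _ Av])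
    show "(\<lambda>k. A_sum m (\<lambda>n. complex_of_real (cutoff k n) * v n) n) \<longlonglongrightarrow> A_sum m v n" for n
    proof (rule A_sum_pointwise_lim)
      fix n
      have "(\<lambda>k. complex_of_real (cutoff k n) * v n) \<longlonglongrightarrow> complex_of_real 1 * v n"
        by (intro tendsto_mult tendsto_of_real tendsto_const cutoff_lim)
      then show "(\<lambda>k. complex_of_real (cutoff k n) * v n) \<longlonglongrightarrow> v n" by simp
    qed
    fix k n
    let ?c = "\<lambda>n. complex_of_real (cutoff k n)"
    let ?e = "\<lambda>i. A_coeff i m n * (complex_of_real (cutoff k (n - ?a i) - cutoff k n) * v (n - ?a i))
      - A_coeff i m (n + ?a i) * (complex_of_real (cutoff k (n + ?a i) - cutoff k n) * v (n + ?a i))"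
    have "A_coord i m (\<lambda>n. ?c n * v n) n = ?c n * A_coord i m v n + ?e i" for i
      by (simp add: A_coord_coeff algebra_simps)
    then have "A_sum m (\<lambda>n. ?c n * v n) n - A_sum m v n = (?c n - 1) * A_sum m v n + (\<Sum>i\<in>UNIV. ?e i)"
      by (simp only: A_sum_def sum.distrib sum_distrib_left[symmetric]) (simp add: left_diff_distrib)
    also have "cmod \<dots> \<le> w n"
      unfolding w_def
    proof (rule norm_triangle_mono)
      have "cmod (?c n - 1) \<le> 1"
      proof -
        have "?c n - 1 = complex_of_real (cutoff k n - 1)" by simp
        then show ?thesis using cutoff_range[of k n] by (simp only: norm_of_real)
      qed
      then show "cmod ((?c n - 1) * A_sum m v n) \<le> cmod (A_sum m v n)"
        unfolding norm_mult by (rule mult_left_le_one_le[OF norm_ge_zero norm_ge_zero])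
      have "cmod (?e i) \<le> ?B * (cmod (v (n - ?a i)) + cmod (v (n + ?a i)))" for i
      proof -
        have m: "n - ?a i = n + axis i (- int m)" by (auto simp: vec_eq_iff axis_def)
        have "cmod (?e i) \<le> cmod (A_coeff i m n) * \<bar>cutoff k (n - ?a i) - cutoff k n\<bar> * cmod (v (n - ?a i))
            + cmod (A_coeff i m (n + ?a i)) * \<bar>cutoff k (n + ?a i) - cutoff k n\<bar> * cmod (v (n + ?a i))"
          by (rule order_trans[OF norm_triangle_ineq4]) (simp only: norm_mult norm_of_real mult.assoc order_refl)
        also have "\<dots> \<le> ?B * cmod (v (n - ?a i)) + ?B * cmod (v (n + ?a i))"
          by (intro add_mono mult_right_mono A_coeff_cutoff_bound[OF m] A_coeff_cutoff_bound[OF refl]) auto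
        finally show ?thesis by (simp add: distrib_left)
      qed
      then show "cmod (\<Sum>i\<in>UNIV. ?e i) \<le> (\<Sum>i\<in>UNIV. ?B * (cmod (v (n - ?a i)) + cmod (v (n + ?a i))))"
        by (intro order_trans[OF norm_sum] sum_mono)
    qed
    also have "w n = cmod (complex_of_real (w n))" using w0 by simp
    finally show "cmod (A_sum m (\<lambda>n. ?c n * v n) n - A_sum m v n) \<le> cmod (complex_of_real (w n))" .
  qed
qed

definition A_graph :: "nat \<Rightarrow> (int^'d::finite) graph" where
  "A_graph m = {(u, A_sum m u) | u. finsupp u}"

text \<open>The closure is the maximal operator: the cutoffs approximate every pair of square-summable sequences
  that satisfies the difference equation.\<close>

lemma closure_A_graph: "graph_closure (A_graph m) = {(v, A_sum m v) | v. ell2 v \<and> ell2 (A_sum m v)}"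
proof (intro equalityI subsetI)
  fix z assume "z \<in> graph_closure (A_graph m :: (int^'a) graph)"
  then obtain u f U F where z: "z = (u, f)" and G: "\<And>k. (U k, F k) \<in> A_graph m" and lim: "ell2_lim U u" "ell2_lim F f"
    by (auto simp: graph_closure_def)
  have F: "F k = A_sum m (U k)" for k using G[of k] by (auto simp: A_graph_def)
  have "f n = A_sum m u n" for n
    using ell2_lim_pointwise[OF lim(2), of n] A_sum_pointwise_lim[OF ell2_lim_pointwise[OF lim(1)], where m = m and n = n]
    unfolding F by (rule LIMSEQ_unique)
  then have "f = A_sum m u" by auto
  then show "z \<in> {(v, A_sum m v) | v. ell2 v \<and> ell2 (A_sum m v)}"
    using z lim by (auto simp: ell2_lim_def)
next
  fix z assume "z \<in> {(v :: int^'a \<Rightarrow> complex, A_sum m v) | v. ell2 v \<and> ell2 (A_sum m v)}"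
  then obtain v where z: "z = (v, A_sum m v)" and v: "ell2 v" "ell2 (A_sum m v)" by blast
  let ?V = "\<lambda>k n. complex_of_real (cutoff k n) * v n"
  have "ell2_lim ?V v"
  proof (rule ell2_dominated_convergence[OF v(1) _ _ v(1)])
    fix k n
    have "?V k n - v n = complex_of_real (cutoff k n - 1) * v n" by (simp add: left_diff_distrib)
    moreover have "\<bar>cutoff k n - 1\<bar> \<le> 1" using cutoff_range[of k n] by simp
    ultimately show "cmod (?V k n - v n) \<le> cmod (v n)"
      by (simp only: norm_mult norm_of_real) (rule mult_left_le_one_le, auto)
  next
    fix n
    have "(\<lambda>k. complex_of_real (cutoff k n) * v n) \<longlonglongrightarrow> complex_of_real 1 * v n"
      by (intro tendsto_mult tendsto_of_real tendsto_const cutoff_lim)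
    then show "(\<lambda>k. ?V k n) \<longlonglongrightarrow> v n" by simp
  qed
  moreover have "(?V k, A_sum m (?V k)) \<in> A_graph m" for k
    unfolding A_graph_def using finsupp_cutoff by blast
  ultimately show "z \<in> graph_closure (A_graph m)"
    unfolding z graph_closure_def mem_Collect_eq case_prod_conv
    using cutoff_approximation[OF v] by (intro exI[of _ ?V] exI[of _ "\<lambda>k. A_sum m (?V k)"]) blast
qed

text \<open>Testing against \<open>delta n\<close> shows that the adjoint acts by the same difference expression, hence is
  contained in the maximal operator.\<close>

theorem self_adjoint_A: "self_adjoint_graph (graph_closure (A_graph m :: (int^'d::finite) graph))"
proof -
  let ?G = "graph_closure (A_graph m :: (int^'d) graph)"
  have "graph_adjoint ?G \<subseteq> ?G"
  proof (safe)
    fix v g assume vg: "(v, g) \<in> graph_adjoint ?G"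
    then have ell: "ell2 v" "ell2 g" by (auto simp: graph_adjoint_def)
    have "g n = A_sum m v n" for n
    proof -
      have "(delta n, A_sum m (delta n)) \<in> ?G"
        unfolding closure_A_graph
        by (intro CollectI exI[of _ "delta n"] conjI refl finsupp_ell2 finsupp_A_sum finsupp_delta)
      then have "ip v (A_sum m (delta n)) = ip g (delta n)"
        using vg by (auto simp: graph_adjoint_def)
      then have "cnj (ip v (A_sum m (delta n))) = cnj (ip g (delta n))" by simp
      then have "ip (A_sum m (delta n)) v = g n" unfolding ip_cnj by simp
      then show ?thesis using A_sum_symmetric[OF finsupp_delta, of n m v] by simp
    qed
    then have "g = A_sum m v" by auto
    then show "(v, g) \<in> ?G" unfolding closure_A_graph using ell by auto
  qed
  moreover have "?G \<subseteq> graph_adjoint ?G"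
  proof (safe)
    fix v g assume vg: "(v, g) \<in> ?G"
    then obtain V F where G: "\<And>k. (V k, F k) \<in> A_graph m" and lim: "ell2_lim V v" "ell2_lim F g"
      by (auto simp: graph_closure_def)
    have V: "finsupp (V k)" "F k = A_sum m (V k)" for k using G[of k] by (auto simp: A_graph_def)
    have "ip v f = ip g u" if "(u, f) \<in> ?G" for u f
    proof -
      have u: "ell2 u" "ell2 f" "f = A_sum m u" using that unfolding closure_A_graph by auto
      have "ip (V k) f = ip (F k) u" for k unfolding V(2) u(3) by (rule A_sum_symmetric[OF V(1)])
      then show ?thesis
        using ell2_lim_ip[OF lim(1) ell2_lim_const[OF u(2)]] ell2_lim_ip[OF lim(2) ell2_lim_const[OF u(1)]]
        by (metis (no_types, lifting) LIMSEQ_unique ext)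
    qed
    then show "(v, g) \<in> graph_adjoint ?G"
      using vg unfolding graph_adjoint_def closure_A_graph by auto
  qed
  moreover have "single_valued ?G" unfolding closure_A_graph by (auto simp: single_valued_def)
  ultimately show ?thesis by (auto simp: self_adjoint_graph_def)
qed

section \<open>A sufficient condition for the Mourre estimate\<close>

abbreviation first_coefficient :: "nat \<Rightarrow> real" where
  "first_coefficient \<equiv> (\<lambda>j. if j = 1 then 1 else 0)"

lemma A_comb_core_first: "A_comb_core \<kappa> first_coefficient = (A_graph \<kappa> :: (int^'d::finite) graph)"
proof -
  let ?S = "\<lambda>(u :: int^'d \<Rightarrow> complex) k n. \<Sum>j=1..k. complex_of_real (first_coefficient j) * A_sum (j * \<kappa>) u n"
  have S: "?S u k n = (if 1 \<le> k then A_sum \<kappa> u n else 0)" for u k n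
  proof -
    have "?S u k n = (\<Sum>j=1..k. if j = 1 then A_sum \<kappa> u n else 0)" by (intro sum.cong) auto
    then show ?thesis by simp
  qed
  have lim: "ell2_lim (?S u) (A_sum \<kappa> u)" if u: "finsupp u" for u
  proof -
    have A: "ell2 (A_sum \<kappa> u)" using u by (intro finsupp_ell2 finsupp_A_sum)
    show ?thesis unfolding S
      by (rule ell2_dominated_convergence[OF A _ _ A])
        (auto intro!: tendsto_eventually eventually_mono[OF eventually_ge_at_top[of 1]])
  qed
  have uniq: "f = A_sum \<kappa> u" if "finsupp u" "ell2_lim (?S u) f" for u f
    using LIMSEQ_unique[OF ell2_lim_pointwise[OF that(2)] ell2_lim_pointwise[OF lim[OF that(1)]]] by auto
  show ?thesis
    unfolding A_comb_core_def A_graph_def using lim uniq by blast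
qed

text \<open>The commutator with the single operator \<open>A_sum \<kappa>\<close> commutes with the spectral projections, so that the
  estimate is an inequality between symbols on the preimage of the interval.\<close>

lemma mu_setI:
  assumes \<theta>: "E = (\<Prod>i\<in>UNIV. cos (\<theta>0 (i :: 'd::finite)))" and ab: "a < E" "E < b" and \<gamma>: "0 < \<gamma>"
    and pos: "\<And>\<theta> :: 'd \<Rightarrow> real. a < (\<Prod>i\<in>UNIV. cos (\<theta> i)) \<Longrightarrow> (\<Prod>i\<in>UNIV. cos (\<theta> i)) < b \<Longrightarrow> \<gamma> \<le> commutator_symbol \<kappa> \<theta>"
  shows "E \<in> mu_set TYPE('d) \<kappa>"
proof -
  let ?p = "\<lambda>\<theta> :: 'd \<Rightarrow> real. \<Prod>i\<in>UNIV. cos (\<theta> i)"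
  let ?P = "spectral_projection ?p" and ?I = "{a<..<b}" and ?C = "commutator \<kappa> :: (int^'d) oper"
  let ?i = "\<lambda>\<theta>. complex_of_real (indicator ?I (?p \<theta>))"
  let ?g = "\<lambda>\<theta> :: 'd \<Rightarrow> real. complex_of_real (commutator_symbol \<kappa> \<theta>)"
  let ?A = "A_comb \<kappa> first_coefficient :: (int^'d) graph"
  have A: "?A = graph_closure (A_graph \<kappa>)" by (simp only: A_comb_def A_comb_core_first)
  obtain K where K: "bounded_symbol K (\<lambda>\<theta>. complex_of_real (?p \<theta>))" using laurent_bounded_symbol[OF laurent_MV] .
  obtain L where L: "bounded_symbol L ?g" using laurent_bounded_symbol[OF laurent_commutator] .
  have i: "bounded_symbol 1 ?i" by (rule bounded_symbol_indicator[OF laurent_MV K]) simp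
  have spec: "complex_of_real E \<in> oper_spectrum (MV :: (int^'d) oper)"
    using laurent_symbol_in_spectrum[OF laurent_MV, of \<theta>0] \<theta> by simp
  have adm: "admissible TYPE('d) \<kappa> first_coefficient"
    using self_adjoint_A[of \<kappa>] unfolding admissible_def A A_comb_core_first by (auto simp: A_graph_def)
  have comm: "commutator_ext MV ?A ?C"
    unfolding commutator_ext_def
  proof (intro conjI allI impI)
    show "bounded_oper ?C" by (rule laurent_bounded[OF laurent_commutator])
    fix u f g assume "(u, f) \<in> ?A" "(MV u, g) \<in> ?A"
    then have "f = A_sum \<kappa> u" "g = A_sum \<kappa> (MV u)" unfolding A closure_A_graph by auto
    then show "?C u = (\<lambda>x. MV (\<lambda>y. \<i> * f y) x - \<i> * g x)" by (simp add: MV_A_sum_commutator)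
  qed
  have le: "oper_le (\<lambda>u n. complex_of_real \<gamma> * ?P ?I u n) (\<lambda>u. ?P ?I (?C (?P ?I u)))"
    unfolding oper_le_def
  proof (intro allI impI)
    fix u :: "int^'d \<Rightarrow> complex" assume u: "ell2 u"
    have I: "?I \<in> sets borel" by simp
    have Pu: "ell2 (?P ?I u)" unfolding spectral_projection_def using mult_bound(1)[OF i u] .
    have "?P ?I (?C (?P ?I u)) = ?C (?P ?I (?P ?I u))"
      using laurent_commutes_mult[OF laurent_commutator i Pu] by (simp add: spectral_projection_def)
    also have "?P ?I (?P ?I u) = ?P ?I u"
      using orth_projection_spectral_projection[OF laurent_MV K I] u by (simp add: orth_projection_def)
    also have "?C (?P ?I u) = mult_op (\<lambda>\<theta>. ?g \<theta> * ?i \<theta>) u"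
      unfolding spectral_projection_def by (rule laurent_comp_mult[OF laurent_commutator i u])
    finally have "(\<lambda>x. ?P ?I (?C (?P ?I u)) x - complex_of_real \<gamma> * ?P ?I u x)
        = mult_op (\<lambda>\<theta>. 1 * (?g \<theta> * ?i \<theta>) + (- complex_of_real \<gamma>) * ?i \<theta>) u"
      unfolding mult_symbol_lincomb[OF bounded_symbol_mult[OF L i] i u] by (simp add: spectral_projection_def)
    also have "\<dots> = mult_op (\<lambda>\<theta>. complex_of_real ((commutator_symbol \<kappa> \<theta> - \<gamma>) * indicator ?I (?p \<theta>))) u"
      by (simp add: algebra_simps)
    finally have eq: "(\<lambda>x. ?P ?I (?C (?P ?I u)) x - complex_of_real \<gamma> * ?P ?I u x)
        = mult_op (\<lambda>\<theta>. complex_of_real ((commutator_symbol \<kappa> \<theta> - \<gamma>) * indicator ?I (?p \<theta>))) u" .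
    have bs: "bounded_symbol ((L + cmod (complex_of_real (- \<gamma>))) * 1) (\<lambda>\<theta>. complex_of_real ((commutator_symbol \<kappa> \<theta> - \<gamma>) * indicator ?I (?p \<theta>)))"
      using bounded_symbol_mult[OF bounded_symbol_add[OF L bounded_symbol_const[of "complex_of_real (- \<gamma>)"]] i] by simp
    show "ip u (\<lambda>x. ?P ?I (?C (?P ?I u)) x - complex_of_real \<gamma> * ?P ?I u x) \<in> \<real>\<^sub>\<ge>\<^sub>0"
      unfolding eq by (rule mult_nonneg[OF bs _ u]) (use pos in \<open>auto simp: indicator_def\<close>)
  qed
  have meas: "spectral_measure MV ?P" by (rule spectral_measure_spectral_projection[OF laurent_MV K])
  show ?thesis
    unfolding mu_set_def mem_Collect_eq
    using spec adm comm meas ab \<gamma> le by blast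
qed

lemma sin_four_times_sin: "sin (4 * t) * sin t = 4 * (1 - (cos t)\<^sup>2) * cos t * (2 * (cos t)\<^sup>2 - 1)" for t :: real
proof -
  have "sin (4 * t) = 2 * (2 * sin t * cos t) * (2 * (cos t)\<^sup>2 - 1)"
    using sin_double[of "2 * t"] sin_double[of t] cos_double_cos[of t] by simp
  then have "sin (4 * t) * sin t = 4 * (sin t)\<^sup>2 * cos t * (2 * (cos t)\<^sup>2 - 1)"
    by (simp only: power2_eq_square) simp
  then show ?thesis by (simp only: sin_squared_eq)
qed

lemma commutator_symbol_4:
  "commutator_symbol 4 \<theta> = 4 * (\<Prod>i\<in>UNIV. cos (\<theta> i)) * (\<Sum>i\<in>UNIV. (1 - (cos (\<theta> i))\<^sup>2) * (2 * (cos (\<theta> i))\<^sup>2 - 1))"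
proof -
  have "(\<Prod>i\<in>UNIV. cos (\<theta> i)) = cos (\<theta> i) * (\<Prod>l\<in>- {i}. cos (\<theta> l))" for i
    unfolding Compl_eq_Diff_UNIV by (rule prod.remove) auto
  then have "sin (real 4 * \<theta> i) * sin (\<theta> i) * (\<Prod>l\<in>- {i}. cos (\<theta> l))
      = 4 * (\<Prod>i\<in>UNIV. cos (\<theta> i)) * ((1 - (cos (\<theta> i))\<^sup>2) * (2 * (cos (\<theta> i))\<^sup>2 - 1))" for i
    using sin_four_times_sin[of "\<theta> i"] by simp
  then show ?thesis unfolding commutator_symbol_def by (simp only: sum_distrib_left)
qed

text \<open>If a product of numbers in \<open>[-1, 1]\<close> exceeds \<open>cos (\<pi>/4)\<close>, so does each factor in modulus; then all
  summands in the symbol of the commutator with \<open>A\<^sub>4\<close> are non-negative, and they vanish together only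
  when all factors have modulus one.\<close>

theorem mu_set_above_cos_pi_quarter: "{cos (pi/4)<..<1} \<subseteq> mu_set TYPE('d::finite) 4"
proof
  fix E :: real assume "E \<in> {cos (pi/4)<..<1}"
  then have E: "cos (pi/4) < E" "E < 1" by auto
  have c: "0 < cos (pi/4 :: real)" "(cos (pi/4 :: real))\<^sup>2 = 1/2" by (simp_all add: cos_45 power_divide)
  define a b where "a = (cos (pi/4) + E) / 2" and "b = (E + 1) / 2"
  have ab: "cos (pi/4) < a" "a < E" "E < b" "b < 1" using E by (auto simp: a_def b_def)
  then have a: "0 < a" "1/2 < a\<^sup>2" using c power_strict_mono[of "cos (pi/4)" a 2] by auto
  have b: "0 < b" "b\<^sup>2 < 1" using ab a by (auto simp: power_less_one_iff abs_square_less_1)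
  define \<gamma> where "\<gamma> = 4 * a * ((1 - b\<^sup>2) * (2 * a\<^sup>2 - 1))"
  have \<gamma>: "0 < \<gamma>" unfolding \<gamma>_def using a b by (intro mult_pos_pos) auto
  fix i0 :: 'd
  have witness: "E = (\<Prod>i\<in>UNIV. cos (if i = i0 then arccos E else 0))"
  proof -
    have "(\<Prod>i\<in>UNIV. cos (if i = i0 then arccos E else 0)) = (\<Prod>i\<in>UNIV. if i = i0 then cos (arccos E) else 1)"
      by (intro prod.cong) auto
    also have "\<dots> = cos (arccos E)" by (subst prod.delta) auto
    also have "\<dots> = E" using E c by (intro cos_arccos) auto
    finally show ?thesis by simp
  qed
  show "E \<in> mu_set TYPE('d) 4"
  proof (rule mu_setI[OF witness ab(2,3) \<gamma>])
    fix \<theta> :: "'d \<Rightarrow> real"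
    let ?p = "\<Prod>i\<in>UNIV. cos (\<theta> i)" and ?z = "\<lambda>i. (cos (\<theta> i))\<^sup>2"
    assume p: "a < ?p" "?p < b"
    have p2: "?p\<^sup>2 = (\<Prod>i\<in>UNIV. ?z i)" by (simp add: prod_power_distrib)
    have z01: "0 \<le> ?z i" "?z i \<le> 1" for i by (simp_all add: abs_square_le_1)
    have z: "a\<^sup>2 \<le> ?z i" for i
    proof -
      have "a\<^sup>2 \<le> ?p\<^sup>2" using p a by (intro power_mono) auto
      also have "\<dots> = ?z i * (\<Prod>l\<in>- {i}. ?z l)"
        unfolding p2 Compl_eq_Diff_UNIV by (rule prod.remove) auto
      also have "\<dots> \<le> ?z i * 1" using z01 by (intro mult_left_mono prod_le_1) auto
      finally show ?thesis by simp
    qed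
    have "1 - b\<^sup>2 \<le> 1 - ?p\<^sup>2" using p a power_mono[of ?p b 2] by auto
    also have "\<dots> \<le> (\<Sum>i\<in>UNIV. 1 - ?z i)"
    proof -
      have "1 - (\<Sum>i\<in>UNIV. 1 - ?z i) \<le> (\<Prod>i\<in>UNIV. 1 - (1 - ?z i))"
        using z01 by (intro Weierstrass_prod_ineq) auto
      then show ?thesis by (simp add: p2)
    qed
    finally have s: "1 - b\<^sup>2 \<le> (\<Sum>i\<in>UNIV. 1 - ?z i)" .
    have "(1 - b\<^sup>2) * (2 * a\<^sup>2 - 1) \<le> (\<Sum>i\<in>UNIV. 1 - ?z i) * (2 * a\<^sup>2 - 1)"
      using s a by (intro mult_right_mono) auto
    also have "\<dots> \<le> (\<Sum>i\<in>UNIV. (1 - ?z i) * (2 * ?z i - 1))"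
      unfolding sum_distrib_right using z z01 by (intro sum_mono mult_left_mono) auto
    finally have "4 * a * ((1 - b\<^sup>2) * (2 * a\<^sup>2 - 1)) \<le> 4 * ?p * (\<Sum>i\<in>UNIV. (1 - ?z i) * (2 * ?z i - 1))"
      using p a b by (intro mult_mono) auto
    then show "\<gamma> \<le> commutator_symbol 4 \<theta>" unfolding commutator_symbol_4 \<gamma>_def .
  qed
qed

section \<open>The thresholds in closed form\<close>

lemma cos_pi_quarter: "0 < cos (pi/4 :: real)" "(cos (pi/4 :: real))\<^sup>2 = 1/2" "sqrt (1/2) = cos (pi/4)"
  by (simp_all add: cos_45 power_divide real_sqrt_divide real_div_sqrt field_simps)

lemma cheb_T_4: "cheb_T 4 x = 8 * x\<^sup>2 * (x\<^sup>2 - 1) + 1"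
  by (simp add: numeral_eq_Suc algebra_simps)

text \<open>The square of \<open>X\<^sub>q\<close> in the chain will be \<open>y (q + 1)\<close>. The shift by one makes \<open>y 0 = 0\<close>, the
  natural start of the recursion, and the chain runs from \<open>k = 1\<close> to \<open>k = n + 2\<close>.\<close>

locale threshold_angle =
  fixes n :: nat and \<phi> E :: real
  assumes \<phi>_def: "\<phi> = pi / real (n + 4)" and E_def: "E = 1 / (2 * cos \<phi>)"
begin

definition \<sigma> :: "nat \<Rightarrow> real" where "\<sigma> k = sin (real k * \<phi>)"

definition y :: "nat \<Rightarrow> real" where "y k = E * \<sigma> k / \<sigma> (Suc k)"

definition x :: "nat \<Rightarrow> real" where "x k = sqrt (y k)"

lemma \<phi>_bounds: "0 < \<phi>" "\<phi> \<le> pi / 4" "real (n + 4) * \<phi> = pi"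
proof -
  show "0 < \<phi>" "real (n + 4) * \<phi> = pi" by (simp_all add: \<phi>_def)
  show "\<phi> \<le> pi / 4" unfolding \<phi>_def by (intro divide_left_mono) auto
qed

lemma cos_\<phi>_pos: "0 < cos \<phi>"
  using \<phi>_bounds pi_gt_zero by (intro cos_gt_zero_pi) linarith+

lemma E_pos: "0 < E"
  using cos_\<phi>_pos by (simp add: E_def)

lemma \<sigma>_0 [simp]: "\<sigma> 0 = 0"
  by (simp add: \<sigma>_def)

lemma \<sigma>_pos: "1 \<le> k \<Longrightarrow> k \<le> n + 3 \<Longrightarrow> 0 < \<sigma> k"
proof -
  assume k: "1 \<le> k" "k \<le> n + 3"
  have "real k * \<phi> < real (n + 4) * \<phi>" using k \<phi>_bounds(1) by (intro mult_strict_right_mono) auto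
  also have "\<dots> = pi" by (rule \<phi>_bounds(3))
  finally show ?thesis unfolding \<sigma>_def using k \<phi>_bounds(1) by (intro sin_gt_zero mult_pos_pos) auto
qed

lemma \<sigma>_reflect: "k \<le> n + 4 \<Longrightarrow> \<sigma> (n + 4 - k) = \<sigma> k"
proof -
  assume "k \<le> n + 4"
  then have "real (n + 4 - k) * \<phi> = pi - real k * \<phi>"
    using \<phi>_bounds(3) by (simp add: of_nat_diff algebra_simps)
  then show ?thesis by (simp add: \<sigma>_def)
qed

text \<open>Addition theorem, with \<open>2 E cos \<phi> = 1\<close>.\<close>

lemma \<sigma>_recursion: "\<sigma> (Suc k) = E * (\<sigma> k + \<sigma> (Suc (Suc k)))"
proof -
  let ?t = "real (Suc k) * \<phi>"
  have "real k * \<phi> = ?t - \<phi>" "real (Suc (Suc k)) * \<phi> = ?t + \<phi>" by (simp_all add: algebra_simps)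
  then have "\<sigma> k + \<sigma> (Suc (Suc k)) = 2 * cos \<phi> * \<sigma> (Suc k)"
    unfolding \<sigma>_def by (simp only: sin_add sin_diff) simp
  then show ?thesis using cos_\<phi>_pos by (simp add: E_def)
qed

lemma y_0: "y 0 = 0"
  by (simp add: y_def)

lemma y_nonneg: "k \<le> n + 2 \<Longrightarrow> 0 \<le> y k"
  using \<sigma>_pos[of k] \<sigma>_pos[of "Suc k"] E_pos unfolding y_def by (cases "k = 0") auto

lemma y_reflect: "1 \<le> k \<Longrightarrow> k \<le> n + 3 \<Longrightarrow> y (n + 3 - k) = E * \<sigma> (Suc k) / \<sigma> k"
proof -
  assume k: "1 \<le> k" "k \<le> n + 3"
  have "n + 3 - k = n + 4 - Suc k" by simp
  then have "\<sigma> (n + 3 - k) = \<sigma> (Suc k)" using \<sigma>_reflect[of "Suc k"] k by (simp only:)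
  moreover have "\<sigma> (Suc (n + 3 - k)) = \<sigma> k"
  proof -
    have "Suc (n + 3 - k) = n + 4 - k" using k by simp
    then show ?thesis using \<sigma>_reflect[of k] k by (simp only:)
  qed
  ultimately show ?thesis by (simp add: y_def)
qed

lemma y_complement: "k \<le> n + 2 \<Longrightarrow> y k + y (n + 2 - k) = 1"
proof -
  assume k: "k \<le> n + 2"
  have "y (n + 3 - Suc k) = E * \<sigma> (Suc (Suc k)) / \<sigma> (Suc k)" using k by (intro y_reflect) auto
  then have "y k + y (n + 2 - k) = E * (\<sigma> k + \<sigma> (Suc (Suc k))) / \<sigma> (Suc k)"
    by (simp add: y_def add_divide_distrib distrib_left)
  also have "\<dots> = 1" unfolding \<sigma>_recursion[of k, symmetric] using \<sigma>_pos[of "Suc k"] k by simp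
  finally show ?thesis .
qed

text \<open>\<open>\<sigma> k \<cdot> \<sigma> (k + 2) = (\<sigma> (k + 1))\<^sup>2 - (sin \<phi>)\<^sup>2\<close>.\<close>

lemma y_strict_mono: "Suc k \<le> n + 2 \<Longrightarrow> y k < y (Suc k)"
proof -
  assume k: "Suc k \<le> n + 2"
  let ?t = "real (Suc k) * \<phi>"
  have "real k * \<phi> = ?t - \<phi>" "real (Suc (Suc k)) * \<phi> = ?t + \<phi>" by (simp_all add: algebra_simps)
  then have "\<sigma> k * \<sigma> (Suc (Suc k)) = (sin ?t * cos \<phi>)\<^sup>2 - (cos ?t * sin \<phi>)\<^sup>2"
    unfolding \<sigma>_def by (simp only: sin_add sin_diff) (simp add: algebra_simps power2_eq_square)
  also have "\<dots> = (\<sigma> (Suc k))\<^sup>2 - (sin \<phi>)\<^sup>2"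
    unfolding power_mult_distrib cos_squared_eq \<sigma>_def by (simp add: algebra_simps)
  also have "\<dots> < \<sigma> (Suc k) * \<sigma> (Suc k)"
    using sin_gt_zero[of \<phi>] \<phi>_bounds pi_gt_zero by (simp add: power2_eq_square)
  finally have "\<sigma> k / \<sigma> (Suc k) < \<sigma> (Suc k) / \<sigma> (Suc (Suc k))"
    using \<sigma>_pos[of "Suc k"] \<sigma>_pos[of "Suc (Suc k)"] k by (simp add: divide_less_eq less_divide_eq mult_ac)
  then show ?thesis unfolding y_def using E_pos by (simp flip: times_divide_eq_right)
qed

lemma y_1: "y 1 = E\<^sup>2"
  using \<sigma>_recursion[of 0] \<sigma>_pos[of 1] \<sigma>_pos[of 2] by (simp add: y_def numeral_2_eq_2 power2_eq_square)

lemma y_last: "y (n + 2) = 1"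
  using y_complement[of "n + 2"] by (simp add: y_0)

lemma x_nonneg: "k \<le> n + 2 \<Longrightarrow> 0 \<le> x k" and x_square: "k \<le> n + 2 \<Longrightarrow> (x k)\<^sup>2 = y k"
  using y_nonneg by (simp_all add: x_def)

lemma x_mult_reflect: "1 \<le> k \<Longrightarrow> k \<le> n + 2 \<Longrightarrow> x k * x (n + 3 - k) = E"
proof -
  assume k: "1 \<le> k" "k \<le> n + 2"
  have "y k * y (n + 3 - k) = E * E"
    using y_reflect[of k] k \<sigma>_pos[of k] \<sigma>_pos[of "Suc k"] by (simp add: y_def)
  then show ?thesis using E_pos by (simp add: x_def flip: real_sqrt_mult)
qed

lemma x_pos: "1 \<le> k \<Longrightarrow> k \<le> n + 2 \<Longrightarrow> 0 < x k"
  using x_mult_reflect[of k] x_nonneg[of k] E_pos by (cases "x k = 0") auto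

lemma x_strict_mono: "Suc k \<le> n + 2 \<Longrightarrow> x k < x (Suc k)"
  using y_strict_mono by (simp add: x_def)

lemma E_bounds: "1 \<le> n \<Longrightarrow> (cos (pi/4))\<^sup>2 < E" "1 \<le> n \<Longrightarrow> E < cos (pi/4)"
proof -
  assume n: "1 \<le> n"
  have "\<phi> < pi / 4" unfolding \<phi>_def using n by (intro divide_strict_left_mono) auto
  then have c: "cos (pi/4) < cos \<phi>" using \<phi>_bounds(1) by (intro cos_monotone_0_pi) auto
  have "cos \<phi> < 1" using cos_monotone_0_pi[of 0 \<phi>] \<phi>_bounds pi_gt_zero by simp
  then show "(cos (pi/4))\<^sup>2 < E" using cos_\<phi>_pos by (simp add: cos_pi_quarter E_def field_simps)
  have "2 * cos (pi/4) * cos (pi/4) < 2 * cos (pi/4) * cos \<phi>"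
    using cos_pi_quarter(1) by (intro mult_strict_left_mono[OF c]) simp
  moreover have "2 * cos (pi/4) * cos (pi/4) = (1 :: real)"
    using cos_pi_quarter(2) by (simp add: power2_eq_square)
  ultimately have "1 < 2 * cos (pi/4) * cos \<phi>" by linarith
  then show "E < cos (pi/4)" using cos_\<phi>_pos by (simp add: E_def field_simps)
qed

text \<open>The Chebyshev condition is \<open>y_complement\<close>, the product condition \<open>x_mult_reflect\<close>. The middle of the
  chain is located by the first of these: two neighbours, or one entry with itself, have squares that
  add up to \<open>1\<close>.\<close>

lemma threshold_chain_exists:
  assumes n: "1 \<le> n"
  shows "threshold_chain 4 n E (\<lambda>q. x (nat (q + 1)))"
proof -
  let ?X = "\<lambda>q :: int. x (nat (q + 1))"
  have T: "cheb_T 4 (?X q) = cheb_T 4 (?X (int n - q))" if "0 \<le> q" "q \<le> int n" for q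
  proof -
    have k: "nat (q + 1) \<le> n + 2" "nat (int n - q + 1) = n + 2 - nat (q + 1)" using that by auto
    have "y (n + 2 - nat (q + 1)) = 1 - y (nat (q + 1))" using y_complement[OF k(1)] by simp
    then have sq: "(?X (int n - q))\<^sup>2 = 1 - (?X q)\<^sup>2" unfolding k(2) using k(1) by (simp add: x_square)
    show ?thesis by (simp only: cheb_T_4 sq) (simp add: algebra_simps)
  qed
  have R: "?X (int n - q) = E / ?X (1 + q)" if "- 1 \<le> q" "q \<le> int n" for q
  proof -
    have k: "1 \<le> nat (1 + q + 1)" "nat (1 + q + 1) \<le> n + 2" "nat (int n - q + 1) = n + 3 - nat (1 + q + 1)"
      using that by auto
    show ?thesis unfolding k(3) using x_mult_reflect[OF k(1,2)] x_pos[OF k(1,2)] by (simp add: field_simps)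
  qed
  have mono: "?X q < ?X (q + 1)" if "0 \<le> q" "q \<le> int n" for q
  proof -
    have "nat (q + 1 + 1) = Suc (nat (q + 1))" using that by auto
    then show ?thesis using x_strict_mono[of "nat (q + 1)"] that by simp
  qed
  have X0: "?X 0 = E" using y_1 E_pos by (simp add: x_def)
  have Xl: "?X (int n + 1) = 1"
  proof -
    have "nat (int n + 1 + 1) = n + 2" by simp
    then show ?thesis using y_last by (simp add: x_def)
  qed
  show ?thesis
  proof (cases "odd n")
    case True
    then obtain h where h: "n = 2 * h + 1" by (elim oddE)
    have half: "(int n - 1) div 2 = int h" "(int n + 1) div 2 = int h + 1" using h by auto
    have k: "nat (int h + 1) = Suc h" "nat (int h + 1 + 1) = Suc (Suc h)" "n + 2 - Suc h = Suc (Suc h)" using h by auto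
    have "y (Suc h) + y (Suc (Suc h)) = 1" using y_complement[of "Suc h"] h k by simp
    moreover have "y (Suc h) < y (Suc (Suc h))" using y_strict_mono[of "Suc h"] h by simp
    ultimately have "y (Suc h) < 1/2" "1/2 < y (Suc (Suc h))" by linarith+
    then have "?X (int h) < cos (pi/4)" "cos (pi/4) < ?X (int h + 1)"
      unfolding k x_def cos_pi_quarter(3)[symmetric] by simp_all
    then show ?thesis
      unfolding threshold_chain_def Let_def half using True T R mono X0 Xl h by auto
  next
    case False
    then have "even n" by simp
    then obtain h where h: "n = 2 * h" by (elim evenE)
    have half: "int n div 2 = int h" using h by simp
    have k: "nat (int h + 1) = Suc h" "n + 2 - Suc h = Suc h" using h by auto
    have "y (Suc h) = 1/2" using y_complement[of "Suc h"] h k by simp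
    then have "?X (int h) = cos (pi/4)" unfolding k x_def cos_pi_quarter(3)[symmetric] by simp
    then show ?thesis
      unfolding threshold_chain_def Let_def half using False T R mono X0 Xl h by auto
  qed
qed

end

text \<open>What both parities of the chain have in common. For \<open>\<kappa> = 4\<close> and positive \<open>X < Y\<close>, equality of the
  Chebyshev values means \<open>X\<^sup>2 + Y\<^sup>2 = 1\<close>.\<close>

lemma threshold_chain_relations:
  assumes chain: "threshold_chain 4 n E X" and E: "0 < E"
  shows "X 0 = E" "X (int n + 1) = 1"
    and "\<And>q. 0 \<le> q \<Longrightarrow> q \<le> int n \<Longrightarrow> (X (q + 1))\<^sup>2 * (1 - (X q)\<^sup>2) = E\<^sup>2"
    and "\<And>q. 0 \<le> q \<Longrightarrow> q \<le> int n + 1 \<Longrightarrow> 0 < X q"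
proof -
  \<comment> \<open>The last index at which the chain states its first two conditions; reflection gives the others.\<close>
  define H :: int where "H = (if odd n then (int n - 1) div 2 else int n div 2 - 1)"
  note H = H_def
  have half: "odd n \<Longrightarrow> int n = 2 * H + 1" "even n \<Longrightarrow> int n = 2 * H + 2"
    unfolding H by (auto elim!: oddE evenE)
  have X: "X 0 = E" "X (int n + 1) = 1"
    and T: "\<And>q. 0 \<le> q \<Longrightarrow> q \<le> H \<Longrightarrow> cheb_T 4 (X q) = cheb_T 4 (X (int n - q))"
    and R0: "\<And>q. - 1 \<le> q \<Longrightarrow> q \<le> H \<Longrightarrow> X (int n - q) = E / X (1 + q)"
    using chain unfolding threshold_chain_def Let_def H by (auto split: if_splits)
  have mono: "X q < X (q + 1)" if q: "0 \<le> q" "q \<le> int n" for q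
  proof (cases "odd n")
    case True
    then have half: "(int n + 1) div 2 = (int n - 1) div 2 + 1" by (elim oddE) simp
    consider "q < (int n - 1) div 2" | "q = (int n - 1) div 2" | "(int n + 1) div 2 \<le> q" using half by linarith
    then show ?thesis
    proof cases
      case 2
      have "X ((int n - 1) div 2) < cos (pi/4)" "cos (pi/4) < X ((int n - 1) div 2 + 1)"
        using chain True unfolding threshold_chain_def Let_def half by auto
      then show ?thesis using 2 by simp
    qed (use chain True q in \<open>auto simp: threshold_chain_def Let_def\<close>)
  qed (use chain q in \<open>auto simp: threshold_chain_def Let_def\<close>)
  have pos: "0 < X q" if "0 \<le> q" "q \<le> int n + 1" for q
    using that
  proof (induction q rule: int_ge_induct)
    case base
    then show ?case using X E by simp
  next
    case (step q)
    then show ?case using mono[of q] by simp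
  qed
  have mono': "X p < X q" if "0 \<le> p" "p < q" "q \<le> int n + 1" for p q
  proof -
    have "p + 1 \<le> q" using that by simp
    then show ?thesis using that(3)
    proof (induction q rule: int_ge_induct)
      case base
      then show ?case using mono[of p] that by simp
    next
      case (step q)
      then show ?case using mono[of q] that by simp
    qed
  qed
  have M1: "(X q)\<^sup>2 + (X (int n - q))\<^sup>2 = 1" if q: "0 \<le> q" "q \<le> H" for q
  proof -
    let ?a = "(X q)\<^sup>2" and ?b = "(X (int n - q))\<^sup>2"
    have lt: "q < int n - q" using q half by (cases "odd n") auto
    have "0 < X q" "X q < X (int n - q)" using pos[of q] mono'[of q "int n - q"] q lt by auto
    then have "?a \<noteq> ?b" using power_strict_mono[of "X q" "X (int n - q)" 2] by simp
    moreover have "(?a - ?b) * (?a + ?b - 1) = 0" using T[OF q] unfolding cheb_T_4 by (simp add: algebra_simps)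
    ultimately show ?thesis by simp
  qed
  have M: "(X q)\<^sup>2 + (X (int n - q))\<^sup>2 = 1" if q: "0 \<le> q" "q \<le> int n" for q
  proof -
    have "q \<le> H \<or> int n - q \<le> H \<or> even n \<and> q = int n div 2"
    proof (cases "odd n")
      case True
      then show ?thesis using half(1) by linarith
    next
      case False
      then show ?thesis using half(2) by auto
    qed
    then consider "q \<le> H" | "int n - q \<le> H" | "even n" "q = int n div 2" by blast
    then show ?thesis
    proof cases
      case 1
      then show ?thesis using M1 q by simp
    next
      case 2
      then show ?thesis using M1[of "int n - q"] q by (simp add: add.commute)
    next
      case 3
      then have "X q = cos (pi/4)" using chain by (auto simp: threshold_chain_def Let_def)
      moreover have "int n - q = q" using 3 by (auto elim!: evenE)
      ultimately show ?thesis by (simp add: cos_pi_quarter)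
    qed
  qed
  have R: "X (int n - q) * X (1 + q) = E" if q: "- 1 \<le> q" "q \<le> int n" for q
  proof -
    have *: "X (int n - q) * X (1 + q) = E" if "- 1 \<le> q" "q \<le> H" "q \<le> int n" for q
      using R0[OF that(1,2)] pos[of "1 + q"] that by simp
    have "q \<le> H \<or> int n - 1 - q \<le> H" using half by (cases "odd n") auto
    then consider "q \<le> H" | "int n - 1 - q \<le> H" by blast
    then show ?thesis
    proof cases
      case 1
      then show ?thesis using *[of q] q by simp
    next
      case 2
      have "int n - (int n - 1 - q) = 1 + q" "1 + (int n - 1 - q) = int n - q" by simp_all
      then show ?thesis using *[of "int n - 1 - q"] 2 q by (simp add: mult.commute)
    qed
  qed
  show "X 0 = E" "X (int n + 1) = 1" by (fact X)+
  show "0 < X q" if "0 \<le> q" "q \<le> int n + 1" for q using pos that .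
  show "(X (q + 1))\<^sup>2 * (1 - (X q)\<^sup>2) = E\<^sup>2" if q: "0 \<le> q" "q \<le> int n" for q
  proof -
    have "1 - (X q)\<^sup>2 = (X (int n - q))\<^sup>2" using M[OF q] by simp
    then show ?thesis using R[of q] q by (simp add: add.commute mult.commute flip: power_mult_distrib)
  qed
qed

text \<open>The relation \<open>y\<^bsub>q+1\<^esub> (1 - y\<^sub>q) = E\<^sup>2\<close> is a Moebius recursion with eigenvalues \<open>E e\<^bsup>\<plusminus>i \<phi>\<^esup>\<close>, where
  \<open>2 E cos \<phi> = 1\<close>. Its orbit from \<open>E\<^sup>2\<close> is \<open>E sin ((q + 1) \<phi>) / sin ((q + 2) \<phi>)\<close>; it stays positive only
  while \<open>(q + 2) \<phi> < \<pi>\<close>, and it reaches \<open>1\<close> exactly at a zero of \<open>sin ((q + 3) \<phi>)\<close>.\<close>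

lemma threshold_chain_unique:
  assumes E: "(cos (pi/4))\<^sup>2 < E" "E < cos (pi/4)" and chain: "threshold_chain 4 n E X"
  shows "E = 1 / (2 * cos (pi / real (n + 4)))"
proof -
  have E0: "1/2 < E" using E by (simp add: cos_pi_quarter)
  note rel = threshold_chain_relations[OF chain]
  define \<phi> where "\<phi> = arccos (1 / (2 * E))"
  have "cos (pi/4) < 1 / (2 * E)"
  proof -
    have "cos (pi/4) * (2 * E) < cos (pi/4) * (2 * cos (pi/4))"
      using E cos_pi_quarter(1) by (intro mult_strict_left_mono) auto
    also have "\<dots> = 1" using cos_pi_quarter(2) by (simp add: power2_eq_square)
    finally show ?thesis using E0 by (simp add: field_simps)
  qed
  moreover have e: "1 / (2 * E) < 1" "0 < 1 / (2 * E)" using E0 by auto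
  moreover from e(2) have e': "- 1 \<le> 1 / (2 * E)" by linarith
  ultimately have \<phi>: "cos \<phi> = 1 / (2 * E)" "0 < \<phi>" "\<phi> < pi / 4"
  proof -
    show c: "cos \<phi> = 1 / (2 * E)" unfolding \<phi>_def by (intro cos_arccos) (use e in linarith)+
    show "0 < \<phi>" unfolding \<phi>_def using arccos_less_arccos[OF e' e(1) order_refl] by simp
    show "\<phi> < pi / 4" unfolding \<phi>_def
      using e \<open>cos (pi/4) < 1 / (2 * E)\<close> arccos_less_arccos[of "cos (pi/4)" "1 / (2 * E)"] cos_pi_quarter(1)
      by (simp add: arccos_cos)
  qed
  have rec: "sin (t + \<phi>) = E * (sin t + sin (t + 2 * \<phi>))" for t
  proof -
    have "sin t + sin (t + 2 * \<phi>) = sin ((t + \<phi>) - \<phi>) + sin ((t + \<phi>) + \<phi>)" by (simp add: add.assoc)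
    also have "\<dots> = 2 * cos \<phi> * sin (t + \<phi>)" by (simp only: sin_add[of "t + \<phi>"] sin_diff[of "t + \<phi>"]) simp
    finally show ?thesis using \<phi>(1) E0 by simp
  qed
  have orbit: "(X (int k))\<^sup>2 = E * sin (real (k + 1) * \<phi>) / sin (real (k + 2) * \<phi>) \<and> real (k + 2) * \<phi> < pi"
    if "k \<le> n + 1" for k
    using that
  proof (induction k)
    case 0
    have "sin \<phi> \<noteq> 0" using sin_gt_zero[of \<phi>] \<phi> pi_gt_zero by auto
    moreover have "sin (2 * \<phi>) = sin \<phi> / E" unfolding sin_double \<phi>(1) by simp
    ultimately have "E * sin \<phi> / sin (2 * \<phi>) = E\<^sup>2" using E0 by (simp add: power2_eq_square)
    then show ?case using rel(1) E0 \<phi> pi_gt_zero by simp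
  next
    case (Suc k)
    let ?t = "real (k + 1) * \<phi>"
    have args: "real (k + 2) * \<phi> = ?t + \<phi>" "real (Suc k + 1) * \<phi> = ?t + \<phi>" "real (Suc k + 2) * \<phi> = ?t + 2 * \<phi>"
      by (simp_all add: algebra_simps)
    have IH: "(X (int k))\<^sup>2 = E * sin ?t / sin (?t + \<phi>)" "?t + \<phi> < pi"
      using Suc unfolding args by auto
    have t0: "0 < ?t" using \<phi> by simp
    have s1: "0 < sin (?t + \<phi>)" by (rule sin_gt_zero[OF add_pos_pos[OF t0 \<phi>(2)] IH(2)])
    have "1 - (X (int k))\<^sup>2 = (sin (?t + \<phi>) - E * sin ?t) / sin (?t + \<phi>)"
      unfolding IH(1) using s1 by (simp add: diff_divide_distrib)
    also have "sin (?t + \<phi>) - E * sin ?t = E * sin (?t + 2 * \<phi>)" using rec[of ?t] by (simp add: algebra_simps)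
    finally have gap: "1 - (X (int k))\<^sup>2 = E * sin (?t + 2 * \<phi>) / sin (?t + \<phi>)" .
    have prod: "(X (int (Suc k)))\<^sup>2 * (1 - (X (int k))\<^sup>2) = E\<^sup>2"
      using rel(3)[of "int k"] Suc.prems E0 by (simp add: add.commute)
    moreover have "0 < (X (int (Suc k)))\<^sup>2" using rel(4)[of "int (Suc k)"] Suc.prems E0 by simp
    ultimately have "0 < 1 - (X (int k))\<^sup>2" using E0 by (metis zero_less_mult_pos zero_less_power less_trans zero_less_divide_1_iff zero_less_numeral)
    then have s2: "0 < sin (?t + 2 * \<phi>)" unfolding gap using s1 E0 by (simp add: zero_less_divide_iff zero_less_mult_iff)
    have "?t + 2 * \<phi> < pi"
    proof (rule ccontr)
      assume "\<not> ?thesis"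
      moreover have "?t + 2 * \<phi> \<le> 2 * pi" using IH(2) \<phi>(3) pi_gt_zero by linarith
      ultimately have "sin (?t + 2 * \<phi>) \<le> 0"
        using sin_ge_zero[of "?t + 2 * \<phi> - pi"] by (simp add: sin_diff)
      then show False using s2 by simp
    qed
    moreover have "(X (int (Suc k)))\<^sup>2 = E * sin (?t + \<phi>) / sin (?t + 2 * \<phi>)"
      using prod s1 s2 E0 unfolding gap by (simp add: field_simps power2_eq_square)
    ultimately show ?case unfolding args by simp
  qed
  let ?t = "real (n + 2) * \<phi>"
  have args: "real (n + 1 + 1) * \<phi> = ?t" "real (n + 1 + 2) * \<phi> = ?t + \<phi>" by (simp_all add: algebra_simps)
  have last: "(X (int (n + 1)))\<^sup>2 = E * sin ?t / sin (?t + \<phi>)" "?t + \<phi> < pi"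
    using orbit[of "n + 1"] unfolding args by auto
  have t0: "0 < ?t" using \<phi> by simp
  have s1: "0 < sin (?t + \<phi>)" by (rule sin_gt_zero[OF add_pos_pos[OF t0 \<phi>(2)] last(2)])
  have "X (int (n + 1)) = 1" using rel(2) E0 by (simp add: add.commute)
  then have "E * sin ?t = sin (?t + \<phi>)" using last(1) s1 by (simp add: field_simps)
  then have zero: "sin (?t + 2 * \<phi>) = 0" using rec[of ?t] E0 by (simp add: algebra_simps)
  have "?t + 2 * \<phi> = pi"
  proof (rule ccontr)
    assume "?t + 2 * \<phi> \<noteq> pi"
    then consider "?t + 2 * \<phi> < pi" | "0 < ?t + 2 * \<phi> - pi" by linarith
    then show False
    proof cases
      case 1
      moreover have "0 < ?t + 2 * \<phi>" using t0 \<phi>(2) by linarith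
      ultimately show False using zero sin_gt_zero[of "?t + 2 * \<phi>"] by linarith
    next
      case 2
      moreover have "?t + 2 * \<phi> - pi < pi" using last(2) \<phi>(3) pi_gt_zero by linarith
      ultimately show False using zero sin_gt_zero[of "?t + 2 * \<phi> - pi"] by (simp add: sin_diff)
    qed
  qed
  then have angle: "\<phi> = pi / real (n + 4)" by (simp add: field_simps)
  show ?thesis unfolding angle[symmetric] \<phi>(1) by simp
qed

lemma threshold_eq:
  assumes n: "1 \<le> n"
  shows "threshold 4 n = 1 / (2 * cos (pi / real (n + 4)))"
proof -
  interpret threshold_angle n "pi / real (n + 4)" "1 / (2 * cos (pi / real (n + 4)))" by unfold_locales auto
  show ?thesis
    unfolding threshold_def
  proof (rule the_equality)
    show "1 / (2 * cos (pi / real (n + 4))) \<in> {(cos (pi / real 4))\<^sup>2<..<cos (pi / real 4)} \<and>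
        (\<exists>X. threshold_chain 4 n (1 / (2 * cos (pi / real (n + 4)))) X)"
      using E_bounds[OF n] threshold_chain_exists[OF n] by auto
  qed (use threshold_chain_unique in auto)
qed

lemma threshold_strict_antimono:
  assumes n: "1 \<le> n"
  shows "threshold 4 (Suc n) < threshold 4 n"
proof -
  let ?a = "pi / real (n + 4)" and ?b = "pi / real (Suc n + 4)"
  have b: "0 < ?b" "?b < ?a" by (simp, intro divide_strict_left_mono) auto
  have a: "?a < pi / 2" by (intro divide_strict_left_mono) auto
  have c: "0 < cos ?a" by (intro cos_gt_zero_pi) (use a b pi_gt_zero in linarith)+
  have "cos ?a < cos ?b" by (intro cos_monotone_0_pi) (use a b pi_gt_zero in linarith)+
  then have "1 / (2 * cos ?b) < 1 / (2 * cos ?a)" using c by (intro divide_strict_left_mono) auto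
  then show ?thesis using threshold_eq[OF n] threshold_eq[of "Suc n"] by simp
qed

lemma threshold_tendsto: "threshold 4 \<longlonglongrightarrow> (cos (pi/4))\<^sup>2"
proof -
  have "(\<lambda>n. pi / real (n + 4)) \<longlonglongrightarrow> 0" using LIMSEQ_ignore_initial_segment[OF lim_const_over_n[of pi]] .
  then have "(\<lambda>n. 1 / (2 * cos (pi / real (n + 4)))) \<longlonglongrightarrow> 1 / (2 * cos 0)"
    by (intro tendsto_divide tendsto_mult tendsto_const tendsto_cos) auto
  moreover have "eventually (\<lambda>n. 1 / (2 * cos (pi / real (n + 4))) = threshold 4 n) sequentially"
    using eventually_ge_at_top[of 1] by eventually_elim (simp add: threshold_eq)
  ultimately show ?thesis unfolding cos_pi_quarter(2) using Lim_transform_eventually by fastforce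
qed

section \<open>An obstruction at the thresholds\<close>

text \<open>The estimate makes the series of symbols positive at each of the points. Their weighted sum can be
  formed term by term, and there it cancels.\<close>

lemma not_in_mu_setI:
  assumes \<kappa>: "0 < \<kappa>" and I: "finite I" "I \<noteq> {}" and w: "\<And>k. k \<in> I \<Longrightarrow> 0 < w k"
    and level: "\<And>k. k \<in> I \<Longrightarrow> (\<Prod>i\<in>UNIV. cos (\<Theta> k i)) = E"
    and balance: "\<And>j. (\<Sum>k\<in>I. w k * commutator_symbol (Suc j * \<kappa>) (\<Theta> k :: 'd::finite \<Rightarrow> real)) = 0"
  shows "E \<notin> mu_set TYPE('d) \<kappa>"
proof
  assume "E \<in> mu_set TYPE('d) \<kappa>"
  then obtain \<rho> where \<rho>: "summable (\<lambda>j. \<bar>\<rho> (Suc j)\<bar>)"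
    "\<And>\<theta> :: 'd \<Rightarrow> real. (\<Prod>i\<in>UNIV. cos (\<theta> i)) = E \<Longrightarrow> 0 < (\<Sum>j. \<rho> (Suc j) * commutator_symbol (Suc j * \<kappa>) \<theta>)"
    by (rule mu_set_symbol_positive[OF _ \<kappa>]) blast
  have sum: "summable (\<lambda>j. \<rho> (Suc j) * commutator_symbol (Suc j * \<kappa>) \<theta>)" for \<theta> :: "'d \<Rightarrow> real"
  proof (rule summable_comparison_test'[OF summable_mult2[OF \<rho>(1), of "real CARD('d)"]])
    fix j
    show "norm (\<rho> (Suc j) * commutator_symbol (Suc j * \<kappa>) \<theta>) \<le> \<bar>\<rho> (Suc j)\<bar> * real CARD('d)"
      unfolding real_norm_def abs_mult by (intro mult_left_mono abs_commutator_symbol_le) simp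
  qed
  have "0 < (\<Sum>k\<in>I. w k * (\<Sum>j. \<rho> (Suc j) * commutator_symbol (Suc j * \<kappa>) (\<Theta> k)))"
    using I w level \<rho>(2) by (intro sum_pos mult_pos_pos) auto
  also have "\<dots> = (\<Sum>k\<in>I. \<Sum>j. w k * (\<rho> (Suc j) * commutator_symbol (Suc j * \<kappa>) (\<Theta> k)))"
    by (intro sum.cong refl suminf_mult[symmetric] sum)
  also have "\<dots> = (\<Sum>j. \<Sum>k\<in>I. w k * (\<rho> (Suc j) * commutator_symbol (Suc j * \<kappa>) (\<Theta> k)))"
    by (intro suminf_sum[symmetric] summable_mult sum)
  also have "\<dots> = (\<Sum>j. \<rho> (Suc j) * (\<Sum>k\<in>I. w k * commutator_symbol (Suc j * \<kappa>) (\<Theta> k)))"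
    by (simp only: sum_distrib_left mult.left_commute)
  also have "\<dots> = 0" unfolding balance by simp
  finally show False by simp
qed

definition triple :: "real \<Rightarrow> real \<Rightarrow> real \<Rightarrow> 3 \<Rightarrow> real" where
  "triple a b c = (\<lambda>i. if i = 1 then a else if i = 2 then b else c)"

lemma prod_cos_triple: "(\<Prod>i\<in>UNIV. cos (triple a b c i)) = cos a * cos b * cos c"
  unfolding UNIV_3 by (simp add: triple_def)

lemma commutator_symbol_triple:
  "commutator_symbol m (triple a b c) = sin (real m * a) * sin a * (cos b * cos c)
    + sin (real m * b) * sin b * (cos a * cos c) + sin (real m * c) * sin c * (cos a * cos b)"
proof -
  have "- {1 :: 3} = {2, 3}" "- {2 :: 3} = {1, 3}" "- {3 :: 3} = {1, 2}"
    unfolding set_eq_iff forall_3 by simp_all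
  then show ?thesis unfolding commutator_symbol_def sum_3 by (simp add: triple_def)
qed

context threshold_angle
begin

definition \<theta> :: "nat \<Rightarrow> real" where "\<theta> k = arccos (x k)"

lemma x_le_1: "k \<le> n + 2 \<Longrightarrow> x k \<le> 1"
  using y_complement[of k] y_nonneg[of "n + 2 - k"] by (simp add: x_def)

lemma cos_\<theta>: "k \<le> n + 2 \<Longrightarrow> cos (\<theta> k) = x k"
  unfolding \<theta>_def using x_nonneg[of k] x_le_1[of k] by (intro cos_arccos) auto

lemma sin_\<theta>: "k \<le> n + 2 \<Longrightarrow> sin (\<theta> k) = x (n + 2 - k)"
proof -
  assume k: "k \<le> n + 2"
  have "sin (\<theta> k) = sqrt (1 - (x k)\<^sup>2)"
    unfolding \<theta>_def using x_nonneg[OF k] x_le_1[OF k] by (intro sin_arccos) auto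
  also have "1 - (x k)\<^sup>2 = y (n + 2 - k)" using y_complement[OF k] x_square[OF k] by simp
  finally show ?thesis by (simp add: x_def)
qed

lemma \<theta>_complement: "k \<le> n + 2 \<Longrightarrow> \<theta> (n + 2 - k) = pi / 2 - \<theta> k"
proof -
  assume k: "k \<le> n + 2"
  have "0 \<le> \<theta> k" "\<theta> k \<le> pi / 2"
    unfolding \<theta>_def using x_nonneg[OF k] x_le_1[OF k] by (simp add: arccos_lbound, intro arccos_le_pi2)
  moreover have "\<theta> (n + 2 - k) = arccos (cos (pi / 2 - \<theta> k))"
    using sin_\<theta>[OF k] unfolding \<theta>_def[of "n + 2 - k"] by (simp add: cos_diff)
  ultimately show ?thesis by (simp add: arccos_cos)
qed

lemma sin_multiple_\<theta>_complement: "k \<le> n + 2 \<Longrightarrow> sin (real (j * 4) * \<theta> (n + 2 - k)) = - sin (real (j * 4) * \<theta> k)"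
proof -
  assume "k \<le> n + 2"
  then have "real (j * 4) * \<theta> (n + 2 - k) = 2 * real j * pi - real (j * 4) * \<theta> k"
    by (simp only: \<theta>_complement) (simp add: algebra_simps)
  then show ?thesis by (simp only: sin_diff sin_2npi cos_2npi)
qed

definition weight :: "nat \<Rightarrow> real" where "weight k = \<sigma> k * \<sigma> (Suc k)"

text \<open>The weighted symbol at the pair number \<open>k + 1\<close> is \<open>cos \<psi> (flux (k + 1) s\<^bsub>k+1\<^esub> - flux k s\<^sub>k)\<close>, where
  \<open>s\<^sub>k = sin (4 j \<theta>\<^sub>k)\<close> and \<open>\<psi>\<close> is the third angle: the two lemmas below show that what enters one pair leaves the previous one. It
  vanishes at both ends, where a factor \<open>\<sigma> 0\<close> or \<open>\<sigma> (n + 4)\<close> occurs.\<close>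

definition flux :: "nat \<Rightarrow> real" where "flux k = E * \<sigma> (Suc k) * sqrt (\<sigma> k * \<sigma> (Suc (Suc k)))"

lemma x_mult_Suc: "Suc k \<le> n + 2 \<Longrightarrow> weight (Suc k) * (x k * x (Suc k)) = flux k"
proof -
  assume k: "Suc k \<le> n + 2"
  have s: "0 < \<sigma> (Suc k)" "0 < \<sigma> (Suc (Suc k))" using \<sigma>_pos k by auto
  have "x k * x (Suc k) = sqrt (E\<^sup>2 * (\<sigma> k * \<sigma> (Suc (Suc k))) / (\<sigma> (Suc (Suc k)))\<^sup>2)"
    unfolding x_def real_sqrt_mult[symmetric] y_def using s by (simp add: power2_eq_square field_simps)
  also have "\<dots> = E * sqrt (\<sigma> k * \<sigma> (Suc (Suc k))) / \<sigma> (Suc (Suc k))"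
    using E_pos s by (simp only: real_sqrt_divide real_sqrt_mult[of "E\<^sup>2"] real_sqrt_abs abs_of_pos)
  finally show ?thesis using s by (simp add: weight_def flux_def)
qed

lemma x_mult_reflected: "1 \<le> k \<Longrightarrow> k \<le> n + 2 \<Longrightarrow> weight k * (x (n + 2 - k) * x (n + 3 - k)) = flux k"
proof -
  assume k: "1 \<le> k" "k \<le> n + 2"
  have s: "0 < \<sigma> (Suc k)" "0 < \<sigma> k" using \<sigma>_pos k by auto
  have y1: "y (n + 2 - k) = E * \<sigma> (Suc (Suc k)) / \<sigma> (Suc k)" using y_reflect[of "Suc k"] k by simp
  have y2: "y (n + 3 - k) = E * \<sigma> (Suc k) / \<sigma> k" using y_reflect[of k] k by simp
  have "x (n + 2 - k) * x (n + 3 - k) = sqrt (E\<^sup>2 * (\<sigma> k * \<sigma> (Suc (Suc k))) / (\<sigma> k)\<^sup>2)"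
    unfolding x_def real_sqrt_mult[symmetric] y1 y2 using s by (simp add: power2_eq_square field_simps)
  also have "\<dots> = E * sqrt (\<sigma> k * \<sigma> (Suc (Suc k))) / \<sigma> k"
    using E_pos s by (simp only: real_sqrt_divide real_sqrt_mult[of "E\<^sup>2"] real_sqrt_abs abs_of_pos)
  finally show ?thesis using s by (simp add: weight_def flux_def)
qed

lemma weighted_symbols_cancel:
  assumes \<psi>: "\<And>j. sin (real (j * 4) * \<psi>) * sin \<psi> = 0"
  shows "(\<Sum>k\<in>{1..n + 2}. weight k * commutator_symbol (j * 4) (triple (\<theta> k) (\<theta> (n + 3 - k)) \<psi>)) = 0"
proof -
  let ?s = "\<lambda>k. sin (real (j * 4) * \<theta> k)"
  have step: "weight (Suc k) * commutator_symbol (j * 4) (triple (\<theta> (Suc k)) (\<theta> (n + 3 - Suc k)) \<psi>)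
      = cos \<psi> * (flux (Suc k) * ?s (Suc k) - flux k * ?s k)" if k: "k < n + 2" for k
  proof -
    have k': "n + 3 - Suc k = n + 2 - k" "n + 2 - (n + 2 - k) = k" using k by auto
    have s: "?s (n + 2 - k) = - ?s k" using sin_multiple_\<theta>_complement[of k j] k by simp
    have "commutator_symbol (j * 4) (triple (\<theta> (Suc k)) (\<theta> (n + 3 - Suc k)) \<psi>)
        = cos \<psi> * (?s (Suc k) * (x (n + 2 - Suc k) * x (n + 3 - Suc k)) - ?s k * (x k * x (Suc k)))"
      unfolding commutator_symbol_triple \<psi> k'(1) s
      using k cos_\<theta>[of "Suc k"] cos_\<theta>[of "n + 2 - k"] sin_\<theta>[of "Suc k"] sin_\<theta>[of "n + 2 - k"]
      by (simp add: k'(2) algebra_simps)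
    then have "weight (Suc k) * commutator_symbol (j * 4) (triple (\<theta> (Suc k)) (\<theta> (n + 3 - Suc k)) \<psi>)
        = cos \<psi> * (?s (Suc k) * (weight (Suc k) * (x (n + 2 - Suc k) * x (n + 3 - Suc k)))
          - ?s k * (weight (Suc k) * (x k * x (Suc k))))"
      by (simp only: right_diff_distrib mult_ac)
    then show ?thesis
      using x_mult_Suc[of k] x_mult_reflected[of "Suc k"] k by (simp add: mult.commute)
  qed
  have "(\<Sum>k\<in>{1..n + 2}. weight k * commutator_symbol (j * 4) (triple (\<theta> k) (\<theta> (n + 3 - k)) \<psi>))
      = (\<Sum>k<n + 2. weight (Suc k) * commutator_symbol (j * 4) (triple (\<theta> (Suc k)) (\<theta> (n + 3 - Suc k)) \<psi>))"
    using sum.shift_bounds_Suc_ivl[of "\<lambda>k. weight k * commutator_symbol (j * 4) (triple (\<theta> k) (\<theta> (n + 3 - k)) \<psi>)" 0 "n + 2"]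
    by (simp only: atLeastLessThanSuc_atLeastAtMost lessThan_atLeast0 One_nat_def)
  also have "\<dots> = (\<Sum>k<n + 2. cos \<psi> * (flux (Suc k) * ?s (Suc k) - flux k * ?s k))"
    by (intro sum.cong refl step) simp
  also have "\<dots> = cos \<psi> * (flux (n + 2) * ?s (n + 2) - flux 0 * ?s 0)"
    unfolding sum_distrib_left[symmetric] by (subst sum_lessThan_telescope) (rule refl)
  also have "\<dots> = 0"
    using \<sigma>_reflect[of "n + 4"] by (simp add: flux_def numeral_eq_Suc)
  finally show ?thesis .
qed

lemma E_times_cos_in_Theta_set:
  assumes \<psi>: "\<And>j. sin (real (j * 4) * \<psi>) * sin \<psi> = 0"
  shows "E * cos \<psi> \<in> Theta_set TYPE(3) 4"
proof -
  let ?\<Theta> = "\<lambda>k. triple (\<theta> k) (\<theta> (n + 3 - k)) \<psi>"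
  have level: "(\<Prod>i\<in>UNIV. cos (?\<Theta> k i)) = E * cos \<psi>" if "k \<in> {1..n + 2}" for k
  proof -
    have "n + 3 - k \<le> n + 2" using that by auto
    from cos_\<theta>[OF this] show ?thesis
      unfolding prod_cos_triple using that cos_\<theta>[of k] x_mult_reflect[of k] by simp
  qed
  have "E * cos \<psi> \<notin> mu_set TYPE(3) 4"
  proof (rule not_in_mu_setI[where I = "{1..n + 2}" and w = weight and \<Theta> = ?\<Theta>])
    show "0 < weight k" if "k \<in> {1..n + 2}" for k
      unfolding weight_def using that \<sigma>_pos[of k] \<sigma>_pos[of "Suc k"] by simp
    show "(\<Sum>k\<in>{1..n + 2}. weight k * commutator_symbol (Suc j * 4) (?\<Theta> k)) = 0" for j
      by (rule weighted_symbols_cancel[OF \<psi>])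
  qed (use level in auto)
  moreover have "complex_of_real (E * cos \<psi>) \<in> oper_spectrum (MV :: (int^3) oper)"
  proof -
    have "(\<Prod>i\<in>UNIV. cos (?\<Theta> 1 i)) = E * cos \<psi>" by (rule level) simp
    then show ?thesis using laurent_symbol_in_spectrum[OF laurent_MV, of "?\<Theta> 1"] by (simp only:)
  qed
  ultimately show ?thesis by (simp add: Theta_set_def)
qed

end

lemma threshold_in_Theta_set:
  assumes n: "1 \<le> n"
  shows "threshold 4 n \<in> Theta_set TYPE(3) 4" "threshold 4 n * cos (pi/4) \<in> Theta_set TYPE(3) 4"
proof -
  interpret threshold_angle n "pi / real (n + 4)" "threshold 4 n"
    by unfold_locales (auto simp: threshold_eq[OF n])
  show "threshold 4 n \<in> Theta_set TYPE(3) 4" using E_times_cos_in_Theta_set[of 0] by simp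
  show "threshold 4 n * cos (pi/4) \<in> Theta_set TYPE(3) 4"
  proof (rule E_times_cos_in_Theta_set)
    fix j
    have "real (j * 4) * (pi/4) = real j * pi" by simp
    then show "sin (real (j * 4) * (pi/4)) * sin (pi/4) = 0" by (simp only: sin_npi)
  qed
qed

lemma threshold_bounds:
  assumes n: "1 \<le> n"
  shows "(cos (pi/4))\<^sup>2 < threshold 4 n" "threshold 4 n < cos (pi/4)"
proof -
  interpret threshold_angle n "pi / real (n + 4)" "threshold 4 n"
    by unfold_locales (auto simp: threshold_eq[OF n])
  show "(cos (pi/4))\<^sup>2 < threshold 4 n" "threshold 4 n < cos (pi/4)" by (rule E_bounds[OF n])+
qed

lemma theta0_set_dim3: "a \<le> \<kappa> \<Longrightarrow> b \<le> \<kappa> \<Longrightarrow> c \<le> \<kappa> \<Longrightarrow>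
  cos (real a * pi / real \<kappa>) * cos (real b * pi / real \<kappa>) * cos (real c * pi / real \<kappa>) \<in> theta0_set TYPE(3) \<kappa>"
proof -
  assume le: "a \<le> \<kappa>" "b \<le> \<kappa>" "c \<le> \<kappa>"
  let ?j = "\<lambda>i :: 3. if i = 1 then a else if i = 2 then b else c"
  have "(\<Prod>q\<in>UNIV. cos (real (?j q) * pi / real \<kappa>))
      = cos (real a * pi / real \<kappa>) * cos (real b * pi / real \<kappa>) * cos (real c * pi / real \<kappa>)"
    unfolding UNIV_3 by simp
  moreover have "\<forall>q. ?j q \<in> {0..\<kappa>}" using le by simp
  ultimately show ?thesis unfolding theta0_set_def by (intro CollectI exI[of _ ?j]) simp
qed

lemma theta0_set_members: "{0, cos (pi/4) ^ 3, (cos (pi/4))\<^sup>2, cos (pi/4), 1} \<subseteq> theta0_set TYPE(3) 4"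
  using theta0_set_dim3[of 2 4 0 0] theta0_set_dim3[of 1 4 1 1] theta0_set_dim3[of 1 4 1 0]
    theta0_set_dim3[of 1 4 0 0] theta0_set_dim3[of 0 4 0 0]
  by (simp add: power3_eq_cube power2_eq_square)

theorem theorem1p14:
  "{cos (pi/4)<..<1} \<subseteq> mu_set TYPE(3) 4
   \<and> {0, cos (pi/4) ^ 3, (cos (pi/4))\<^sup>2, cos (pi/4), 1} \<subseteq> theta0_set TYPE(3) 4
   \<and> (threshold 4 ` {1..} \<subseteq> {(cos (pi/4))\<^sup>2<..<cos (pi/4)} \<inter> Theta_set TYPE(3) 4
      \<and> (\<forall>n\<ge>1. threshold 4 (Suc n) < threshold 4 n)
      \<and> threshold 4 \<longlonglongrightarrow> (cos (pi/4))\<^sup>2)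
   \<and> ((\<lambda>n. threshold 4 n * cos (pi/4)) ` {1..}
        \<subseteq> {cos (pi/4) ^ 3<..<(cos (pi/4))\<^sup>2} \<inter> Theta_set TYPE(3) 4
      \<and> (\<forall>n\<ge>1. threshold 4 (Suc n) * cos (pi/4) < threshold 4 n * cos (pi/4))
      \<and> (\<lambda>n. threshold 4 n * cos (pi/4)) \<longlonglongrightarrow> cos (pi/4) ^ 3)"
proof (intro conjI)
  note c = cos_pi_quarter(1)
  show "{cos (pi/4)<..<1} \<subseteq> mu_set TYPE(3) 4" by (rule mu_set_above_cos_pi_quarter)
  show "{0, cos (pi/4) ^ 3, (cos (pi/4))\<^sup>2, cos (pi/4), 1} \<subseteq> theta0_set TYPE(3) 4" by (rule theta0_set_members)
  show "threshold 4 ` {1..} \<subseteq> {(cos (pi/4))\<^sup>2<..<cos (pi/4)} \<inter> Theta_set TYPE(3) 4"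
    using threshold_bounds threshold_in_Theta_set(1) by auto
  show "\<forall>n\<ge>1. threshold 4 (Suc n) < threshold 4 n" using threshold_strict_antimono by blast
  show "threshold 4 \<longlonglongrightarrow> (cos (pi/4))\<^sup>2" by (rule threshold_tendsto)
  show "(\<lambda>n. threshold 4 n * cos (pi/4)) ` {1..} \<subseteq> {cos (pi/4) ^ 3<..<(cos (pi/4))\<^sup>2} \<inter> Theta_set TYPE(3) 4"
  proof
    fix e assume "e \<in> (\<lambda>n. threshold 4 n * cos (pi/4)) ` {1..}"
    then obtain n where n: "1 \<le> n" "e = threshold 4 n * cos (pi/4)" by auto
    have "(cos (pi/4))\<^sup>2 * cos (pi/4) < e" "e < cos (pi/4) * cos (pi/4)"
      unfolding n(2) using threshold_bounds[OF n(1)] c by (auto intro: mult_strict_right_mono)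
    then show "e \<in> {cos (pi/4) ^ 3<..<(cos (pi/4))\<^sup>2} \<inter> Theta_set TYPE(3) 4"
      using threshold_in_Theta_set(2)[OF n(1)] n(2) by (simp add: power3_eq_cube power2_eq_square)
  qed
  show "\<forall>n\<ge>1. threshold 4 (Suc n) * cos (pi/4) < threshold 4 n * cos (pi/4)"
    using threshold_strict_antimono c by (auto intro: mult_strict_right_mono)
  show "(\<lambda>n. threshold 4 n * cos (pi/4)) \<longlonglongrightarrow> cos (pi/4) ^ 3"
    using tendsto_mult[OF threshold_tendsto tendsto_const[of "cos (pi/4)"]]
    by (simp add: power3_eq_cube power2_eq_square)
qed

end
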